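(* Let $B(z_1,\dots,z_d)$ be a power series with nonnegative coefficients, of full rank, aperiodic, and convergent on a neighborhood $\Omega$ of $\mathbf{0}$. Let $K(\mathbf{t})=\log B(e^{\mathbf{t}})$ and $\Psi=\{\mathbf{t}\in\mathbb{R}^d:e^{\mathbf{t}}\in\Omega\}$. Let $\boldsymbol\lambda$ be a vector of positive reals such that $K(\mathbf{t})-\boldsymbol\lambda^T\mathbf{t}$ does not tend to its infimum on the boundary of $\Psi$; let $\boldsymbol\tau$ be the unique point of $\Psi$ where it is minimal and $\boldsymbol\zeta=e^{\boldsymbol\tau}$. Assume $\zeta_j\le1$ for all $j$; let $\mathcal{S}=\{j:\zeta_j<1\}$ and $\mathcal{C}=\{j:\zeta_j=1\}$ (so $\mathcal{S}\cup\mathcal{C}=\{1,\dots,d\}$). Let $\mathcal{H}$ be the Hessian of $K$ at $\boldsymbol\tau$ and $\mathcal{M}$ the submatrix of $\mathcal{H}^{-1}$ with rows and columns in $\mathcal{C}$. Let $A(\mathbf{z})$ be a power series analytic on the torus of radius $\boldsymbol\zeta$ with $A(\boldsymbol\zeta)\neq0$. Let $\delta<1/2$ and $(\boldsymbol\kappa_n)$ vectors of nonnegative integers with $\boldsymbol\kappa_n=\boldsymbol\lambda n+O(n^\delta)$. Then, as $n\to\infty$, \[ [\mathbf{z}^{\boldsymbol\kappa_n}]\frac{A(\mathbf{z})B(\mathbf{z})^n}{\prod_{j=1}^d(1-z_j)}\sim\frac{B(\boldsymbol\zeta)^n}{\boldsymbol\zeta^{\boldsymbol\kappa_n}}\cdot\frac{A(\boldsymbol\zeta)}{\prod_{j\in\mathcal{S}}(1-\zeta_j)}\cdot\frac{1}{\sqrt{(2\pi)^dn^{|\mathcal{S}|}\det(\mathcal{H})}}\int_{(0,+\infty)^{|\mathcal{C}|}}e^{-\mathbf{u}^T\mathcal{M}\mathbf{u}/2}\,d\mathbf{u}.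 \]
   Context: Notation: $\mathbf{x}^{\mathbf{y}}=\prod_jx_j^{y_j}$, $e^{\mathbf{t}}=(e^{t_1},\dots,e^{t_d})$, $[\mathbf{z}^{\mathbf{k}}]F$ the coefficient of $\prod_jz_j^{k_j}$ in the power series expansion at $\mathbf{0}$. Torus of radius $\boldsymbol\zeta$: $\{\mathbf{z}:|z_j|=\zeta_j\}$. Support $S_B=\{\mathbf{n}:[\mathbf{z}^{\mathbf{n}}]B\neq0\}$, $\Delta(S_B)=\{\mathbf{n}-\mathbf{m}:\mathbf{n},\mathbf{m}\in S_B\}$; full rank: real span of $\Delta(S_B)$ has dimension $d$. For $q\ge2$, $B$ is $q$-periodic if there exist nonnegative integers $p_1,\dots,p_d$ not all divisible by $q$ and an integer $r$ with $\{\mathbf{p}^T\mathbf{n}:\mathbf{n}\in S_B\}\subseteq r+q\mathbb{Z}_{\ge0}$; aperiodic means not $q$-periodic for any $q\ge2$. If $\mathcal{C}=\emptyset$ the integral is $1$. *)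

theory Defs
  imports "HOL-Analysis.Analysis" "HOL-Library.Landau_Symbols"
begin

text \<open>Multivariate power series in the variables indexed by the finite type 'n are
represented by their coefficient functions on multi-indices 'n \<Rightarrow> nat.\<close>

definition mon :: "'a::comm_ring_1 ^ 'n::finite \<Rightarrow> ('n \<Rightarrow> nat) \<Rightarrow> 'a" where
  "mon z k = (\<Prod>j\<in>UNIV. (z $ j) ^ k j)"

definition ps_eval :: "(('n::finite \<Rightarrow> nat) \<Rightarrow> 'a::{comm_ring_1,t2_space,topological_ab_group_add}) \<Rightarrow> 'a ^ 'n \<Rightarrow> 'a" where
  "ps_eval c z = (\<Sum>\<^sub>\<infinity>k. c k * mon z k)"

definition ps_mult :: "(('n::finite \<Rightarrow> nat) \<Rightarrow> 'a::comm_ring_1) \<Rightarrow> (('n \<Rightarrow> nat) \<Rightarrow> 'a) \<Rightarrow> ('n \<Rightarrow> nat) \<Rightarrow> 'a" where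
  "ps_mult f g k = (\<Sum>i\<in>{i. \<forall>j. i j \<le> k j}. f i * g (\<lambda>j. k j - i j))"

definition ps_one :: "('n::finite \<Rightarrow> nat) \<Rightarrow> 'a::comm_ring_1" where
  "ps_one k = (if k = (\<lambda>_. 0) then 1 else 0)"

definition ps_pow :: "(('n::finite \<Rightarrow> nat) \<Rightarrow> 'a::comm_ring_1) \<Rightarrow> nat \<Rightarrow> ('n \<Rightarrow> nat) \<Rightarrow> 'a" where
  "ps_pow f n = ((ps_mult f) ^^ n) ps_one"

text \<open>Coefficients of 1 / prod_j (1 - z_j).\<close>
definition ps_geom :: "('n::finite \<Rightarrow> nat) \<Rightarrow> 'a::comm_ring_1" where
  "ps_geom k = 1"

definition ps_support :: "(('n::finite \<Rightarrow> nat) \<Rightarrow> 'a::zero) \<Rightarrow> ('n \<Rightarrow> nat) set" where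
  "ps_support c = {k. c k \<noteq> 0}"

definition full_rank :: "(('n::finite \<Rightarrow> nat) \<Rightarrow> 'a::zero) \<Rightarrow> bool" where
  "full_rank c \<longleftrightarrow>
     dim {(\<chi> j. real (n j) - real (m j)) :: real ^ 'n | n m. n \<in> ps_support c \<and> m \<in> ps_support c}
       = CARD('n)"

definition q_periodic :: "nat \<Rightarrow> (('n::finite \<Rightarrow> nat) \<Rightarrow> 'a::zero) \<Rightarrow> bool" where
  "q_periodic q c \<longleftrightarrow>
     (\<exists>p :: 'n \<Rightarrow> nat. (\<exists>j. \<not> q dvd p j) \<and>
        (\<exists>r :: int. \<forall>n \<in> ps_support c. \<exists>k :: nat. int (\<Sum>j\<in>UNIV. p j * n j) = r + int q * int k))"

definition aperiodic :: "(('n::finite \<Rightarrow> nat) \<Rightarrow> 'a::zero) \<Rightarrow> bool" where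
  "aperiodic c \<longleftrightarrow> (\<forall>q\<ge>2. \<not> q_periodic q c)"

definition torus :: "real ^ 'n::finite \<Rightarrow> (complex ^ 'n) set" where
  "torus \<zeta> = {z. \<forall>j. norm (z $ j) = \<zeta> $ j}"

definition hessian :: "(real ^ 'n::finite \<Rightarrow> real) \<Rightarrow> real ^ 'n \<Rightarrow> real ^ 'n ^ 'n" where
  "hessian f x = (\<chi> i j. deriv (\<lambda>s. deriv (\<lambda>r. f (x + s *\<^sub>R axis j 1 + r *\<^sub>R axis i 1)) 0) 0)"

end

theory Submission
  imports Defs "HOL-Probability.Probability"
begin

text \<open>
  Normalised by its value at \<open>\<zeta>\<close>, the rescaled series \<open>B\<close> is the law of a random vector in
  \<open>\<nat>\<^sup>d\<close>; minimality of \<open>\<tau>\<close> says that its mean is \<open>\<lambda>\<close>, and its covariance is the Hessian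
  of \<open>K\<close>.  After dividing by \<open>B(\<zeta>)\<^sup>n / \<zeta>\<^sup>\<kappa>\<close>, the coefficient in question is the sum over all
  \<open>k\<close> and \<open>m\<close> of \<open>a\<^sub>k \<zeta>\<^sup>k \<zeta>\<^sup>m P(S\<^sub>n = \<kappa> - k - m)\<close>, where \<open>S\<^sub>n\<close> is the associated random walk.

  Fourier inversion with a Gaussian bound on the characteristic function (this is where full rank
  and aperiodicity enter) gives the local limit theorem for \<open>n\<^sup>d\<^sup>/\<^sup>2 P(S\<^sub>n = x)\<close>; tilting the
  law by \<open>O(n\<^sup>-\<^sup>1\<^sup>/\<^sup>2)\<close> improves the uniform bound to exponential decay in \<open>|x - n \<lambda>| / n\<^sup>1\<^sup>/\<^sup>2\<close>.
  In the directions of \<open>\<C>\<close> the weight \<open>\<zeta>\<^sup>m\<close> is constant and the sum over \<open>m\<close> is a Riemann sum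
  of mesh \<open>n\<^sup>-\<^sup>1\<^sup>/\<^sup>2\<close>, which converges to the Gaussian orthant integral by dominated convergence.
  In the directions of \<open>\<S>\<close> the weights are summable, and Tannery's theorem yields the factors
  \<open>1 / (1 - \<zeta>\<^sub>j)\<close> and \<open>A(\<zeta>)\<close>.
\<close>

subsection \<open>Power series algebra\<close>

text \<open>The bound of order n^(-d/2) that Fourier inversion gives at a single point cannot be
  summed over the unbounded orthant of exponents in the directions of \<open>C\<close>; a majorant
  depending on |x - n \<lambda>| / sqrt n is needed there. Obtaining it by tilting requires a bound
  on the characteristic function for all tilts |s_j| <= e at once. Therefore all tilted weights are
  bounded below by one weight \<open>low\<close>, and the loss of modulus caused by interference of
  phases is estimated for \<open>low\<close> alone; this loss is monotone in the weights.

  The sums are nested with the directions of \<open>C\<close> innermost: for fixed k and a fixed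
  part v of m outside \<open>C\<close>, the rest of the sum is a probability of order n^(-|S|/2),
  bounded uniformly in its base point. The shift by k + v disappears on the scale sqrt n, so the
  limit is the same for every (k, v) and the summable weights factor out. Since \<delta> < 1/2, the
  deviation of \<kappa> from n \<lambda> also disappears on this scale, which puts the corner of the
  limiting orthant at the mean.\<close>

lemma finite_le_fun: "finite {i :: 'n::finite \<Rightarrow> nat. \<forall>j. i j \<le> k j}"
proof -
  have "{i :: 'n \<Rightarrow> nat. \<forall>j. i j \<le> k j} = PiE UNIV (\<lambda>j. {..k j})"
    by (auto simp: PiE_UNIV_domain)
  then show ?thesis by (simp add: finite_PiE)
qed

lemma mon_add: "mon z (\<lambda>j. i j + k j) = mon z i * mon z k"
  by (simp add: mon_def power_add prod.distrib)

lemma mon_zero [simp]: "mon z (\<lambda>_. 0) = 1"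
  by (simp add: mon_def)

lemma summable_on_product_norm:
  fixes f :: "'a \<Rightarrow> 'c::real_normed_field" and g :: "'b \<Rightarrow> 'c"
  assumes f: "(\<lambda>x. norm (f x)) summable_on A" and g: "(\<lambda>y. norm (g y)) summable_on B"
  shows "(\<lambda>(x, y). norm (f x * g y)) summable_on A \<times> B"
proof (rule summable_on_SigmaI)
  fix x assume "x \<in> A"
  show "((\<lambda>y. case (x, y) of (x, y) \<Rightarrow> norm (f x * g y)) has_sum norm (f x) * (\<Sum>\<^sub>\<infinity>y\<in>B. norm (g y))) B"
    using has_sum_cmult_right[OF has_sum_infsum[OF g]] by (simp add: norm_mult)
next
  show "(\<lambda>x. norm (f x) * (\<Sum>\<^sub>\<infinity>y\<in>B. norm (g y))) summable_on A"
    by (rule summable_on_cmult_left[OF f])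
qed (simp_all add: norm_mult)

lemma infsum_product_norm:
  fixes f :: "'a \<Rightarrow> 'c::{real_normed_field,banach}" and g :: "'b \<Rightarrow> 'c"
  assumes f: "(\<lambda>x. norm (f x)) summable_on A" and g: "(\<lambda>y. norm (g y)) summable_on B"
  shows "(\<Sum>\<^sub>\<infinity>(x, y)\<in>A \<times> B. f x * g y) = infsum f A * infsum g B"
proof -
  have "(\<lambda>p. norm (case p of (x, y) \<Rightarrow> f x * g y)) summable_on A \<times> B"
    using summable_on_product_norm[OF f g] by (simp add: case_prod_unfold)
  then have "(\<lambda>(x, y). f x * g y) summable_on A \<times> B"
    by (rule abs_summable_summable)
  then have "(\<Sum>\<^sub>\<infinity>(x, y)\<in>A \<times> B. f x * g y) = (\<Sum>\<^sub>\<infinity>x\<in>A. \<Sum>\<^sub>\<infinity>y\<in>B. f x * g y)"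
    by (rule infsum_Sigma'_banach[symmetric])
  also have "\<dots> = infsum f A * infsum g B"
    using f g by (simp add: infsum_cmult_right infsum_cmult_left abs_summable_summable)
  finally show ?thesis .
qed

text \<open>Cauchy product by reindexing: the pairs (k, i) with i <= k correspond to all pairs of
  exponents (i, k - i), so the absolutely convergent double series can be regrouped by total
  exponent.\<close>

lemma
  fixes f g :: "('n::finite \<Rightarrow> nat) \<Rightarrow> 'a::{real_normed_field,banach}"
  assumes f: "(\<lambda>k. norm (f k * mon z k)) summable_on UNIV"
      and g: "(\<lambda>k. norm (g k * mon z k)) summable_on UNIV"
  shows ps_mult_summable: "(\<lambda>k. norm (ps_mult f g k * mon z k)) summable_on UNIV"
    and ps_eval_mult: "ps_eval (ps_mult f g) z = ps_eval f z * ps_eval g z"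
proof -
  define D where "D = (SIGMA k:UNIV. {i :: 'n \<Rightarrow> nat. \<forall>j. i j \<le> k j})"
  define \<phi> where "\<phi> = (\<lambda>(k, i). (i :: 'n \<Rightarrow> nat, \<lambda>j. k j - i j :: nat))"
  define h where "h = (\<lambda>(i, j). (f i * mon z i) * (g j * mon z j))"
  have bij: "bij_betw \<phi> D (UNIV \<times> UNIV)"
    by (rule bij_betw_byWitness[where f' = "\<lambda>(i, l). (\<lambda>j. i j + l j, i)"])
       (auto simp: \<phi>_def D_def fun_eq_iff)
  have h\<phi>: "h (\<phi> (k, i)) = f i * g (\<lambda>j. k j - i j) * mon z k" if "\<forall>j. i j \<le> k j" for k i
  proof -
    have "k = (\<lambda>j. i j + (k j - i j))" using that by auto
    then have "mon z k = mon z i * mon z (\<lambda>j. k j - i j)" by (metis mon_add)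
    then show ?thesis by (simp add: h_def \<phi>_def)
  qed
  have sh: "(\<lambda>p. norm (h p)) summable_on UNIV \<times> UNIV"
    using summable_on_product_norm[OF f g] by (simp add: h_def case_prod_unfold)
  then have sD: "(\<lambda>p. norm (h (\<phi> p))) summable_on D"
    using summable_on_reindex_bij_betw[OF bij, of "\<lambda>p. norm (h p)"] by simp
  then have sD': "(\<lambda>p. h (\<phi> p)) summable_on D" by (rule abs_summable_summable)
  have inner: "(\<Sum>\<^sub>\<infinity>i\<in>{i. \<forall>j. i j \<le> k j}. h (\<phi> (k, i))) = ps_mult f g k * mon z k" for k
  proof -
    have "(\<Sum>\<^sub>\<infinity>i\<in>{i. \<forall>j. i j \<le> k j}. h (\<phi> (k, i)))
        = (\<Sum>\<^sub>\<infinity>i\<in>{i. \<forall>j. i j \<le> k j}. f i * g (\<lambda>j. k j - i j) * mon z k)"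
      by (rule infsum_cong) (simp add: h\<phi>)
    also have "\<dots> = ps_mult f g k * mon z k"
      by (simp add: finite_le_fun ps_mult_def sum_distrib_right)
    finally show ?thesis .
  qed
  have "(\<lambda>k. \<Sum>\<^sub>\<infinity>i\<in>{i. \<forall>j. i j \<le> k j}. norm (h (\<phi> (k, i)))) summable_on UNIV"
    using sD summable_on_Sigma_banach[of "\<lambda>k i. norm (h (\<phi> (k, i)))" UNIV "\<lambda>k. {i. \<forall>j. i j \<le> k j}"]
    by (simp add: D_def case_prod_unfold)
  then show "(\<lambda>k. norm (ps_mult f g k * mon z k)) summable_on UNIV"
  proof (rule summable_on_comparison_test)
    fix k
    show "norm (ps_mult f g k * mon z k) \<le> (\<Sum>\<^sub>\<infinity>i\<in>{i. \<forall>j. i j \<le> k j}. norm (h (\<phi> (k, i))))"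
      unfolding inner[symmetric] by (simp add: finite_le_fun norm_sum)
  qed auto
  have "ps_eval (ps_mult f g) z = (\<Sum>\<^sub>\<infinity>k. \<Sum>\<^sub>\<infinity>i\<in>{i. \<forall>j. i j \<le> k j}. h (\<phi> (k, i)))"
    by (simp add: ps_eval_def inner)
  also have "\<dots> = infsum (\<lambda>p. h (\<phi> p)) D"
    using infsum_Sigma_banach[of "\<lambda>p. h (\<phi> p)" UNIV "\<lambda>k. {i. \<forall>j. i j \<le> k j}"] sD' by (simp add: D_def)
  also have "\<dots> = infsum h (UNIV \<times> UNIV)"
    by (rule infsum_reindex_bij_betw[OF bij])
  also have "\<dots> = ps_eval f z * ps_eval g z"
    using infsum_product_norm[OF f g] by (simp add: h_def ps_eval_def)
  finally show "ps_eval (ps_mult f g) z = ps_eval f z * ps_eval g z" .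
qed

lemma ps_pow_0 [simp]: "ps_pow f 0 = ps_one" and ps_pow_Suc: "ps_pow f (Suc n) = ps_mult f (ps_pow f n)"
  by (simp_all add: ps_pow_def)

lemma
  fixes f :: "('n::finite \<Rightarrow> nat) \<Rightarrow> 'a::{real_normed_field,banach}"
  assumes f: "(\<lambda>k. norm (f k * mon z k)) summable_on UNIV"
  shows ps_pow_summable: "(\<lambda>k. norm (ps_pow f n k * mon z k)) summable_on UNIV"
    and ps_eval_pow: "ps_eval (ps_pow f n) z = ps_eval f z ^ n"
proof -
  have "(\<lambda>k. norm (ps_pow f n k * mon z k)) summable_on UNIV \<and> ps_eval (ps_pow f n) z = ps_eval f z ^ n"
  proof (induction n)
    case 0
    have *: "((\<lambda>k. ps_one k * mon z k) has_sum 1) UNIV"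
      by (rule has_sum_finite_neutralI[of "{\<lambda>_. 0}"]) (auto simp: ps_one_def)
    have **: "((\<lambda>k. norm (ps_one k * mon z k)) has_sum 1) UNIV"
      by (rule has_sum_finite_neutralI[of "{\<lambda>_. 0}"]) (auto simp: ps_one_def)
    show ?case
      using has_sum_imp_summable[OF **] infsumI[OF *] by (simp add: ps_eval_def)
  next
    case (Suc n)
    then show ?case
      using ps_mult_summable[OF f] ps_eval_mult[OF f] by (simp add: ps_pow_Suc)
  qed
  then show "(\<lambda>k. norm (ps_pow f n k * mon z k)) summable_on UNIV"
    and "ps_eval (ps_pow f n) z = ps_eval f z ^ n" by auto
qed

lemma ps_mult_of_real:
  "ps_mult (\<lambda>k. complex_of_real (f k)) (\<lambda>k. complex_of_real (g k)) k = complex_of_real (ps_mult f g k)"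
  by (simp add: ps_mult_def)

lemma ps_pow_of_real: "ps_pow (\<lambda>k. complex_of_real (f k)) n k = complex_of_real (ps_pow f n k)"
proof (induction n arbitrary: k)
  case 0 show ?case by (simp add: ps_one_def)
next
  case (Suc n)
  then have "ps_pow (\<lambda>k. complex_of_real (f k)) n = (\<lambda>k. complex_of_real (ps_pow f n k))" by auto
  then show ?case by (simp add: ps_pow_Suc ps_mult_of_real)
qed

lemma ps_pow_nonneg:
  fixes f :: "('n::finite \<Rightarrow> nat) \<Rightarrow> real"
  assumes "\<And>k. f k \<ge> 0" shows "ps_pow f n k \<ge> 0"
proof (induction n arbitrary: k)
  case 0 show ?case by (simp add: ps_one_def)
next
  case (Suc n) then show ?case by (auto simp: ps_pow_Suc ps_mult_def assms intro!: sum_nonneg)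
qed

text \<open>Monomials are multiplicative along k = i + (k - i), so rescaling the variables by z and
  dividing by c passes through every convolution. With z = \<zeta> and c = B(\<zeta>) this converts
  coefficients of powers of B into walk probabilities.\<close>

lemma ps_pow_scale:
  fixes f :: "('n::finite \<Rightarrow> nat) \<Rightarrow> 'a::field"
  assumes "c \<noteq> 0"
  shows "ps_pow (\<lambda>k. f k * mon z k / c) n k = ps_pow f n k * mon z k / c ^ n"
proof (induction n arbitrary: k)
  case 0 show ?case by (simp add: ps_one_def)
next
  case (Suc n)
  have "f i * mon z i / c * (ps_pow f n (\<lambda>j. k j - i j) * mon z (\<lambda>j. k j - i j) / c ^ n)
      = f i * ps_pow f n (\<lambda>j. k j - i j) * mon z k / c ^ Suc n" if "\<forall>j. i j \<le> k j" for i
  proof -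
    have "k = (\<lambda>j. i j + (k j - i j))" using that by auto
    then have "mon z k = mon z i * mon z (\<lambda>j. k j - i j)" by (metis mon_add)
    then show ?thesis by simp
  qed
  then have "(\<Sum>i\<in>{i. \<forall>j. i j \<le> k j}. f i * mon z i / c * (ps_pow f n (\<lambda>j. k j - i j) * mon z (\<lambda>j. k j - i j) / c ^ n))
      = (\<Sum>i\<in>{i. \<forall>j. i j \<le> k j}. f i * ps_pow f n (\<lambda>j. k j - i j) * mon z k / c ^ Suc n)"
    by (intro sum.cong) auto
  then show ?case
    by (simp only: ps_pow_Suc ps_mult_def Suc sum_distrib_right sum_divide_distrib)
qed

subsection \<open>Lebesgue measure on real vectors\<close>

lemma prod_Basis_vec: "(\<Prod>b\<in>Basis. f b) = (\<Prod>j\<in>UNIV. f (axis j (1::real)))" for f :: "real^'n::finite \<Rightarrow> 'b::comm_monoid_mult"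
proof -
  have "Basis = range (\<lambda>j. axis j (1::real) :: real^'n)" by (auto simp: Basis_vec_def)
  moreover have "inj (\<lambda>j. axis j (1::real) :: real^'n)" by (auto simp: inj_on_def axis_eq_axis)
  ultimately show ?thesis by (metis (no_types, lifting) prod.reindex_cong)
qed

lemma measurable_vec_lambda [measurable]:
  "(vec_lambda :: _ \<Rightarrow> real^'n::finite) \<in> PiM UNIV (\<lambda>_. lborel) \<rightarrow>\<^sub>M borel"
proof (subst borel_measurable_euclidean_space, safe)
  fix b :: "real^'n" assume "b \<in> Basis"
  then obtain j where b: "b = axis j 1" by (auto simp: Basis_vec_def)
  have "(\<lambda>x. x j) \<in> PiM UNIV (\<lambda>_::'n. lborel) \<rightarrow>\<^sub>M (lborel :: real measure)"
    by (rule measurable_component_singleton) auto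
  then have "(\<lambda>x. x j) \<in> borel_measurable (PiM UNIV (\<lambda>_::'n. lborel :: real measure))"
    by simp
  then show "(\<lambda>x. vec_lambda x \<bullet> b) \<in> borel_measurable (PiM UNIV (\<lambda>_. lborel))"
    by (simp add: b inner_axis)
qed

text \<open>Lebesgue measure is determined by its values on boxes, where both measures give the
  product of the side lengths. The identity makes Fubini's theorem for finite product measures
  available on \<open>real^'n\<close>.\<close>

lemma lborel_vec_eq_distr:
  "(lborel :: (real^'n::finite) measure) = distr (PiM UNIV (\<lambda>_. lborel)) borel vec_lambda"
proof (rule lborel_eqI)
  fix l u :: "real^'n" assume le: "\<And>b. b \<in> Basis \<Longrightarrow> l \<bullet> b \<le> u \<bullet> b"
  then have le': "l $ j \<le> u $ j" for j
    using le[of "axis j 1"] by (simp add: inner_axis)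
  interpret product_sigma_finite "\<lambda>_::'n. lborel :: real measure" by standard
  interpret finite_product_sigma_finite "\<lambda>_::'n. lborel :: real measure" UNIV by standard auto
  have eq: "vec_lambda -` box l u \<inter> space (PiM UNIV (\<lambda>_. lborel)) = PiE UNIV (\<lambda>j. {l $ j <..< u $ j})"
    by (auto simp: space_PiM mem_box_cart PiE_UNIV_domain Pi_iff)
  have "emeasure (distr (PiM UNIV (\<lambda>_. lborel)) borel vec_lambda) (box l u)
      = emeasure (PiM UNIV (\<lambda>_::'n. lborel)) (PiE UNIV (\<lambda>j. {l $ j <..< u $ j}))"
    by (subst emeasure_distr) (auto simp: eq)
  also have "\<dots> = (\<Prod>j\<in>UNIV. emeasure lborel {l $ j <..< u $ j})"
    by (rule measure_times) auto
  also have "\<dots> = (\<Prod>j\<in>UNIV. ennreal (u $ j - l $ j))"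
    using le' by simp
  also have "\<dots> = ennreal (\<Prod>j\<in>UNIV. u $ j - l $ j)"
    using le' by (intro prod_ennreal) auto
  finally show "emeasure (distr (PiM UNIV (\<lambda>_. lborel)) borel vec_lambda) (box l u) = ennreal (\<Prod>b\<in>Basis. (u - l) \<bullet> b)"
    by (simp add: prod_Basis_vec inner_axis)
qed simp

lemma
  fixes f :: "'n::finite \<Rightarrow> real \<Rightarrow> 'b::{real_normed_field,banach,second_countable_topology}"
  assumes f: "\<And>j. integrable lborel (f j)"
  shows integrable_vec_prod: "integrable lborel (\<lambda>x::real^'n. \<Prod>j\<in>UNIV. f j (x $ j))"
    and integral_vec_prod: "(\<integral>(x::real^'n). (\<Prod>j\<in>UNIV. f j (x $ j)) \<partial>lborel) = (\<Prod>j\<in>UNIV. \<integral>t. f j t \<partial>lborel)"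
proof -
  interpret product_sigma_finite "\<lambda>_::'n. lborel :: real measure" by standard
  have [measurable]: "f j \<in> borel_measurable borel" for j using f[of j] by auto
  have m: "(\<lambda>x::real^'n. \<Prod>j\<in>UNIV. f j (x $ j)) \<in> borel_measurable borel" by measurable
  show "integrable lborel (\<lambda>x::real^'n. \<Prod>j\<in>UNIV. f j (x $ j))"
    unfolding lborel_vec_eq_distr
    by (subst integrable_distr_eq) (use product_integrable_prod[of UNIV f] f m in auto)
  show "(\<integral>(x::real^'n). (\<Prod>j\<in>UNIV. f j (x $ j)) \<partial>lborel) = (\<Prod>j\<in>UNIV. \<integral>t. f j t \<partial>lborel)"
    unfolding lborel_vec_eq_distr
    by (subst integral_distr) (use product_integral_prod[of UNIV f] f m in auto)
qed

section \<open>Matrix inverses and linear changes of variables\<close>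

lemma matrix_mul_matrix_inv:
  fixes A :: "real^'n::finite^'n"
  assumes "invertible A"
  shows "A ** matrix_inv A = mat 1"
  using someI_ex[OF assms[unfolded invertible_def]] by (auto simp: matrix_inv_def)

lemma matrix_inv_eqI:
  fixes A :: "real^'n::finite^'n"
  assumes "A ** B = mat 1"
  shows "matrix_inv A = B"
proof -
  have "B ** A = mat 1" using assms by (simp add: matrix_left_right_inverse)
  with assms have "invertible A" by (auto simp: invertible_def)
  then have "B ** (A ** matrix_inv A) = B" by (simp add: matrix_mul_matrix_inv)
  then show ?thesis by (simp add: matrix_mul_assoc \<open>B ** A = mat 1\<close>)
qed

lemma prod_vec_Basis_diff: "(\<Prod>b\<in>Basis. (u - l) \<bullet> b) = (\<Prod>j\<in>UNIV. u $ j - l $ j)" for u l :: "real^'n::finite"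
  by (simp add: prod_Basis_vec inner_axis)

text \<open>The library's linear change of variables is restricted to well-ordered index types.\<close>
lemma nn_integral_shear:
  fixes f :: "real^'n::finite \<Rightarrow> ennreal"
  assumes [measurable]: "f \<in> borel_measurable borel" and "m \<noteq> n"
  shows "(\<integral>\<^sup>+x. f (\<chi> i. if i = m then x $ m + c * x $ n else x $ i) \<partial>lborel) = (\<integral>\<^sup>+x. f x \<partial>lborel)"
proof -
  interpret product_sigma_finite "\<lambda>_::'n. lborel :: real measure" by standard
  \<comment> \<open>With coordinate m integrated innermost, the shear translates that variable by c
    times x_n, which is constant for the inner integral because n differs from m.\<close>
  define I where "I = UNIV - {m}"
  have I: "finite I" "m \<notin> I" "insert m I = UNIV" by (auto simp: I_def)
  have *: "(\<integral>\<^sup>+x. g x \<partial>(lborel :: (real^'n) measure)) = (\<integral>\<^sup>+x. \<integral>\<^sup>+y. g (vec_lambda (x(m := y))) \<partial>lborel \<partial>PiM I (\<lambda>_. lborel))"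
    if [measurable]: "g \<in> borel_measurable borel" for g
  proof -
    have "(\<lambda>x. g (vec_lambda x)) \<in> borel_measurable (PiM UNIV (\<lambda>_. lborel))" by measurable
    then show ?thesis
      using product_nn_integral_insert[OF I(1,2), of "\<lambda>x. g (vec_lambda x)"] I(3)
      by (subst lborel_vec_eq_distr) (simp add: nn_integral_distr)
  qed
  have upd: "(\<lambda>y. vec_lambda (x(m := y)) :: real^'n) \<in> borel_measurable borel" for x
  proof (subst borel_measurable_euclidean_space, safe)
    fix b :: "real^'n" assume "b \<in> Basis"
    then obtain j where b: "b = axis j 1" by (auto simp: Basis_vec_def)
    show "(\<lambda>y. vec_lambda (x(m := y)) \<bullet> b) \<in> borel_measurable borel"
      by (cases "j = m") (simp_all add: b inner_axis)
  qed
  have shear: "(\<lambda>x::real^'n. \<chi> i. if i = m then x $ m + c * x $ n else x $ i) \<in> borel_measurable borel"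
  proof (rule borel_measurable_continuous_onI)
    show "continuous_on UNIV (\<lambda>x::real^'n. \<chi> i. if i = m then x $ m + c * x $ n else x $ i)"
    proof (rule continuous_on_vec_lambda)
      fix i show "continuous_on UNIV (\<lambda>x::real^'n. if i = m then x $ m + c * x $ n else x $ i)"
        by (cases "i = m") (auto intro!: continuous_intros)
    qed
  qed
  have "(\<integral>\<^sup>+y. f (\<chi> i. if i = m then vec_lambda (x(m := y)) $ m + c * vec_lambda (x(m := y)) $ n else vec_lambda (x(m := y)) $ i) \<partial>lborel)
      = (\<integral>\<^sup>+y. f (vec_lambda (x(m := y))) \<partial>lborel)" for x :: "'n \<Rightarrow> real"
  proof -
    have "(\<integral>\<^sup>+y. f (vec_lambda (x(m := y))) \<partial>lborel) = (\<integral>\<^sup>+y. f (vec_lambda (x(m := c * x n + 1 * y))) \<partial>lborel)"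
      by (subst nn_integral_real_affine[where t = "c * x n" and c = 1])
         (use measurable_compose[OF upd assms(1)] in simp_all)
    also have "\<dots> = (\<integral>\<^sup>+y. f (\<chi> i. if i = m then vec_lambda (x(m := y)) $ m + c * vec_lambda (x(m := y)) $ n else vec_lambda (x(m := y)) $ i) \<partial>lborel)"
      using assms(2) by (intro nn_integral_cong arg_cong[where f = f]) (auto simp: vec_eq_iff)
    finally show ?thesis by simp
  qed
  then show ?thesis
    using measurable_compose[OF shear assms(1)] assms(1) by (simp add: *)
qed

text \<open>A transposition of coordinates maps boxes to boxes and permutes the factors of their
  volume.\<close>

lemma distr_lborel_swap:
  "distr lborel borel (\<lambda>x::real^'n::finite. \<chi> i. x $ Transposition.transpose m n i) = lborel"
proof (rule lborel_eqI[symmetric])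
  let ?T = "\<lambda>x::real^'n. \<chi> i. x $ Transposition.transpose m n i"
  have T [measurable]: "?T \<in> borel_measurable borel"
    by (rule borel_measurable_continuous_onI) (intro continuous_on_vec_lambda continuous_intros)
  fix l u :: "real^'n" assume le: "\<And>b. b \<in> Basis \<Longrightarrow> l \<bullet> b \<le> u \<bullet> b"
  then have le': "l $ j \<le> u $ j" for j
    using le[of "axis j 1"] by (simp add: inner_axis)
  have pre: "?T -` box l u = box (?T l) (?T u)"
    by (auto simp: mem_box_cart) (metis transpose_involutory)+
  have "emeasure (distr lborel borel ?T) (box l u) = emeasure lborel (box (?T l) (?T u))"
    by (subst emeasure_distr) (auto simp: pre)
  also have "\<dots> = ennreal (\<Prod>j\<in>UNIV. u $ Transposition.transpose m n j - l $ Transposition.transpose m n j)"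
  proof -
    have "\<forall>b\<in>Basis. ?T l \<bullet> b \<le> ?T u \<bullet> b" using le' by (auto simp: Basis_vec_def inner_axis)
    then show ?thesis by (simp add: emeasure_lborel_box_eq prod_vec_Basis_diff)
  qed
  also have "(\<Prod>j\<in>UNIV. u $ Transposition.transpose m n j - l $ Transposition.transpose m n j) = (\<Prod>j\<in>UNIV. u $ j - l $ j)"
    using prod.permute[OF permutes_swap_id, where S=UNIV and g="\<lambda>i. u $ i - l $ i", of m n] by (simp add: o_def)
  finally show "emeasure (distr lborel borel ?T) (box l u) = ennreal (\<Prod>b\<in>Basis. (u - l) \<bullet> b)"
    by (simp add: prod_vec_Basis_diff)
qed simp

lemma measurable_matrix_vector_mult [measurable]:
  "(*v) (A :: real^'n::finite^'m::finite) \<in> borel_measurable borel"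
  by (rule borel_measurable_continuous_onI) (simp add: linear_continuous_on)

text \<open>The formula is stable under matrix products, so elementary matrices suffice: a zero row
  is excluded by the determinant, diagonal matrices scale each axis, swaps and shears preserve the
  measure. Nonnegative integrands keep the induction free of integrability conditions.\<close>

lemma nn_integral_matrix_subst:
  fixes A :: "real^'n::finite^'n"
  assumes "det A \<noteq> 0" "f \<in> borel_measurable borel"
  shows "(\<integral>\<^sup>+x. f x \<partial>lborel) = ennreal \<bar>det A\<bar> * (\<integral>\<^sup>+x. f (A *v x) \<partial>lborel)"
proof -
  let ?T = "\<lambda>A :: real^'n^'n. \<forall>f\<in>borel_measurable borel. (\<integral>\<^sup>+x. f x \<partial>lborel) = ennreal \<bar>det A\<bar> * (\<integral>\<^sup>+x. f (A *v x) \<partial>lborel)"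
  have "det A \<noteq> 0 \<longrightarrow> ?T A"
  proof (rule induct_matrix_elementary[of _ A]; intro impI ballI)
    fix A B :: "real^'n^'n" and f :: "real^'n \<Rightarrow> ennreal"
    assume AB: "det (A ** B) \<noteq> 0" and f [measurable]: "f \<in> borel_measurable borel"
    assume A: "det A \<noteq> 0 \<longrightarrow> ?T A"
      and B: "det B \<noteq> 0 \<longrightarrow> ?T B"
    have nz: "det A \<noteq> 0" "det B \<noteq> 0" using AB by (auto simp: det_mul)
    have "(\<integral>\<^sup>+x. f x \<partial>lborel) = ennreal \<bar>det A\<bar> * (\<integral>\<^sup>+x. f (A *v x) \<partial>lborel)"
      using A nz f by blast
    also have "(\<integral>\<^sup>+x. f (A *v x) \<partial>lborel) = ennreal \<bar>det B\<bar> * (\<integral>\<^sup>+x. f (A *v (B *v x)) \<partial>lborel)"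
      using B[rule_format, OF nz(2), of "\<lambda>x. f (A *v x)"] by simp
    finally show "(\<integral>\<^sup>+x. f x \<partial>lborel) = ennreal \<bar>det (A ** B)\<bar> * (\<integral>\<^sup>+x. f (A ** B *v x) \<partial>lborel)"
      by (simp add: det_mul abs_mult ennreal_mult mult.assoc matrix_vector_mul_assoc)
  next
    fix A :: "real^'n^'n" and i f
    assume "row i A = 0" "det A \<noteq> 0"
    then show "(\<integral>\<^sup>+x. f x \<partial>lborel) = ennreal \<bar>det A\<bar> * (\<integral>\<^sup>+x. f (A *v x) \<partial>lborel)"
      using det_zero_row(2) by (metis row_def vec_lambda_eta)
  next
    fix A :: "real^'n^'n" and f :: "real^'n \<Rightarrow> ennreal"
    assume d: "\<And>i j. i \<noteq> j \<Longrightarrow> A $ i $ j = 0" and nz: "det A \<noteq> 0" and f [measurable]: "f \<in> borel_measurable borel"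
    have detA: "det A = (\<Prod>i\<in>UNIV. A $ i $ i)" using d by (rule det_diagonal)
    then have nz': "A $ i $ i \<noteq> 0" for i using nz by auto
    \<comment> \<open>A diagonal matrix multiplies each basis vector by its own scalar; this is the
      coordinatewise form to which \<open>lborel_affine_euclidean\<close> applies.\<close>
    have T: "A *v x = 0 + (\<Sum>j\<in>Basis. ((A *v j) \<bullet> j * (x \<bullet> j)) *\<^sub>R j)" for x
    proof (rule euclidean_eqI)
      fix b :: "real^'n" assume b: "b \<in> Basis"
      then obtain i where bi: "b = axis i 1" by (auto simp: Basis_vec_def)
      have "(A *v x) \<bullet> b = A $ i $ i * x $ i"
        unfolding bi by (simp add: inner_axis matrix_vector_mult_def, subst sum.remove[of _ i]) (auto intro!: sum.neutral simp: d)
      moreover have "(A *v b) \<bullet> b = A $ i $ i"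
        unfolding bi by (simp add: inner_axis matrix_vector_mult_basis column_def)
      ultimately show "(A *v x) \<bullet> b = (0 + (\<Sum>j\<in>Basis. ((A *v j) \<bullet> j * (x \<bullet> j)) *\<^sub>R j)) \<bullet> b"
        using b by (simp add: inner_sum_left_Basis) (simp add: bi inner_axis)
    qed
    have Ab: "(A *v axis i 1) \<bullet> axis i 1 = A $ i $ i" for i
      by (simp add: inner_axis matrix_vector_mult_basis column_def)
    have "lborel = density (distr lborel borel (\<lambda>x. 0 + (\<Sum>j\<in>Basis. ((A *v j) \<bullet> j * (x \<bullet> j)) *\<^sub>R j))) (\<lambda>_. \<Prod>j\<in>Basis. \<bar>(A *v j) \<bullet> j\<bar>)"
      by (rule lborel_affine_euclidean) (auto simp: Basis_vec_def Ab nz')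
    then have l: "lborel = density (distr lborel borel ((*v) A)) (\<lambda>_. \<bar>det A\<bar>)"
      unfolding T[symmetric] by (simp add: prod_Basis_vec Ab detA abs_prod)
    show "(\<integral>\<^sup>+x. f x \<partial>lborel) = ennreal \<bar>det A\<bar> * (\<integral>\<^sup>+x. f (A *v x) \<partial>lborel)"
      by (subst l) (simp add: nn_integral_density nn_integral_distr nn_integral_cmult)
  next
    fix m n :: 'n and f :: "real^'n \<Rightarrow> ennreal"
    let ?A = "(\<chi> i j. mat 1 $ i $ Transposition.transpose m n j) :: real^'n^'n"
    assume f [measurable]: "f \<in> borel_measurable borel"
    have d: "\<bar>det ?A\<bar> = 1"
      by (simp add: det_permute_columns permutes_swap_id sign_swap_id abs_mult)
    have A: "?A *v x = (\<chi> i. x $ Transposition.transpose m n i)" for x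
    proof -
      have "(i = Transposition.transpose m n j) \<longleftrightarrow> (j = Transposition.transpose m n i)" for i j
        by (metis transpose_involutory)
      then have "(\<Sum>j\<in>UNIV. (if i = Transposition.transpose m n j then 1 else 0) * x $ j) = (\<Sum>j\<in>UNIV. if j = Transposition.transpose m n i then x $ j else 0)" for i
        by (intro sum.cong) auto
      then show ?thesis
        by (simp add: vec_eq_iff matrix_vector_mult_def mat_def)
    qed
    have T: "(\<lambda>x::real^'n. \<chi> i. x $ Transposition.transpose m n i) \<in> borel_measurable borel"
      by (rule borel_measurable_continuous_onI) (intro continuous_on_vec_lambda continuous_intros)
    have "(\<integral>\<^sup>+x. f x \<partial>lborel) = (\<integral>\<^sup>+x. f (\<chi> i. x $ Transposition.transpose m n i) \<partial>lborel)"
      using T by (subst distr_lborel_swap[of m n, symmetric]) (simp add: nn_integral_distr)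
    then show "(\<integral>\<^sup>+x. f x \<partial>lborel) = ennreal \<bar>det ?A\<bar> * (\<integral>\<^sup>+x. f (?A *v x) \<partial>lborel)"
      by (simp add: d A)
  next
    fix m n :: 'n and c :: real and f :: "real^'n \<Rightarrow> ennreal"
    let ?A = "(\<chi> i j. if i = m \<and> j = n then c else of_bool (i = j)) :: real^'n^'n"
    assume mn: "m \<noteq> n" and f: "f \<in> borel_measurable borel"
    have "?A = (\<chi> k. if k = m then row m (mat 1) + c *s row n (mat 1) else row k (mat 1))"
      using mn by (auto simp: vec_eq_iff row_def mat_def)
    then have d: "det ?A = 1" using det_row_operation[OF mn, of "mat 1" c] by simp
    have A: "?A *v x = (\<chi> i. if i = m then x $ m + c * x $ n else x $ i)" for x
    proof -
      have "(\<Sum>j\<in>UNIV. (if i = m \<and> j = n then c else of_bool (i = j)) * x $ j)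
          = (\<Sum>j\<in>UNIV. (if j = i then x $ j else 0) + (if j = n then if i = m then c * x $ j else 0 else 0))" for i
        using mn by (intro sum.cong) auto
      then show ?thesis
        by (simp add: vec_eq_iff matrix_vector_mult_def sum.distrib)
    qed
    show "(\<integral>\<^sup>+x. f x \<partial>lborel) = ennreal \<bar>det ?A\<bar> * (\<integral>\<^sup>+x. f (?A *v x) \<partial>lborel)"
      by (simp add: d A nn_integral_shear[OF f mn])
  qed
  then show ?thesis using assms by blast
qed

text \<open>As an identity of measures, the substitution rule transfers at once from nonnegative
  functions to Banach space valued ones, through the density and image formulas of the Bochner
  integral.\<close>

lemma lborel_matrix_image:
  fixes A :: "real^'n::finite^'n"
  assumes "det A \<noteq> 0"
  shows "lborel = density (distr lborel borel ((*v) A)) (\<lambda>_. ennreal \<bar>det A\<bar>)"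
proof (rule measure_eqI)
  fix X :: "(real^'n) set" assume "X \<in> sets lborel"
  then have [measurable]: "X \<in> sets borel" by simp
  have "emeasure lborel X = (\<integral>\<^sup>+x. indicator X x \<partial>lborel)" by simp
  also have "\<dots> = ennreal \<bar>det A\<bar> * (\<integral>\<^sup>+x. indicator X (A *v x) \<partial>lborel)"
    by (rule nn_integral_matrix_subst[OF assms]) simp
  also have "(\<integral>\<^sup>+x. indicator X (A *v x) \<partial>lborel) = emeasure (distr lborel borel ((*v) A)) X"
    by (simp add: nn_integral_distr flip: nn_integral_indicator)
  finally show "emeasure lborel X = emeasure (density (distr lborel borel ((*v) A)) (\<lambda>_. ennreal \<bar>det A\<bar>)) X"
    by (simp add: emeasure_density_const)
qed simp

lemma integral_matrix_subst:
  fixes A :: "real^'n::finite^'n" and f :: "real^'n \<Rightarrow> 'b::{banach,second_countable_topology}"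
  assumes "det A \<noteq> 0" and [measurable]: "f \<in> borel_measurable borel"
  shows "(\<integral>x. f x \<partial>lborel) = \<bar>det A\<bar> *\<^sub>R (\<integral>x. f (A *v x) \<partial>lborel)"
  by (subst lborel_matrix_image[OF assms(1)]) (simp add: integral_density integral_distr)

subsection \<open>The Gaussian integral of a quadratic form\<close>

text \<open>Gram-Schmidt for the inner product x . H y: fewer than d vectors orthonormal for it span
  a proper subspace, and a vector outside, made orthogonal and normalised, extends the family. The
  columns of P are d such vectors.\<close>

lemma quadratic_form_orthonormal:
  fixes H :: "real^'n::finite^'n"
  assumes sym: "transpose H = H" and pd: "\<And>x. x \<noteq> 0 \<Longrightarrow> x \<bullet> (H *v x) > 0"
  obtains P :: "real^'n^'n" where "transpose P ** H ** P = mat 1"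
proof -
  define bil where "bil x y = x \<bullet> (H *v y)" for x y
  have bil_sym: "bil x y = bil y x" for x y
    unfolding bil_def by (metis dot_lmul_matrix inner_commute sym vector_transpose_matrix)
  have bil_add: "bil x (y + z) = bil x y + bil x z" and bil_diff: "bil x (y - z) = bil x y - bil x z"
    and bil_scale: "bil x (c *\<^sub>R y) = c * bil x y" for x y z c
    by (simp_all add: bil_def matrix_vector_right_distrib matrix_vector_mult_diff_distrib inner_add_right inner_diff_right matrix_vector_mult_scaleR)
  have bil_sum: "bil x (\<Sum>b\<in>B. g b) = (\<Sum>b\<in>B. bil x (g b))" if "finite B" for x B g
    using that by (induction B) (auto simp: bil_add, simp add: bil_def)
  have ex: "\<exists>B. finite B \<and> card B = m \<and> (\<forall>b\<in>B. \<forall>c\<in>B. bil b c = (if b = c then 1 else 0))" if "m \<le> CARD('n)" for m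
    using that
  proof (induction m)
    case 0 show ?case by (intro exI[of _ "{}"]) auto
  next
    case (Suc m)
    then obtain B where B: "finite B" "card B = m" and on: "\<And>b c. b \<in> B \<Longrightarrow> c \<in> B \<Longrightarrow> bil b c = (if b = c then 1 else 0)"
      by auto
    have "dim (span B) < DIM(real^'n)"
      using B Suc.prems dim_le_card'[of B] by simp
    then have "span B \<noteq> UNIV" by (metis dim_UNIV less_irrefl)
    then obtain v where v: "v \<notin> span B" by auto
    define w where "w = v - (\<Sum>b\<in>B. bil b v *\<^sub>R b)"
    have "w \<noteq> 0"
    proof
      assume "w = 0"
      then have "v = (\<Sum>b\<in>B. bil b v *\<^sub>R b)" by (simp add: w_def)
      also have "\<dots> \<in> span B" by (intro span_sum span_scale span_base)
      finally show False using v by simp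
    qed
    then have ww: "bil w w > 0" using pd by (simp add: bil_def)
    have bw: "bil b w = 0" if "b \<in> B" for b
    proof -
      have "bil b w = bil b v - (\<Sum>c\<in>B. bil c v * bil b c)"
        using B by (simp add: w_def bil_diff bil_sum bil_scale)
      also have "(\<Sum>c\<in>B. bil c v * bil b c) = (\<Sum>c\<in>B. if c = b then bil c v else 0)"
        by (rule sum.cong) (use on that in auto)
      also have "\<dots> = bil b v" using B that by simp
      finally show ?thesis by simp
    qed
    define e where "e = (1 / sqrt (bil w w)) *\<^sub>R w"
    have be: "bil b e = 0" if "b \<in> B" for b using bw[OF that] by (simp add: e_def bil_scale)
    have "bil e e = (1 / sqrt (bil w w)) * ((1 / sqrt (bil w w)) * bil w w)"
      unfolding e_def using bil_sym[of "(1 / sqrt (bil w w)) *\<^sub>R w" w] by (simp only: bil_scale)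
    then have ee: "bil e e = 1" using ww by simp
    have "e \<notin> B" using be ee by force
    have eb: "bil e b = 0" if "b \<in> B" for b using be[OF that] bil_sym[of e b] by simp
    then show ?case
      using B on be ee \<open>e \<notin> B\<close> by (intro exI[of _ "insert e B"]) auto
  qed
  obtain B where B: "finite B" "card B = CARD('n)" and on: "\<forall>b\<in>B. \<forall>c\<in>B. bil b c = (if b = c then 1 else 0)"
    using ex[of "CARD('n)"] by auto
  obtain \<beta> where \<beta>: "bij_betw \<beta> (UNIV :: 'n set) B"
    using B by (metis finite_same_card_bij finite_class.finite_UNIV)
  define P :: "real^'n^'n" where "P = (\<chi> i j. \<beta> j $ i)"
  have "(transpose P ** H ** P) $ i $ j = bil (\<beta> i) (\<beta> j)" for i j
  proof -
    have "(transpose P ** H ** P) $ i $ j = (transpose P ** (H ** P)) $ i $ j"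
      by (simp add: matrix_mul_assoc)
    also have "\<dots> = bil (\<beta> i) (\<beta> j)"
      by (simp add: bil_def matrix_matrix_mult_def P_def transpose_def inner_vec_def matrix_vector_mult_def)
    finally show ?thesis .
  qed
  moreover have "bil (\<beta> i) (\<beta> j) = (if i = j then 1 else 0)" for i j
    using on \<beta> by (auto simp: bij_betw_def inj_on_def)
  ultimately have "transpose P ** H ** P = mat 1"
    by (simp add: vec_eq_iff mat_def)
  then show ?thesis by (rule that)
qed

lemma measurable_cis [measurable]: "cis \<in> borel_measurable borel"
  by (rule borel_measurable_continuous_onI) (intro continuous_intros)

lemma cis_sum: "cis (\<Sum>i\<in>A. f i) = (\<Prod>i\<in>A. cis (f i))"
  by (induction A rule: infinite_finite_induct) (auto simp flip: cis_mult)

text \<open>Taken from the characteristic function of the standard normal law at -t, with the factor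
  1 / sqrt (2 pi) cleared.\<close>

lemma
  fixes t :: real
  shows integrable_gaussian_1: "integrable lborel (\<lambda>x::real. complex_of_real (exp (- x\<^sup>2 / 2)) * cis (- (x * t)))"
    and integral_gaussian_1: "(\<integral>x. complex_of_real (exp (- x\<^sup>2 / 2)) * cis (- (x * t)) \<partial>lborel)
      = complex_of_real (sqrt (2 * pi) * exp (- t\<^sup>2 / 2))"
proof -
  have "integrable lborel (\<lambda>x. std_normal_density x)"
    by (rule integrable_normal_density) simp
  then have "integrable lborel (\<lambda>x. sqrt (2 * pi) * std_normal_density x)" by simp
  then have i: "integrable lborel (\<lambda>x::real. exp (- x\<^sup>2 / 2))"
    by (simp add: std_normal_density_def)
  show "integrable lborel (\<lambda>x::real. complex_of_real (exp (- x\<^sup>2 / 2)) * cis (- (x * t)))"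
    by (rule Bochner_Integration.integrable_bound[OF i]) (auto simp: norm_mult)
  have "complex_of_real (exp (- t\<^sup>2 / 2)) = char std_normal_distribution (- t)"
    by (simp add: char_std_normal_distribution)
  also have "\<dots> = (\<integral>x. std_normal_density x *\<^sub>R iexp (- t * x) \<partial>lborel)"
    unfolding char_def by (subst integral_density) auto
  also have "\<dots> = (\<integral>x. complex_of_real (1 / sqrt (2 * pi)) * (complex_of_real (exp (- x\<^sup>2 / 2)) * cis (- (x * t))) \<partial>lborel)"
    by (rule Bochner_Integration.integral_cong) (auto simp: std_normal_density_def scaleR_conv_of_real cis_conv_exp mult_ac)
  also have "\<dots> = complex_of_real (1 / sqrt (2 * pi)) * (\<integral>x. complex_of_real (exp (- x\<^sup>2 / 2)) * cis (- (x * t)) \<partial>lborel)"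
    by (rule integral_mult_right_zero)
  finally have "complex_of_real (sqrt (2 * pi)) * complex_of_real (exp (- t\<^sup>2 / 2))
    = (complex_of_real (sqrt (2 * pi)) * complex_of_real (1 / sqrt (2 * pi))) * (\<integral>x. complex_of_real (exp (- x\<^sup>2 / 2)) * cis (- (x * t)) \<partial>lborel)"
    by (simp only: mult.assoc)
  also have "complex_of_real (sqrt (2 * pi)) * complex_of_real (1 / sqrt (2 * pi)) = 1"
    by (simp flip: of_real_mult)
  finally show "(\<integral>x. complex_of_real (exp (- x\<^sup>2 / 2)) * cis (- (x * t)) \<partial>lborel)
      = complex_of_real (sqrt (2 * pi) * exp (- t\<^sup>2 / 2))"
    by simp
qed

lemma integral_gaussian_std:
  fixes u :: "real^'n::finite"
  shows "(\<integral>(x::real^'n). complex_of_real (exp (- (x \<bullet> x) / 2)) * cis (- (x \<bullet> u)) \<partial>lborel)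
      = complex_of_real (sqrt (2 * pi) ^ CARD('n) * exp (- (u \<bullet> u) / 2))"
proof -
  have sq: "- (x \<bullet> x) / 2 = (\<Sum>j\<in>UNIV. - (x $ j)\<^sup>2 / 2)" for x :: "real^'n"
    by (simp add: inner_vec_def power2_eq_square sum_negf flip: sum_divide_distrib)
  have ip: "- (x \<bullet> u) = (\<Sum>j\<in>UNIV. - (x $ j * u $ j))" for x :: "real^'n"
    by (simp add: inner_vec_def sum_negf)
  have eq: "(\<lambda>x::real^'n. complex_of_real (exp (- (x \<bullet> x) / 2)) * cis (- (x \<bullet> u)))
      = (\<lambda>x. \<Prod>j\<in>UNIV. complex_of_real (exp (- (x $ j)\<^sup>2 / 2)) * cis (- (x $ j * u $ j)))"
    unfolding sq ip cis_sum by (simp only: exp_sum[OF finite] of_real_prod prod.distrib)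
  show ?thesis
    unfolding eq unfolding sq integral_vec_prod[OF integrable_gaussian_1] integral_gaussian_1
    by (simp add: exp_sum prod.distrib)
qed

text \<open>Substituting x = P y, with P from \<open>quadratic_form_orthonormal\<close>, turns the
  form into y . y and u into P^T u. The relation P^T H P = 1 yields both det(P)^2 det H = 1 and
  H^(-1) = P P^T, which identify the constant and the exponent.\<close>

lemma
  fixes H :: "real^'n::finite^'n"
  assumes sym: "transpose H = H" and pd: "\<And>x. x \<noteq> 0 \<Longrightarrow> x \<bullet> (H *v x) > 0"
  shows det_pos_def: "det H > 0"
    and integral_gaussian_form: "(\<integral>x. complex_of_real (exp (- (x \<bullet> (H *v x)) / 2)) * cis (- (x \<bullet> u)) \<partial>lborel)
      = complex_of_real (sqrt ((2 * pi) ^ CARD('n) / det H) * exp (- (u \<bullet> (matrix_inv H *v u)) / 2))"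
proof -
  obtain P :: "real^'n^'n" where P: "transpose P ** H ** P = mat 1"
    using quadratic_form_orthonormal[OF sym pd] by blast
  have "det (transpose P ** H ** P) = 1" by (simp add: P)
  then have d: "(det P)\<^sup>2 * det H = 1"
    by (simp add: det_mul det_transpose power2_eq_square mult_ac)
  then have dP: "det P \<noteq> 0" by auto
  have "(det P)\<^sup>2 > 0" using dP by simp
  then show dH: "det H > 0" using d by (metis zero_less_mult_pos zero_less_one)
  have dP': "\<bar>det P\<bar> = sqrt (1 / det H)"
    using d dH by (metis nonzero_eq_divide_eq order_less_irrefl real_sqrt_abs)
  have "(P ** transpose P) ** H = mat 1"
  proof -
    have "transpose P ** (H ** P) = mat 1" using P by (simp add: matrix_mul_assoc)
    then have "(H ** P) ** transpose P = mat 1" by (rule matrix_left_right_inverse[THEN iffD1])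
    then have "H ** (P ** transpose P) = mat 1" by (simp add: matrix_mul_assoc)
    then show ?thesis by (rule matrix_left_right_inverse[THEN iffD1])
  qed
  then have inv: "matrix_inv H = P ** transpose P"
    by (metis matrix_inv_eqI matrix_left_right_inverse)
  have q1: "(P *v x) \<bullet> (H *v (P *v x)) = x \<bullet> x" for x
  proof -
    have "(P *v x) \<bullet> (H *v (P *v x)) = x \<bullet> (transpose P *v (H *v (P *v x)))"
      by (metis dot_lmul_matrix inner_commute vector_transpose_matrix)
    also have "\<dots> = x \<bullet> x" by (simp only: matrix_vector_mul_assoc matrix_mul_assoc P matrix_vector_mul_lid)
    finally show ?thesis .
  qed
  have q2: "(P *v x) \<bullet> u = x \<bullet> (transpose P *v u)" for x
    by (metis dot_lmul_matrix inner_commute vector_transpose_matrix)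
  have q3: "(transpose P *v u) \<bullet> (transpose P *v u) = u \<bullet> (matrix_inv H *v u)"
    by (simp only: q2[symmetric] inv inner_commute[of _ u] matrix_vector_mul_assoc)
  have m: "(\<lambda>x. complex_of_real (exp (- (x \<bullet> (H *v x)) / 2)) * cis (- (x \<bullet> u))) \<in> borel_measurable borel"
    by measurable
  show "(\<integral>x. complex_of_real (exp (- (x \<bullet> (H *v x)) / 2)) * cis (- (x \<bullet> u)) \<partial>lborel)
      = complex_of_real (sqrt ((2 * pi) ^ CARD('n) / det H) * exp (- (u \<bullet> (matrix_inv H *v u)) / 2))"
    unfolding integral_matrix_subst[OF dP m] q1 q2 integral_gaussian_std q3 dP'
    using dH by (simp add: real_sqrt_divide real_sqrt_power power_mult_distrib real_sqrt_mult scaleR_conv_of_real)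
qed

subsection \<open>Fourier inversion\<close>

definition rvec :: "('n::finite \<Rightarrow> nat) \<Rightarrow> real^'n" where
  "rvec k = (\<chi> j. real (k j))"

definition ivec :: "('n::finite \<Rightarrow> int) \<Rightarrow> real^'n" where
  "ivec x = (\<chi> j. of_int (x j))"

text \<open>Closed, hence compact, as the lower bound for \<open>defect\<close> requires; the
  coincidence of opposite faces modulo 2 pi concerns a null set and leaves Fourier integrals
  unaffected.\<close>

definition pi_box :: "(real^'n::finite) set" where
  "pi_box = {t. \<forall>j. \<bar>t $ j\<bar> \<le> pi}"

text \<open>Extension by zero to all integer vectors: differences such as \<kappa> - k - m can be
  inserted without side conditions, and sums over m need no upper limit.\<close>

definition extz :: "(('n \<Rightarrow> nat) \<Rightarrow> 'a::zero) \<Rightarrow> ('n \<Rightarrow> int) \<Rightarrow> 'a" where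
  "extz f x = (if \<forall>j. x j \<ge> 0 then f (\<lambda>j. nat (x j)) else 0)"

lemma rvec_eq_ivec: "rvec k = ivec (\<lambda>j. int (k j))"
  by (simp add: rvec_def ivec_def)

lemma infinite_UNIV_multi_index: "infinite (UNIV :: ('n \<Rightarrow> nat) set)"
proof
  assume "finite (UNIV :: ('n \<Rightarrow> nat) set)"
  then have "finite (range (\<lambda>m _. m :: nat) :: ('n \<Rightarrow> nat) set)" by (rule finite_subset[rotated]) auto
  moreover have "inj (\<lambda>m (_::'n). m :: nat)" by (auto simp: inj_def fun_eq_iff)
  ultimately show False using finite_imageD by blast
qed

text \<open>An enumeration of the index type reduces the exchange to \<open>integral_suminf\<close>;
  since the type is infinite, the enumeration is a bijection with the naturals.\<close>

lemma integral_infsum: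
  fixes f :: "'k::countable \<Rightarrow> 'a \<Rightarrow> 'b::{banach,second_countable_topology}"
  assumes inf: "infinite (UNIV :: 'k set)"
    and int: "\<And>k. integrable M (f k)"
    and s: "\<And>x. (\<lambda>k. norm (f k x)) summable_on UNIV"
    and si: "(\<lambda>k. \<integral>x. norm (f k x) \<partial>M) summable_on UNIV"
  shows "(\<integral>x. (\<Sum>\<^sub>\<infinity>k. f k x) \<partial>M) = (\<Sum>\<^sub>\<infinity>k. \<integral>x. f k x \<partial>M)"
proof -
  obtain b :: "nat \<Rightarrow> 'k" where b: "bij_betw b UNIV UNIV"
    using inf bij_betw_from_nat_into[of "UNIV :: 'k set"] by auto
  have sumb: "(\<Sum>\<^sub>\<infinity>k. h k) = (\<Sum>i. h (b i))" if "(\<lambda>k. norm (h k)) summable_on UNIV" for h :: "'k \<Rightarrow> 'b"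
  proof -
    have "(\<lambda>i. h (b i)) summable_on UNIV"
      using abs_summable_summable[OF that] summable_on_reindex_bij_betw[OF b, of h] by simp
    then have "(\<lambda>i. h (b i)) sums (\<Sum>\<^sub>\<infinity>i. h (b i))" by (intro has_sum_imp_sums has_sum_infsum)
    then show ?thesis using infsum_reindex_bij_betw[OF b, of h] by (simp add: sums_iff)
  qed
  have sb: "AE x in M. summable (\<lambda>i. norm (f (b i) x))"
    using s summable_on_reindex_bij_betw[OF b, of "\<lambda>k. norm (f k _)"]
    by (intro AE_I2 summable_on_imp_summable) auto
  have sib: "summable (\<lambda>i. \<integral>x. norm (f (b i) x) \<partial>M)"
    using si summable_on_reindex_bij_betw[OF b, of "\<lambda>k. \<integral>x. norm (f k x) \<partial>M"]
    by (intro summable_on_imp_summable) auto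
  have "(\<integral>x. (\<Sum>\<^sub>\<infinity>k. f k x) \<partial>M) = (\<Sum>i. \<integral>x. f (b i) x \<partial>M)"
    using integral_suminf[OF int sb sib] by (simp add: sumb[OF s])
  also have "\<dots> = (\<Sum>\<^sub>\<infinity>k. \<integral>x. f k x \<partial>M)"
  proof (rule sumb[symmetric], rule summable_on_comparison_test[OF si])
    show "norm (\<integral>x. f k x \<partial>M) \<le> (\<integral>x. norm (f k x) \<partial>M)" for k by simp
  qed auto
  finally show "(\<integral>x. (\<Sum>\<^sub>\<infinity>k. f k x) \<partial>M) = (\<Sum>\<^sub>\<infinity>k. \<integral>x. f k x \<partial>M)" .
qed

lemma has_bochner_integral_cis:
  fixes m :: int
  shows "has_bochner_integral lborel (\<lambda>t. indicator {-pi..pi} t *\<^sub>R cis (t * of_int m)) (if m = 0 then 2 * pi else 0)"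
proof (cases "m = 0")
  case True
  have "has_bochner_integral lborel (\<lambda>t. indicator {-pi..pi} t *\<^sub>R cis (t * of_int m)) (of_real pi - of_real (- pi))"
    by (rule has_bochner_integral_FTC_Icc)
       (auto simp: True has_real_derivative_iff_has_vector_derivative[symmetric] intro!: derivative_eq_intros)
  then show ?thesis by (simp add: True)
next
  case False
  define F where "F t = cis (t * of_int m) / (\<i> * of_int m)" for t
  have d: "(F has_vector_derivative cis (t * of_int m)) (at t within A)" for t A
  proof -
    have "((\<lambda>z. exp (\<i> * (z * of_int m)) / (\<i> * of_int m)) has_field_derivative exp (\<i> * (of_real t * of_int m))) (at (of_real t))"
      using False by (auto intro!: derivative_eq_intros simp: mult_ac)
    from has_vector_derivative_real_field[OF this] show ?thesis
      by (simp add: F_def[abs_def] cis_conv_exp)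
  qed
  have "has_bochner_integral lborel (\<lambda>t. indicator {-pi..pi} t *\<^sub>R cis (t * of_int m)) (F pi - F (-pi))"
    by (rule has_bochner_integral_FTC_Icc) (auto intro!: d continuous_intros)
  \<comment> \<open>The endpoints differ by m full turns, so the antiderivative agrees there and the
    integral vanishes.\<close>
  moreover have "F pi = F (-pi)"
  proof -
    have "cis (pi * of_int m) = cis (- pi * of_int m) * cis (2 * pi * of_int m)"
      unfolding cis_mult by (rule arg_cong[where f = cis]) (simp add: algebra_simps)
    also have "cis (2 * pi * of_int m) = 1" by (rule cis_multiple_2pi) auto
    finally have "cis (pi * of_int m) = cis (- pi * of_int m)" by simp
    then show ?thesis by (simp only: F_def)
  qed
  ultimately show ?thesis using False by simp
qed

lemma indicator_pi_box: "indicator pi_box t = (\<Prod>j\<in>UNIV. indicator {-pi..pi} (t $ j) :: real)"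
proof (cases "t \<in> pi_box")
  case True then show ?thesis by (auto simp: pi_box_def abs_le_iff indicator_def minus_le_iff intro!: prod.neutral[symmetric])
next
  case False
  then obtain j where "\<not> \<bar>t $ j\<bar> \<le> pi" by (auto simp: pi_box_def)
  then have "indicator {-pi..pi} (t $ j) = (0::real)" by (auto simp: indicator_def)
  then have "(\<Prod>j\<in>UNIV. indicator {-pi..pi} (t $ j) :: real) = 0" by (intro prod_zero) auto
  then show ?thesis using False by simp
qed

lemma
  fixes x :: "'n::finite \<Rightarrow> int"
  shows integrable_pi_box_cis: "integrable lborel (\<lambda>t. indicator pi_box t *\<^sub>R cis (t \<bullet> ivec x))"
    and integral_pi_box_cis: "(\<integral>t. indicator pi_box t *\<^sub>R cis (t \<bullet> ivec x) \<partial>lborel) = (if x = (\<lambda>_. 0) then (2 * pi) ^ CARD('n) else 0)"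
proof -
  have eq: "(\<lambda>t. indicator pi_box t *\<^sub>R cis (t \<bullet> ivec x)) = (\<lambda>t. \<Prod>j\<in>UNIV. indicator {-pi..pi} (t $ j) *\<^sub>R cis (t $ j * of_int (x j)))"
    by (simp add: fun_eq_iff indicator_pi_box scaleR_conv_of_real prod.distrib inner_vec_def ivec_def cis_sum)
  note i = has_bochner_integral_cis[unfolded has_bochner_integral_iff]
  show "integrable lborel (\<lambda>t. indicator pi_box t *\<^sub>R cis (t \<bullet> ivec x))"
    unfolding eq using i by (intro integrable_vec_prod) auto
  have "(\<integral>t. indicator pi_box t *\<^sub>R cis (t \<bullet> ivec x) \<partial>lborel) = (\<Prod>j\<in>UNIV. if x j = 0 then complex_of_real (2 * pi) else 0)"
    unfolding eq using i by (subst integral_vec_prod) (auto intro!: prod.cong)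
  also have "\<dots> = (if x = (\<lambda>_. 0) then (2 * pi) ^ CARD('n) else 0)"
    by (auto simp: fun_eq_iff intro!: prod_zero)
  finally show "(\<integral>t. indicator pi_box t *\<^sub>R cis (t \<bullet> ivec x) \<partial>lborel) = (if x = (\<lambda>_. 0) then (2 * pi) ^ CARD('n) else 0)" .
qed

lemma pi_box_measurable [measurable]: "pi_box \<in> sets borel"
  by (rule borel_closed) (unfold pi_box_def, intro closed_Collect_all closed_Collect_le continuous_intros)

text \<open>Absolute summability permits termwise integration, and orthogonality of the characters
  keeps only the term with k = x. If x has a negative coordinate no k qualifies, in accordance with
  the value 0 of \<open>extz\<close>.\<close>

lemma fourier_inversion:
  fixes f :: "('n::finite \<Rightarrow> nat) \<Rightarrow> complex" and x :: "'n \<Rightarrow> int"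
  assumes f: "(\<lambda>k. norm (f k)) summable_on UNIV"
  shows "(\<integral>t. indicator pi_box t *\<^sub>R ((\<Sum>\<^sub>\<infinity>k. f k * cis (t \<bullet> rvec k)) * cis (- (t \<bullet> ivec x))) \<partial>lborel)
    = (2 * pi) ^ CARD('n) * extz f x"
proof -
  define g where "g k t = f k * (indicator pi_box t *\<^sub>R cis (t \<bullet> ivec (\<lambda>j. int (k j) - x j)))" for k t
  have cc: "cis (t \<bullet> ivec (\<lambda>j. int (k j) - x j)) = cis (t \<bullet> rvec k) * cis (- (t \<bullet> ivec x))" for t :: "real^'n" and k
  proof -
    have "ivec (\<lambda>j. int (k j) - x j) = rvec k - ivec x" by (simp add: ivec_def rvec_def vec_eq_iff)
    then show ?thesis by (simp add: cis_mult inner_diff_right)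
  qed
  have ng: "norm (g k t) = norm (f k) * indicator pi_box t" for k t
    by (simp add: g_def norm_mult)
  have v: "integrable lborel (\<lambda>t. indicator pi_box t :: real)" for t :: "real^'n"
    using integrable_norm[OF integrable_pi_box_cis[of "\<lambda>_. 0"]] by simp
  have ig: "integrable lborel (g k)" for k
    unfolding g_def using integrable_pi_box_cis by (intro integrable_mult_right) auto
  have "(\<integral>t. indicator pi_box t *\<^sub>R ((\<Sum>\<^sub>\<infinity>k. f k * cis (t \<bullet> rvec k)) * cis (- (t \<bullet> ivec x))) \<partial>lborel)
      = (\<integral>t. (\<Sum>\<^sub>\<infinity>k. g k t) \<partial>lborel)"
  proof (rule Bochner_Integration.integral_cong)
    fix t :: "real^'n"
    have "(\<lambda>k. f k * cis (t \<bullet> rvec k)) summable_on UNIV"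
      by (rule abs_summable_summable) (simp add: norm_mult f)
    then have "(\<Sum>\<^sub>\<infinity>k. f k * cis (t \<bullet> rvec k)) * (indicator pi_box t *\<^sub>R cis (- (t \<bullet> ivec x))) = (\<Sum>\<^sub>\<infinity>k. f k * cis (t \<bullet> rvec k) * (indicator pi_box t *\<^sub>R cis (- (t \<bullet> ivec x))))"
      by (intro infsum_cmult_left[symmetric])
    moreover have "g k t = f k * cis (t \<bullet> rvec k) * (indicator pi_box t *\<^sub>R cis (- (t \<bullet> ivec x)))" for k
      by (simp add: g_def cc)
    ultimately show "indicator pi_box t *\<^sub>R ((\<Sum>\<^sub>\<infinity>k. f k * cis (t \<bullet> rvec k)) * cis (- (t \<bullet> ivec x))) = (\<Sum>\<^sub>\<infinity>k. g k t)"
      by (metis (no_types, lifting) infsum_cong mult_scaleR_right)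
  qed simp
  also have "\<dots> = (\<Sum>\<^sub>\<infinity>k. \<integral>t. g k t \<partial>lborel)"
  proof (rule integral_infsum[OF infinite_UNIV_multi_index ig])
    show "(\<lambda>k. norm (g k t)) summable_on UNIV" for t
      unfolding ng by (intro summable_on_cmult_left f)
    show "(\<lambda>k. \<integral>t. norm (g k t) \<partial>lborel) summable_on UNIV"
      unfolding ng by (simp add: summable_on_cmult_left f)
  qed
  also have "\<dots> = (\<Sum>\<^sub>\<infinity>k. if (\<lambda>j. int (k j) - x j) = (\<lambda>_. 0) then f k * (2 * pi) ^ CARD('n) else 0)"
    unfolding g_def integral_mult_right_zero integral_pi_box_cis by (rule infsum_cong) simp
  also have "\<dots> = (2 * pi) ^ CARD('n) * extz f x"
  proof (cases "\<forall>j. x j \<ge> 0")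
    case True
    have eq: "(\<lambda>j. int (k j) - x j) = (\<lambda>_. 0) \<longleftrightarrow> k = (\<lambda>j. nat (x j))" for k
      using True by (auto simp: fun_eq_iff) (metis True nat_int)
    show ?thesis
      unfolding eq using True
      by (intro infsumI has_sum_finite_neutralI[of "{\<lambda>j. nat (x j)}"]) (auto simp: extz_def)
  next
    case False
    then have "(\<lambda>j. int (k j) - x j) \<noteq> (\<lambda>_. 0)" for k
      by (auto simp: fun_eq_iff) (metis of_nat_0_le_iff right_minus_eq)
    then show ?thesis using False by (auto simp: extz_def)
  qed
  finally show ?thesis .
qed

subsection \<open>Decay of the characteristic function\<close>

text \<open>Total degree; |s . k| is at most the largest |s_j| times it, so a single exponential
  moment in it controls every small tilt.\<close>

definition deg :: "('n::finite \<Rightarrow> nat) \<Rightarrow> real" where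
  "deg k = (\<Sum>j\<in>UNIV. real (k j))"

lemma deg_nonneg [simp]: "deg k \<ge> 0"
  by (simp add: deg_def sum_nonneg)

lemma norm_rvec_le: "norm (rvec k) \<le> deg k"
  using norm_le_l1_cart[of "rvec k"] by (simp add: rvec_def deg_def)

lemma inner_rvec_bound:
  assumes "\<And>j. \<bar>s $ j\<bar> \<le> e"
  shows "\<bar>s \<bullet> rvec k\<bar> \<le> e * deg k"
proof -
  have "\<bar>s \<bullet> rvec k\<bar> \<le> (\<Sum>j\<in>UNIV. \<bar>s $ j * real (k j)\<bar>)"
    unfolding inner_vec_def rvec_def by (simp add: sum_abs)
  also have "\<dots> \<le> (\<Sum>j\<in>UNIV. e * real (k j))"
    using assms by (intro sum_mono) (auto simp: abs_mult intro!: mult_right_mono)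
  finally show ?thesis by (simp add: deg_def sum_distrib_left)
qed

lemma has_sum_diff:
  fixes f g :: "'a \<Rightarrow> 'b::topological_ab_group_add"
  assumes "(f has_sum a) A" "(g has_sum b) A"
  shows "((\<lambda>x. f x - g x) has_sum (a - b)) A"
  using has_sum_add[OF assms(1), of "\<lambda>x. - g x" "- b"] assms(2) by (simp add: has_sum_uminus)

section \<open>Elementary inequalities for phases\<close>

lemma norm_cis_diff: "norm (cis a - cis b) \<le> \<bar>a - b\<bar>"
proof -
  have "cis a - cis b = cis b * (cis (a - b) - 1)"
    by (simp add: algebra_simps cis_mult)
  then have "norm (cis a - cis b) = norm (iexp (a - b) - (\<Sum>k\<le>0. (\<i> * complex_of_real (a - b)) ^ k / fact k))"
    by (simp add: norm_mult cis_conv_exp)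
  also have "\<dots> \<le> \<bar>a - b\<bar>" using iexp_approx1[of "a - b" 0] by simp
  finally show ?thesis .
qed

text \<open>The second-order Taylor polynomial with remainder |u|^3 / 6 <= u^2 / 6 even leaves 1 -
  cos u >= u^2 / 3.\<close>

lemma one_minus_cos_ge:
  fixes u :: real
  assumes "\<bar>u\<bar> \<le> 1" shows "u\<^sup>2 / 4 \<le> 1 - cos u"
proof -
  have "\<bar>Re (iexp u - (\<Sum>k\<le>2. (\<i> * complex_of_real u) ^ k / fact k))\<bar> \<le> \<bar>u\<bar> ^ 3 / 6"
    using order.trans[OF abs_Re_le_cmod iexp_approx1[of u 2]] by (simp add: eval_nat_numeral)
  moreover have "Re (iexp u - (\<Sum>k\<le>2. (\<i> * complex_of_real u) ^ k / fact k)) = cos u - 1 + u\<^sup>2 / 2"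
    by (simp add: Re_exp eval_nat_numeral)
  ultimately have "cos u - 1 + u\<^sup>2 / 2 \<le> \<bar>u\<bar> ^ 3 / 6" by linarith
  also have "\<bar>u\<bar> ^ 3 = u\<^sup>2 * \<bar>u\<bar>" by (simp add: eval_nat_numeral)
  also have "u\<^sup>2 * \<bar>u\<bar> \<le> u\<^sup>2 * 1" using assms by (intro mult_left_mono) auto
  finally show ?thesis using zero_le_power2[of u] by linarith
qed

text \<open>A relaxed triangle inequality for half the squared chord on the unit circle, from 1 -
  cos z = 2 sin^2 (z / 2) and (a + b)^2 <= 2 (a^2 + b^2). It serves to eliminate an unknown
  reference phase from two terms.\<close>

lemma one_minus_cos_diff_le: "1 - cos (x - y) \<le> 2 * ((1 - cos x) + (1 - cos y))" for x y :: real
proof -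
  have c: "1 - cos z = 2 * (sin (z / 2))\<^sup>2" for z :: real
    using cos_double_sin[of "z / 2"] by simp
  have "\<bar>sin (x / 2 - y / 2)\<bar> \<le> \<bar>sin (x / 2)\<bar> * \<bar>cos (y / 2)\<bar> + \<bar>cos (x / 2)\<bar> * \<bar>sin (y / 2)\<bar>"
    unfolding sin_diff abs_mult[symmetric] by (rule abs_triangle_ineq4)
  also have "\<dots> \<le> \<bar>sin (x / 2)\<bar> * 1 + 1 * \<bar>sin (y / 2)\<bar>"
    by (intro add_mono mult_mono) auto
  finally have "(sin (x / 2 - y / 2))\<^sup>2 \<le> (\<bar>sin (x / 2)\<bar> + \<bar>sin (y / 2)\<bar>)\<^sup>2"
    by (intro power2_le_iff_abs_le[THEN iffD2]) auto
  also have "\<dots> \<le> 2 * ((sin (x / 2))\<^sup>2 + (sin (y / 2))\<^sup>2)"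
    using sum_squares_bound[of "\<bar>sin (x / 2)\<bar>" "\<bar>sin (y / 2)\<bar>"] by (simp add: power2_sum)
  finally show ?thesis unfolding c by (simp add: diff_divide_distrib)
qed

section \<open>The defect of a trigonometric sum: total mass minus modulus\<close>

abbreviation trig :: "('k \<Rightarrow> real) \<Rightarrow> ('k \<Rightarrow> real) \<Rightarrow> complex" where
  "trig w \<phi> \<equiv> \<Sum>\<^sub>\<infinity>k. complex_of_real (w k) * cis (\<phi> k)"

lemma
  assumes "w summable_on UNIV" "\<And>k. w k \<ge> (0::real)"
  shows norm_summable_on_of_real_cis: "(\<lambda>k. norm (complex_of_real (w k) * cis (\<phi> k))) summable_on UNIV"
    and summable_on_of_real_cis: "(\<lambda>k. complex_of_real (w k) * cis (\<phi> k)) summable_on UNIV"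
proof -
  show "(\<lambda>k. norm (complex_of_real (w k) * cis (\<phi> k))) summable_on UNIV"
    using assms by (simp add: norm_mult)
  then show "(\<lambda>k. complex_of_real (w k) * cis (\<phi> k)) summable_on UNIV"
    by (rule abs_summable_summable)
qed

lemma has_sum_one_minus_cos:
  assumes w: "w summable_on UNIV" "\<And>k. w k \<ge> (0::real)"
  shows "((\<lambda>k. w k * (1 - cos (\<phi> k - \<alpha>))) has_sum
    (infsum w UNIV - Re (cis (- \<alpha>) * (trig w \<phi>)))) UNIV"
proof -
  define z where "z = (trig w \<phi>)"
  have "((\<lambda>k. complex_of_real (w k) * cis (\<phi> k)) has_sum z) UNIV"
    unfolding z_def by (intro has_sum_infsum summable_on_of_real_cis w)
  then have "((\<lambda>k. Re (cis (- \<alpha>) * (complex_of_real (w k) * cis (\<phi> k)))) has_sum Re (cis (- \<alpha>) * z)) UNIV"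
    by (intro has_sum_Re has_sum_cmult_right)
  moreover have "Re (cis (- \<alpha>) * (complex_of_real (w k) * cis (\<phi> k))) = w k * cos (\<phi> k - \<alpha>)" for k
    by (simp add: cos_diff distrib_left mult_ac)
  ultimately have "((\<lambda>k. w k * cos (\<phi> k - \<alpha>)) has_sum Re (cis (- \<alpha>) * z)) UNIV"
    by (simp only:)
  from has_sum_diff[OF has_sum_infsum[OF w(1)] this]
  show ?thesis by (simp only: right_diff_distrib mult_1_right z_def)
qed

text \<open>Rotating the sum by its own argument makes it real and equal to its modulus, so the
  defect becomes a series of nonnegative terms with the common phase \<alpha>.\<close>

lemma phase_defect:
  assumes w: "w summable_on UNIV" "\<And>k. w k \<ge> (0::real)"
  obtains \<alpha> where "((\<lambda>k. w k * (1 - cos (\<phi> k - \<alpha>))) has_sum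
    (infsum w UNIV - norm (trig w \<phi>))) UNIV"
proof -
  define z where "z = (trig w \<phi>)"
  have "cis (- Arg z) * z = cis (- Arg z) * rcis (norm z) (Arg z)" by (simp add: rcis_cmod_Arg)
  also have "\<dots> = of_real (norm z)" by (simp add: rcis_def cis_mult)
  finally have "Re (cis (- Arg z) * z) = norm z" by simp
  then show ?thesis using has_sum_one_minus_cos[OF w, of \<phi> "Arg z"] that by (simp add: z_def)
qed

text \<open>For every phase the series of \<open>has_sum_one_minus_cos\<close> is at least the
  defect, with equality at the optimal phase. The phase optimal for w is admissible for v, and the
  terms are monotone in the weight.\<close>

lemma phase_defect_mono:
  assumes w: "w summable_on UNIV" "\<And>k. w k \<ge> (0::real)"
    and v: "v summable_on UNIV" "\<And>k. v k \<ge> 0" "\<And>k. v k \<le> w k"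
  shows "infsum v UNIV - norm (trig v \<phi>)
       \<le> infsum w UNIV - norm (trig w \<phi>)"
proof -
  obtain \<alpha> where \<alpha>: "((\<lambda>k. w k * (1 - cos (\<phi> k - \<alpha>))) has_sum
    (infsum w UNIV - norm (trig w \<phi>))) UNIV"
    by (rule phase_defect[OF w])
  have "Re (cis (- \<alpha>) * (trig v \<phi>)) \<le> norm (trig v \<phi>)"
    using complex_Re_le_cmod[of "cis (- \<alpha>) * (trig v \<phi>)"] by (simp add: norm_mult)
  moreover have "infsum v UNIV - Re (cis (- \<alpha>) * (trig v \<phi>))
      \<le> infsum w UNIV - norm (trig w \<phi>)"
    by (rule has_sum_mono[OF has_sum_one_minus_cos[OF v(1,2)] \<alpha>]) (use v in \<open>auto intro!: mult_right_mono\<close>)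
  ultimately show ?thesis by linarith
qed

text \<open>Only the terms k and l of the nonnegative series are kept; replacing both weights by
  their minimum allows \<open>one_minus_cos_diff_le\<close> to remove \<alpha>.\<close>

lemma phase_defect_pair:
  assumes w: "w summable_on UNIV" "\<And>k. w k \<ge> (0::real)"
  shows "min (w k) (w l) * (1 - cos (\<phi> k - \<phi> l)) / 2
       \<le> infsum w UNIV - norm (trig w \<phi>)"
proof -
  obtain \<alpha> where \<alpha>: "((\<lambda>k. w k * (1 - cos (\<phi> k - \<alpha>))) has_sum
    (infsum w UNIV - norm (trig w \<phi>))) UNIV"
    by (rule phase_defect[OF w])
  have nn: "0 \<le> w k * (1 - cos (\<phi> k - \<alpha>))" for k using w(2) by simp
  show ?thesis
  proof (cases "k = l")
    case True
    have "0 \<le> infsum w UNIV - norm (trig w \<phi>)"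
      using \<alpha> by (rule has_sum_nonneg) (rule nn)
    then show ?thesis using True by simp
  next
    case False
    have "min (w k) (w l) * (1 - cos (\<phi> k - \<phi> l)) / 2
        \<le> min (w k) (w l) * (2 * ((1 - cos (\<phi> k - \<alpha>)) + (1 - cos (\<phi> l - \<alpha>)))) / 2"
      using one_minus_cos_diff_le[of "\<phi> k - \<alpha>" "\<phi> l - \<alpha>"] w(2)
      by (intro divide_right_mono mult_left_mono) auto
    also have "\<dots> = min (w k) (w l) * (1 - cos (\<phi> k - \<alpha>)) + min (w k) (w l) * (1 - cos (\<phi> l - \<alpha>))"
    proof -
      have "m * (2 * (a + b)) / 2 = m * a + m * b" for m a b :: real by (simp add: distrib_left)
      then show ?thesis .
    qed
    also have "\<dots> \<le> w k * (1 - cos (\<phi> k - \<alpha>)) + w l * (1 - cos (\<phi> l - \<alpha>))"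
      by (intro add_mono mult_right_mono) auto
    also have "\<dots> = (\<Sum>k\<in>{k, l}. w k * (1 - cos (\<phi> k - \<alpha>)))" using False by simp
    also have "\<dots> \<le> infsum w UNIV - norm (trig w \<phi>)"
      using \<alpha> by (rule finite_sum_le_has_sum) (auto simp: nn)
    finally show ?thesis .
  qed
qed

text \<open>The first moment is a Lipschitz constant, since the phase of the k-th term changes by at
  most |t - u| deg k.\<close>

lemma continuous_on_trig_series:
  fixes w :: "('n::finite \<Rightarrow> nat) \<Rightarrow> real"
  assumes w: "w summable_on UNIV" "\<And>k. w k \<ge> 0" and wd: "(\<lambda>k. w k * deg k) summable_on UNIV"
  shows "continuous_on UNIV (\<lambda>t. trig w (\<lambda>k. t \<bullet> rvec k))"
proof -
  let ?f = "\<lambda>t. trig w (\<lambda>k. t \<bullet> rvec k)"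
  have s: "(\<lambda>k. complex_of_real (w k) * cis (t \<bullet> rvec k)) summable_on UNIV" for t
    by (intro summable_on_of_real_cis w)
  have "dist (?f t) (?f u) \<le> (\<Sum>\<^sub>\<infinity>k. w k * deg k) * dist t u" for t u
  proof -
    have b: "norm (complex_of_real (w k) * cis (t \<bullet> rvec k) - complex_of_real (w k) * cis (u \<bullet> rvec k)) \<le> w k * deg k * dist t u" for k
    proof -
      have "norm (complex_of_real (w k) * cis (t \<bullet> rvec k) - complex_of_real (w k) * cis (u \<bullet> rvec k))
          = w k * norm (cis (t \<bullet> rvec k) - cis (u \<bullet> rvec k))"
        using w(2) by (simp add: norm_mult flip: right_diff_distrib)
      also have "\<dots> \<le> w k * \<bar>t \<bullet> rvec k - u \<bullet> rvec k\<bar>"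
        using w(2) norm_cis_diff by (intro mult_left_mono) auto
      also have "\<dots> \<le> w k * (dist t u * deg k)"
      proof (rule mult_left_mono)
        have "\<bar>(t - u) \<bullet> rvec k\<bar> \<le> norm (t - u) * norm (rvec k)" by (rule Cauchy_Schwarz_ineq2)
        also have "\<dots> \<le> norm (t - u) * deg k" by (intro mult_left_mono norm_rvec_le) auto
        finally show "\<bar>t \<bullet> rvec k - u \<bullet> rvec k\<bar> \<le> dist t u * deg k" by (simp add: inner_diff_left dist_norm)
      qed (use w(2) in auto)
      finally show ?thesis by (simp add: mult_ac)
    qed
    have "((\<lambda>k. complex_of_real (w k) * cis (t \<bullet> rvec k) - complex_of_real (w k) * cis (u \<bullet> rvec k)) has_sum (?f t - ?f u)) UNIV"
      by (intro has_sum_diff has_sum_infsum s)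
    moreover have "((\<lambda>k. w k * deg k * dist t u) has_sum ((\<Sum>\<^sub>\<infinity>k. w k * deg k) * dist t u)) UNIV"
      by (intro has_sum_cmult_left has_sum_infsum wd)
    ultimately show ?thesis unfolding dist_norm
      by (rule norm_infsum_le) (use b in \<open>simp add: dist_norm\<close>)
  qed
  then have "(\<Sum>\<^sub>\<infinity>k. w k * deg k)-lipschitz_on UNIV ?f"
    using w(2) by (intro lipschitz_onI) (auto intro!: infsum_nonneg)
  then show ?thesis by (rule lipschitz_on_continuous_on)
qed

lemma power_div_fact_le_exp:
  fixes x :: real assumes "x \<ge> 0" shows "x ^ r / fact r \<le> exp x"
proof -
  have "(\<Sum>i\<in>{r}. inverse (fact i) * x ^ i) \<le> (\<Sum>i. inverse (fact i) * x ^ i)"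
    using assms by (intro sum_le_suminf summable_exp) auto
  then show ?thesis by (simp add: exp_def divide_inverse mult.commute)
qed

text \<open>The exponential moment is assumed at \<open>2 * e\<close>, twice the largest tilt
  considered: after a tilt with |s_j| <= e a factor exp (e deg k) is still available to absorb
  polynomial weights.\<close>

locale lattice_dist =
  fixes p :: "('n::finite \<Rightarrow> nat) \<Rightarrow> real" and mu :: "real^'n" and e :: real
  assumes p_nonneg: "p k \<ge> 0" and e_pos: "e > 0"
    and p_exp: "(\<lambda>k. p k * exp (2 * e * deg k)) summable_on UNIV"
    and p_sum: "(p has_sum 1) UNIV"
    and p_mean: "((\<lambda>k. p k * real (k j)) has_sum mu $ j) UNIV"
    and p_full_rank: "full_rank p" and p_aperiodic: "aperiodic p"
begin

lemma summable_moment: "(\<lambda>k. p k * (deg k ^ r * exp (e * deg k))) summable_on UNIV"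
proof (rule summable_on_comparison_test)
  show "(\<lambda>k. fact r / e ^ r * (p k * exp (2 * e * deg k))) summable_on UNIV"
    by (rule summable_on_cmult_right[OF p_exp])
  fix k :: "'n \<Rightarrow> nat"
  have "(e * deg k) ^ r / fact r \<le> exp (e * deg k)"
    using e_pos by (intro power_div_fact_le_exp) auto
  then have "deg k ^ r \<le> fact r / e ^ r * exp (e * deg k)"
    using e_pos by (simp add: power_mult_distrib field_simps)
  then have "p k * (deg k ^ r * exp (e * deg k)) \<le> p k * (fact r / e ^ r * exp (e * deg k) * exp (e * deg k))"
    using p_nonneg by (intro mult_left_mono mult_right_mono) auto
  also have "\<dots> = fact r / e ^ r * (p k * exp (2 * e * deg k))"
    by (simp flip: exp_add add: mult_ac)
  finally show "p k * (deg k ^ r * exp (e * deg k)) \<le> fact r / e ^ r * (p k * exp (2 * e * deg k))" .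
qed (use p_nonneg in auto)

lemma p_summable: "p summable_on UNIV" and p_infsum: "infsum p UNIV = 1"
  using p_sum by (auto intro: has_sum_imp_summable infsumI)

lemma summable_bound:
  fixes g :: "('n \<Rightarrow> nat) \<Rightarrow> 'b::banach"
  assumes "\<And>k. norm (g k) \<le> C * (p k * (deg k ^ r * exp (e * deg k)))"
  shows "(\<lambda>k. norm (g k)) summable_on UNIV" "g summable_on UNIV"
proof -
  show "(\<lambda>k. norm (g k)) summable_on UNIV"
    using summable_on_cmult_right[OF summable_moment[of r], of C] assms
    by (rule summable_on_comparison_test) auto
  then show "g summable_on UNIV" by (rule abs_summable_summable)
qed

definition mg :: "real^'n \<Rightarrow> real" where
  "mg s = (\<Sum>\<^sub>\<infinity>k. p k * exp (s \<bullet> rvec k))"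

text \<open>This is E exp ((s + i t) . X), the characteristic function of the law tilted by s, left
  unnormalised; its value at t = 0 is \<open>mg s\<close>.\<close>

definition cf :: "real^'n \<Rightarrow> real^'n \<Rightarrow> complex" where
  "cf s t = (\<Sum>\<^sub>\<infinity>k. complex_of_real (p k * exp (s \<bullet> rvec k)) * cis (t \<bullet> rvec k))"

lemma tilt_le:
  assumes "\<And>j. \<bar>s $ j\<bar> \<le> e"
  shows "p k * exp (s \<bullet> rvec k) \<le> p k * exp (e * deg k)"
    and "p k * exp (- (e * deg k)) \<le> p k * exp (s \<bullet> rvec k)"
  using inner_rvec_bound[OF assms, of k] p_nonneg by (auto intro!: mult_left_mono simp: abs_le_iff)

lemma tilt_summable:
  assumes "\<And>j. \<bar>s $ j\<bar> \<le> e"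
  shows "(\<lambda>k. p k * exp (s \<bullet> rvec k)) summable_on UNIV"
    and "(\<lambda>k. p k * exp (s \<bullet> rvec k) * deg k) summable_on UNIV"
proof -
  show "(\<lambda>k. p k * exp (s \<bullet> rvec k)) summable_on UNIV"
    by (rule summable_bound(2)[of _ 1 0]) (use tilt_le[OF assms] p_nonneg in auto)
  show "(\<lambda>k. p k * exp (s \<bullet> rvec k) * deg k) summable_on UNIV"
    by (rule summable_bound(2)[of _ 1 1])
       (use mult_right_mono[OF tilt_le(1)[OF assms] deg_nonneg] p_nonneg in \<open>auto simp: mult_ac\<close>)
qed

lemma cf_continuous:
  assumes "\<And>j. \<bar>s $ j\<bar> \<le> e"
  shows "continuous_on UNIV (cf s)"
  unfolding cf_def[abs_def] using p_nonneg tilt_summable[OF assms]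
  by (intro continuous_on_trig_series) auto

text \<open>A common lower bound for the tilted weights over all s with |s_j| <= e. By
  \<open>phase_defect_mono\<close> its defect bounds \<open>mg s\<close> minus the modulus of
  \<open>cf s t\<close> from below, uniformly in s.\<close>

definition low :: "('n \<Rightarrow> nat) \<Rightarrow> real" where
  "low k = p k * exp (- (e * deg k))"

definition defect :: "real^'n \<Rightarrow> real" where
  "defect t = infsum low UNIV - norm (\<Sum>\<^sub>\<infinity>k. complex_of_real (low k) * cis (t \<bullet> rvec k))"

lemma low_nonneg: "low k \<ge> 0" and low_pos: "p k \<noteq> 0 \<Longrightarrow> low k > 0"
  using p_nonneg[of k] by (auto simp: low_def)

lemma low_le: "low k \<le> p k * exp (e * deg k)"
  using p_nonneg[of k] e_pos by (auto simp: low_def intro!: mult_left_mono)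

lemma low_summable: "low summable_on UNIV" "(\<lambda>k. low k * deg k) summable_on UNIV"
proof -
  show "low summable_on UNIV"
    by (rule summable_bound(2)[of _ 1 0]) (use low_le low_nonneg in auto)
  show "(\<lambda>k. low k * deg k) summable_on UNIV"
    by (rule summable_bound(2)[of _ 1 1])
       (use mult_right_mono[OF low_le deg_nonneg] low_nonneg in \<open>auto simp: mult_ac\<close>)
qed

lemma defect_le:
  assumes "\<And>j. \<bar>s $ j\<bar> \<le> e"
  shows "defect t \<le> mg s - norm (cf s t)"
  unfolding defect_def mg_def cf_def
  by (rule phase_defect_mono)
     (use tilt_summable[OF assms] p_nonneg low_summable low_nonneg tilt_le[OF assms] in \<open>auto simp: low_def\<close>)

lemma defect_continuous: "continuous_on UNIV defect"
  unfolding defect_def[abs_def]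
  by (intro continuous_intros continuous_on_trig_series low_summable low_nonneg)

text \<open>Full rank allows a basis of the whole space to be chosen among the differences of
  support points; these become the rows of an invertible integer matrix.\<close>

lemma difference_matrix:
  obtains N :: "real^'n^'n" where "det N \<noteq> 0"
    and "\<And>i. \<exists>k l. p k \<noteq> 0 \<and> p l \<noteq> 0 \<and> N $ i = rvec k - rvec l"
proof -
  define D where "D = {rvec k - rvec l :: real^'n | k l. p k \<noteq> 0 \<and> p l \<noteq> 0}"
  have "D = {(\<chi> j. real (n j) - real (m j)) :: real ^ 'n | n m. n \<in> ps_support p \<and> m \<in> ps_support p}"
    by (auto simp: D_def ps_support_def rvec_def vec_eq_iff)
  then have dimD: "dim D = CARD('n)" using p_full_rank by (simp add: full_rank_def)
  obtain B where B: "B \<subseteq> D" "independent B" "D \<subseteq> span B" "card B = dim D"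
    using basis_exists by blast
  have finB: "finite B" using B(2) by (rule independent_imp_finite)
  have spanB: "span B = UNIV"
  proof -
    have "dim B = DIM(real^'n)" using B dimD by (simp add: dim_eq_card_independent)
    then show ?thesis by (simp only: dim_eq_full)
  qed
  obtain \<beta> where \<beta>: "bij_betw \<beta> (UNIV :: 'n set) B"
    using finB B(4) dimD by (metis finite_same_card_bij finite_class.finite_UNIV)
  define N :: "real^'n^'n" where "N = (\<chi> i. \<beta> i)"
  have "x = 0" if "N *v x = 0" for x
  proof -
    have "\<beta> i \<bullet> x = 0" for i
      using that by (simp add: vec_eq_iff matrix_vector_mul_component N_def)
    then have "orthogonal x b" if "b \<in> B" for b
      using \<beta> that by (auto simp: bij_betw_def orthogonal_def inner_commute)
    then have "orthogonal x x" using spanB orthogonal_to_span by blast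
    then show ?thesis by (simp add: orthogonal_def)
  qed
  then have "\<exists>M. M ** N = mat 1" by (simp add: matrix_left_invertible_ker)
  then have "invertible N" by (simp add: invertible_left_inverse)
  then have "det N \<noteq> 0" by (simp add: invertible_det_nz)
  moreover have "\<exists>k l. p k \<noteq> 0 \<and> p l \<noteq> 0 \<and> N $ i = rvec k - rvec l" for i
    using \<beta> B(1) by (force simp: bij_betw_def N_def D_def)
  ultimately show ?thesis by (rule that)
qed

lemma det_Ints: "(\<And>i j. (A :: real^'n^'n) $ i $ j \<in> \<int>) \<Longrightarrow> det A \<in> \<int>"
  unfolding det_def by (intro Ints_sum Ints_mult Ints_prod) auto

text \<open>By Cramer's rule a common denominator of \<open>t / (2 * pi)\<close> is the determinant of a
  matrix of differences; aperiodicity excludes a nontrivial denominator.\<close>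
lemma phase_lattice_trivial:
  assumes t: "t \<in> pi_box"
    and ph: "\<And>k l. p k \<noteq> 0 \<Longrightarrow> p l \<noteq> 0 \<Longrightarrow> \<exists>m::int. t \<bullet> rvec k - t \<bullet> rvec l = 2 * pi * of_int m"
  shows "t = 0"
proof -
  obtain N :: "real^'n^'n" where N: "det N \<noteq> 0"
    and Nr: "\<And>i. \<exists>k l. p k \<noteq> 0 \<and> p l \<noteq> 0 \<and> N $ i = rvec k - rvec l"
    using difference_matrix by blast
  have NZ: "N $ i $ j \<in> \<int>" for i j
    using Nr[of i] by (auto simp: rvec_def)
  \<comment> \<open>Measured in full turns, the phase hypothesis says that N u is an integer
    vector.\<close>
  define u where "u = (1 / (2 * pi)) *\<^sub>R t"
  have Nu: "(N *v u) $ i \<in> \<int>" for i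
  proof -
    obtain k l where kl: "p k \<noteq> 0" "p l \<noteq> 0" "N $ i = rvec k - rvec l" using Nr by blast
    obtain m :: int where "t \<bullet> rvec k - t \<bullet> rvec l = 2 * pi * of_int m" using ph[OF kl(1,2)] by blast
    moreover have "(N *v u) $ i = (t \<bullet> rvec k - t \<bullet> rvec l) / (2 * pi)"
      by (simp add: matrix_vector_mul_component kl(3) u_def inner_diff_right inner_commute[of _ t])
    ultimately have "(N *v u) $ i = of_int m" by simp
    then show ?thesis by simp
  qed
  have "u = (\<chi> k. det (\<chi> i j. if j = k then (N *v u) $ i else N $ i $ j) / det N)"
    using cramer[OF N, of u "N *v u"] by simp
  then have Du: "det N * u $ j = det (\<chi> i j'. if j' = j then (N *v u) $ i else N $ i $ j')" for j
    using N by (metis (no_types, lifting) nonzero_mult_div_cancel_left times_divide_eq_right vec_lambda_beta)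
  have DuZ: "det N * u $ j \<in> \<int>" for j
    unfolding Du by (rule det_Ints) (use Nu NZ in auto)
  define Q where "Q = nat \<lfloor>\<bar>det N\<bar>\<rfloor>"
  have "\<bar>det N\<bar> \<in> \<int>" using det_Ints[OF NZ] by (simp add: Ints_abs)
  then have Q: "real Q = \<bar>det N\<bar>" by (auto simp: Q_def elim!: Ints_cases)
  then have Q0: "Q > 0" using N by (cases Q) auto
  have "\<exists>q::int. real Q * u $ j = of_int q" for j
  proof -
    have "real Q * u $ j \<in> \<int>"
      using DuZ[of j] Ints_minus[OF DuZ[of j]] by (auto simp: Q abs_if)
    then show ?thesis by (auto elim: Ints_cases)
  qed
  then obtain q where q: "\<And>j. real Q * u $ j = of_int (q j)" by metis
  have qdvd: "int Q dvd q j" for j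
  proof (cases "Q = 1")
    case False
    then have Q2: "Q \<ge> 2" using Q0 by simp
    \<comment> \<open>Periodicity is defined with nonnegative weights, so the integer numerators are
      replaced by their residues modulo Q, with the same divisibility by Q.\<close>
    define P where "P j = nat (q j mod int Q)" for j
    have PP: "int (P j) = q j mod int Q" for j using Q0 by (simp add: P_def)
    obtain k0 where k0: "p k0 \<noteq> 0" using Nr by blast
    define r0 where "r0 = int (\<Sum>j\<in>UNIV. P j * k0 j)"
    \<comment> \<open>The constant must be a residue as well: the cofactor of Q is then a quotient
      of naturals, hence nonnegative as \<open>q_periodic\<close> demands.\<close>
    define r where "r = r0 mod int Q"
    have cong: "int (\<Sum>j\<in>UNIV. P j * k j) mod int Q = r" if k: "p k \<noteq> 0" for k
    proof -
      obtain m :: int where m: "t \<bullet> rvec k - t \<bullet> rvec k0 = 2 * pi * of_int m" using ph[OF k k0] by blast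
      have Qu: "real_of_int (\<Sum>j\<in>UNIV. q j * int (k j)) = real Q * (u \<bullet> rvec k)" for k
        by (simp add: inner_vec_def rvec_def sum_distrib_left q flip: mult.assoc)
      have "u \<bullet> rvec k - u \<bullet> rvec k0 = of_int m"
        using m by (simp add: u_def flip: diff_divide_distrib)
      then have "real Q * (u \<bullet> rvec k) - real Q * (u \<bullet> rvec k0) = real Q * of_int m"
        by (simp flip: right_diff_distrib)
      then have "real_of_int ((\<Sum>j\<in>UNIV. q j * int (k j)) - (\<Sum>j\<in>UNIV. q j * int (k0 j))) = real_of_int (int Q * m)"
        by (simp only: of_int_diff Qu of_int_mult of_int_of_nat_eq)
      then have "(\<Sum>j\<in>UNIV. q j * int (k j)) - (\<Sum>j\<in>UNIV. q j * int (k0 j)) = int Q * m"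
        by (simp only: of_int_eq_iff)
      then have "(\<Sum>j\<in>UNIV. q j * int (k j)) mod int Q = (\<Sum>j\<in>UNIV. q j * int (k0 j)) mod int Q"
        by (metis mod_eq_dvd_iff dvd_triv_left)
      moreover have "int (\<Sum>j\<in>UNIV. P j * k j) mod int Q = (\<Sum>j\<in>UNIV. q j * int (k j)) mod int Q" for k
      proof -
        have "int (\<Sum>j\<in>UNIV. P j * k j) mod int Q = (\<Sum>j\<in>UNIV. (q j mod int Q) * int (k j) mod int Q) mod int Q"
          by (simp add: PP mod_sum_eq)
        also have "\<dots> = (\<Sum>j\<in>UNIV. q j * int (k j)) mod int Q" by (simp add: mod_mult_left_eq mod_sum_eq)
        finally show ?thesis .
      qed
      ultimately show ?thesis by (simp add: r_def r0_def)
    qed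
    have "\<exists>i::nat. int (\<Sum>j\<in>UNIV. P j * k j) = r + int Q * int i" if k: "k \<in> ps_support p" for k
    proof -
      have "p k \<noteq> 0" using k by (simp add: ps_support_def)
      then have "int (\<Sum>j\<in>UNIV. P j * k j) = r + int Q * int ((\<Sum>j\<in>UNIV. P j * k j) div Q)"
        using cong[OF \<open>p k \<noteq> 0\<close>] mod_mult_div_eq[of "int (\<Sum>j\<in>UNIV. P j * k j)" "int Q"] by (simp only: zdiv_int)
      then show ?thesis by blast
    qed
    moreover have "\<not> q_periodic Q p" using p_aperiodic Q2 by (simp add: aperiodic_def)
    ultimately have "Q dvd P j" for j unfolding q_periodic_def by blast
    then have "int Q dvd int (P j)" by simp
    then show ?thesis by (simp add: PP dvd_mod_iff)
  qed simp
  have "t $ j = 0" for j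
  proof -
    obtain m where m: "q j = int Q * m" using qdvd[of j] by (auto elim: dvdE)
    then have "u $ j = of_int m" using q[of j] Q0 by simp
    then have tj: "t $ j = 2 * pi * of_int m" by (simp add: u_def field_simps)
    have "\<bar>t $ j\<bar> \<le> pi" using t by (simp add: pi_box_def)
    then have "2 * pi * \<bar>of_int m\<bar> \<le> pi * 1" using tj by (simp add: abs_mult)
    then have "\<bar>real_of_int m\<bar> < 1" by (simp add: mult.assoc mult.left_commute[of 2] del: mult_1_right)
    then have "m = 0" by linarith
    then show ?thesis using tj by simp
  qed
  then show ?thesis by (simp add: vec_eq_iff)
qed

text \<open>A vanishing defect makes every term vanish, so all phases t . k of support points agree
  with \<alpha> modulo 2 pi; \<open>phase_lattice_trivial\<close> then forces t = 0.\<close>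

lemma defect_pos:
  assumes "t \<in> pi_box" "t \<noteq> 0" shows "defect t > 0"
proof -
  obtain \<alpha> where \<alpha>: "((\<lambda>k. low k * (1 - cos (t \<bullet> rvec k - \<alpha>))) has_sum defect t) UNIV"
    unfolding defect_def by (rule phase_defect[OF low_summable(1) low_nonneg])
  have nn: "0 \<le> low k * (1 - cos (t \<bullet> rvec k - \<alpha>))" for k using low_nonneg by simp
  have "defect t \<ge> 0" using \<alpha> by (rule has_sum_nonneg) (rule nn)
  moreover have "defect t \<noteq> 0"
  proof
    assume "defect t = 0"
    then have "low k * (1 - cos (t \<bullet> rvec k - \<alpha>)) = 0" for k
      using nonneg_has_sum_le_0D[OF \<alpha>] nn by simp
    then have *: "\<exists>m::int. t \<bullet> rvec k - \<alpha> = of_int m * 2 * pi" if "p k \<noteq> 0" for k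
      using low_pos[OF that] by (simp add: cos_one_2pi_int)  (metis less_irrefl)
    have "t = 0"
    proof (rule phase_lattice_trivial[OF assms(1)])
      fix k l assume "p k \<noteq> 0" "p l \<noteq> 0"
      then obtain m n :: int where "t \<bullet> rvec k - \<alpha> = of_int m * 2 * pi" "t \<bullet> rvec l - \<alpha> = of_int n * 2 * pi"
        using * by blast
      then have "t \<bullet> rvec k - t \<bullet> rvec l = 2 * pi * of_int (m - n)" by (simp add: algebra_simps)
      then show "\<exists>m::int. t \<bullet> rvec k - t \<bullet> rvec l = 2 * pi * of_int m" by blast
    qed
    then show False using assms(2) by simp
  qed
  ultimately show ?thesis by simp
qed

text \<open>Each row of N is a difference of support points. Keeping that pair bounds the defect
  below by a multiple of the square of (N t)_i; summing over i and using injectivity of N recovers t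
  . t. The 8 is 2 from \<open>phase_defect_pair\<close> times 4 from
  \<open>one_minus_cos_ge\<close>, and the division by d comes from adding d copies of the
  defect.\<close>

lemma defect_quadratic_near_0:
  "\<exists>c>0. \<exists>r>0. \<forall>t. norm t \<le> r \<longrightarrow> defect t \<ge> c * (t \<bullet> t)"
proof -
  obtain N :: "real^'n^'n" where N: "det N \<noteq> 0"
    and Nr: "\<And>i. \<exists>k l. p k \<noteq> 0 \<and> p l \<noteq> 0 \<and> N $ i = rvec k - rvec l"
    using difference_matrix by blast
  then obtain K L where KL: "\<And>i. p (K i) \<noteq> 0" "\<And>i. p (L i) \<noteq> 0" "\<And>i. N $ i = rvec (K i) - rvec (L i)"
    by metis
  have "inj ((*v) N)" using N by (simp add: invertible_det_nz[symmetric] inj_matrix_vector_mult)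
  then obtain B where B: "B > 0" "\<And>x. B * norm x \<le> norm (N *v x)"
    using linear_inj_bounded_below_pos[of "(*v) N"] by auto
  define m where "m = Min (range (\<lambda>i. min (low (K i)) (low (L i))))"
  have m: "m > 0" "\<And>i. m \<le> min (low (K i)) (low (L i))"
  proof -
    show "m > 0" unfolding m_def using low_pos KL by (subst Min_gr_iff) auto
    show "m \<le> min (low (K i)) (low (L i))" for i unfolding m_def by (rule Min_le) auto
  qed
  \<comment> \<open>For |t| <= 1 / R every |(N t)_i| is at most 1, the range of
    \<open>one_minus_cos_ge\<close>; the summand 1 makes R positive.\<close>
  define R where "R = Max (range (\<lambda>i. norm (N $ i))) + 1"
  have R1: "norm (N $ i) \<le> R - 1" for i
    unfolding R_def by simp
  have R: "norm (N $ i) \<le> R" for i using R1[of i] by linarith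
  have R0: "R > 0" using R1[of undefined] norm_ge_zero[of "N $ undefined"] by linarith
  have main: "defect t \<ge> m * B\<^sup>2 / (8 * CARD('n)) * (t \<bullet> t)" if t: "norm t \<le> 1 / R" for t
  proof -
    have each: "m / 8 * ((N *v t) $ i)\<^sup>2 \<le> defect t" for i
    proof -
      have eq: "t \<bullet> rvec (K i) - t \<bullet> rvec (L i) = (N *v t) $ i"
        by (simp add: matrix_vector_mul_component KL(3) inner_diff_right inner_commute[of _ t])
      have "\<bar>(N *v t) $ i\<bar> \<le> norm (N $ i) * norm t"
        by (simp add: matrix_vector_mul_component Cauchy_Schwarz_ineq2)
      also have "\<dots> \<le> R * (1 / R)" using R R0 t by (intro mult_mono) auto
      finally have "\<bar>(N *v t) $ i\<bar> \<le> 1" using R0 by simp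
      from one_minus_cos_ge[OF this]
      have "m / 8 * ((N *v t) $ i)\<^sup>2 \<le> m * (1 - cos ((N *v t) $ i)) / 2"
        using m(1) by simp
      also have "\<dots> \<le> min (low (K i)) (low (L i)) * (1 - cos ((N *v t) $ i)) / 2"
        using m(2) by (intro divide_right_mono mult_right_mono) auto
      also have "\<dots> \<le> defect t"
        using phase_defect_pair[OF low_summable(1) low_nonneg, of "K i" "L i" "\<lambda>k. t \<bullet> rvec k"]
        unfolding eq defect_def .
      finally show ?thesis .
    qed
    have "m / 8 * (B\<^sup>2 * (t \<bullet> t)) \<le> m / 8 * (norm (N *v t))\<^sup>2"
    proof (rule mult_left_mono)
      have "(B * norm t)\<^sup>2 \<le> (norm (N *v t))\<^sup>2" using B by (intro power_mono) auto
      then show "B\<^sup>2 * (t \<bullet> t) \<le> (norm (N *v t))\<^sup>2" by (simp add: power_mult_distrib dot_square_norm)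
    qed (use m in auto)
    also have "\<dots> = (\<Sum>i\<in>UNIV. m / 8 * ((N *v t) $ i)\<^sup>2)"
      unfolding dot_square_norm[symmetric] inner_vec_def sum_distrib_left
      by (simp add: power2_eq_square)
    also have "\<dots> \<le> (\<Sum>i\<in>(UNIV::'n set). defect t)" by (intro sum_mono each)
    finally have "m / 8 * (B\<^sup>2 * (t \<bullet> t)) \<le> CARD('n) * defect t" by simp
    then show ?thesis by (simp add: field_simps)
  qed
  show ?thesis
    using m B R0 main by (intro exI[of _ "m * B\<^sup>2 / (8 * CARD('n))"] conjI exI[of _ "1 / R"]) auto
qed

lemma compact_pi_box: "compact (pi_box :: (real^'n) set)"
proof -
  have "pi_box = cbox ((\<chi> j. - pi) :: real^'n) (\<chi> j. pi)"
    by (auto simp: pi_box_def mem_box_cart abs_le_iff minus_le_iff)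
  then show ?thesis by (metis compact_cbox)
qed

text \<open>Away from 0 a continuous positive function on a compact set has a positive minimum b,
  and t . t is at most M^2 on the box, so b / M^2 serves there as the quadratic constant.\<close>

lemma defect_quadratic:
  "\<exists>c>0. \<forall>t\<in>pi_box. defect t \<ge> c * (t \<bullet> t)"
proof -
  obtain c r where c: "c > 0" "r > 0" "\<And>t. norm t \<le> r \<Longrightarrow> defect t \<ge> c * (t \<bullet> t)"
    using defect_quadratic_near_0 by blast
  define S where "S = pi_box \<inter> {t :: real^'n. norm t \<ge> r}"
  have S: "compact S" unfolding S_def
    by (intro compact_Int_closed compact_pi_box closed_Collect_le continuous_intros)
  obtain b where b: "b > 0" "\<And>t. t \<in> S \<Longrightarrow> b \<le> defect t"
  proof (cases "S = {}")
    case True then show ?thesis using that[of 1] by auto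
  next
    case False
    obtain t0 where "t0 \<in> S" "\<And>t. t \<in> S \<Longrightarrow> defect t0 \<le> defect t"
      using continuous_attains_inf[OF S False continuous_on_subset[OF defect_continuous]] by auto
    moreover have "defect t0 > 0" using \<open>t0 \<in> S\<close> c(2) by (intro defect_pos) (auto simp: S_def)
    ultimately show ?thesis using that by blast
  qed
  obtain M where M: "M > 0" "\<And>t :: real^'n. t \<in> pi_box \<Longrightarrow> norm t \<le> M"
    using compact_imp_bounded[OF compact_pi_box] unfolding bounded_pos by blast
  have "defect t \<ge> min c (b / M\<^sup>2) * (t \<bullet> t)" if t: "t \<in> pi_box" for t
  proof (cases "norm t \<le> r")
    case True
    have "min c (b / M\<^sup>2) * (t \<bullet> t) \<le> c * (t \<bullet> t)" by (intro mult_right_mono) auto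
    then show ?thesis using c(3)[OF True] by linarith
  next
    case False
    have "t \<bullet> t \<le> M\<^sup>2" using M(2)[OF t] by (simp add: dot_square_norm power_mono)
    then have "min c (b / M\<^sup>2) * (t \<bullet> t) \<le> b / M\<^sup>2 * M\<^sup>2" using M(1) b(1) by (intro mult_mono) auto
    also have "\<dots> = b" using M(1) by simp
    also have "b \<le> defect t" using b(2) t False by (simp add: S_def)
    finally show ?thesis .
  qed
  then show ?thesis using c(1) b(1) M(1) by (intro exI[of _ "min c (b / M\<^sup>2)"]) auto
qed

lemma mg_pos:
  assumes "\<And>j. \<bar>s $ j\<bar> \<le> e" shows "mg s > 0"
proof -
  obtain k where k: "p k \<noteq> 0" using difference_matrix by blast
  have "0 < p k * exp (s \<bullet> rvec k)" using k p_nonneg[of k] by simp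
  also have "\<dots> \<le> mg s"
    unfolding mg_def using finite_sum_le_infsum[OF tilt_summable(1)[OF assms], of "{k}"] p_nonneg by simp
  finally show ?thesis .
qed

text \<open>The additive gap c (t . t) becomes a multiplicative one through 1 - x <= exp (- x).
  Dividing c by M, the value of \<open>mg\<close> at the extreme tilt (e, ..., e) and hence its
  maximum, makes the exponent independent of s.\<close>

lemma cf_bound:
  "\<exists>c>0. \<forall>s t. (\<forall>j. \<bar>s $ j\<bar> \<le> e) \<longrightarrow> t \<in> pi_box \<longrightarrow> norm (cf s t) \<le> mg s * exp (- c * (t \<bullet> t))"
proof -
  obtain c where c: "c > 0" "\<And>t. t \<in> pi_box \<Longrightarrow> defect t \<ge> c * (t \<bullet> t)"
    using defect_quadratic by blast
  define M where "M = mg (\<chi> j. e)"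
  have M: "M > 0" unfolding M_def by (rule mg_pos) (use e_pos in auto)
  have "norm (cf s t) \<le> mg s * exp (- (c / M) * (t \<bullet> t))" if s: "\<And>j. \<bar>s $ j\<bar> \<le> e" and t: "t \<in> pi_box" for s t
  proof -
    have mM: "mg s \<le> M"
      unfolding mg_def M_def
    proof (rule infsum_mono[OF tilt_summable(1)[OF s] tilt_summable(1)])
      fix k :: "'n \<Rightarrow> nat"
      have "(\<chi> j. e) \<bullet> rvec k = e * deg k" by (simp add: inner_vec_def rvec_def deg_def sum_distrib_left)
      then show "p k * exp (s \<bullet> rvec k) \<le> p k * exp ((\<chi> j. e) \<bullet> rvec k)" using tilt_le(1)[OF s] by simp
    qed (use e_pos in auto)
    have pos: "mg s > 0" using mg_pos s by blast
    have "norm (cf s t) \<le> mg s - c * (t \<bullet> t)" using defect_le[OF s, of t] c(2)[OF t] by linarith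
    also have "c * (t \<bullet> t) \<ge> mg s * (c / M * (t \<bullet> t))"
      using mult_right_mono[OF mM, of "c / M * (t \<bullet> t)"] c(1) M by simp
    then have "mg s - c * (t \<bullet> t) \<le> mg s * (1 + - (c / M * (t \<bullet> t)))" by (simp add: right_diff_distrib)
    also have "\<dots> \<le> mg s * exp (- (c / M * (t \<bullet> t)))"
      using pos by (intro mult_left_mono exp_ge_add_one_self) auto
    finally show ?thesis by simp
  qed
  then show ?thesis using c(1) M by (intro exI[of _ "c / M"]) auto
qed

end

subsection \<open>The local limit theorem\<close>

lemma has_sum_finite_sum:
  fixes f :: "'i \<Rightarrow> 'a \<Rightarrow> 'b::topological_comm_monoid_add"
  assumes "\<And>i. i \<in> I \<Longrightarrow> (f i has_sum a i) A"
  shows "((\<lambda>x. \<Sum>i\<in>I. f i x) has_sum (\<Sum>i\<in>I. a i)) A"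
  using assms by (induction I rule: infinite_finite_induct) (auto intro: has_sum_add)

text \<open>The second-order Maclaurin remainder, for all real x and not only near 0: it is applied
  to s . k and to r k_i, which are unbounded in k.\<close>

lemma exp_le_quadratic: "exp x \<le> 1 + x + x\<^sup>2 * exp \<bar>x\<bar>" for x :: real
proof -
  obtain t where t: "\<bar>t\<bar> \<le> \<bar>x\<bar>" "exp x = (\<Sum>m<2. x ^ m / fact m) + exp t / fact 2 * x ^ 2"
    using Maclaurin_exp_le[of x 2] by blast
  have "exp t \<le> exp \<bar>x\<bar>" using t(1) by simp
  then have "exp t / 2 \<le> exp \<bar>x\<bar>" using exp_gt_zero[of t] by linarith
  then have "exp t / 2 * x\<^sup>2 \<le> exp \<bar>x\<bar> * x\<^sup>2" by (rule mult_right_mono) simp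
  then show ?thesis using t(2) by (simp add: eval_nat_numeral mult_ac)
qed

lemma
  fixes a :: real assumes "a > 0"
  shows integrable_exp_neg_square: "integrable lborel (\<lambda>x::real. exp (- (a * x\<^sup>2)))"
    and integral_exp_neg_square: "(\<integral>x. exp (- (a * x\<^sup>2)) \<partial>lborel) = sqrt (pi / a)"
proof -
  define \<sigma> where "\<sigma> = sqrt (1 / (2 * a))"
  have \<sigma>: "\<sigma> > 0" "\<sigma>\<^sup>2 = 1 / (2 * a)" using assms by (auto simp: \<sigma>_def)
  have eq: "exp (- (a * x\<^sup>2)) = sqrt (pi / a) * normal_density 0 \<sigma> x" for x
  proof -
    have "2 * pi * \<sigma>\<^sup>2 = pi / a" "(x - 0)\<^sup>2 / (2 * \<sigma>\<^sup>2) = a * x\<^sup>2"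
      using assms by (simp_all add: \<sigma>(2))
    then show ?thesis using assms by (simp add: normal_density_def)
  qed
  show "integrable lborel (\<lambda>x::real. exp (- (a * x\<^sup>2)))"
    unfolding eq using \<sigma> by simp
  show "(\<integral>x. exp (- (a * x\<^sup>2)) \<partial>lborel) = sqrt (pi / a)"
    unfolding eq using \<sigma> by simp
qed

lemma
  fixes a :: real assumes "a > 0"
  shows integrable_exp_neg_inner: "integrable lborel (\<lambda>x::real^'n::finite. exp (- (a * (x \<bullet> x))))"
    and integral_exp_neg_inner: "(\<integral>(x::real^'n). exp (- (a * (x \<bullet> x))) \<partial>lborel) = sqrt (pi / a) ^ CARD('n)"
proof -
  have eq: "(\<lambda>x::real^'n. exp (- (a * (x \<bullet> x)))) = (\<lambda>x. \<Prod>j\<in>UNIV. exp (- (a * (x $ j)\<^sup>2)))"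
    by (simp add: fun_eq_iff inner_vec_def sum_distrib_left power2_eq_square flip: exp_sum sum_negf)
  show "integrable lborel (\<lambda>x::real^'n. exp (- (a * (x \<bullet> x))))"
    unfolding eq by (rule integrable_vec_prod[OF integrable_exp_neg_square[OF assms]])
  show "(\<integral>(x::real^'n). exp (- (a * (x \<bullet> x))) \<partial>lborel) = sqrt (pi / a) ^ CARD('n)"
    unfolding eq integral_vec_prod[OF integrable_exp_neg_square[OF assms]]
    by (simp add: integral_exp_neg_square[OF assms])
qed

text \<open>At the point with coordinates exp (s_j + i t_j), evaluating a power series is the same
  as forming the characteristic function of the tilted weights.\<close>

lemma mon_polar:
  fixes s t :: "real^'n::finite"
  shows "mon (\<chi> j. complex_of_real (exp (s $ j)) * cis (t $ j)) k = of_real (exp (s \<bullet> rvec k)) * cis (t \<bullet> rvec k)"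
  by (simp add: mon_def power_mult_distrib prod.distrib inner_vec_def rvec_def cis_sum exp_sum Complex.DeMoivre
      exp_of_nat_mult[symmetric] mult.commute flip: of_real_power)

context lattice_dist
begin

abbreviation pn :: "nat \<Rightarrow> ('n \<Rightarrow> nat) \<Rightarrow> real" where
  "pn n \<equiv> ps_pow p n"

text \<open>Evaluation at exp (s + i t) is multiplicative on power series, so the n-th power of
  \<open>cf\<close> is the characteristic function of the convolution power
  \<open>pn n\<close>.\<close>

lemma
  assumes s: "\<And>j. \<bar>s $ j\<bar> \<le> e"
  shows pn_tilt_summable: "(\<lambda>k. norm (complex_of_real (pn n k * exp (s \<bullet> rvec k)))) summable_on UNIV"
    and cf_power: "cf s t ^ n = (\<Sum>\<^sub>\<infinity>k. complex_of_real (pn n k * exp (s \<bullet> rvec k)) * cis (t \<bullet> rvec k))"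
proof -
  define z where "z = (\<chi> j. complex_of_real (exp (s $ j)) * cis (t $ j))"
  have eq: "complex_of_real (c k) * mon z k = complex_of_real (c k * exp (s \<bullet> rvec k)) * cis (t \<bullet> rvec k)"
    for c :: "('n \<Rightarrow> nat) \<Rightarrow> real" and k by (simp add: z_def mon_polar)
  have sm: "(\<lambda>k. norm (complex_of_real (p k) * mon z k)) summable_on UNIV"
    unfolding eq using tilt_summable(1)[OF s] p_nonneg by (simp add: norm_mult)
  have "(\<lambda>k. norm (complex_of_real (pn n k) * mon z k)) summable_on UNIV"
    using ps_pow_summable[OF sm, of n] by (simp add: ps_pow_of_real)
  then show "(\<lambda>k. norm (complex_of_real (pn n k * exp (s \<bullet> rvec k)))) summable_on UNIV"
    unfolding eq by (simp add: norm_mult)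
  have "cf s t = ps_eval (\<lambda>k. complex_of_real (p k)) z"
    by (simp only: cf_def ps_eval_def eq)
  moreover have "ps_pow (\<lambda>k. complex_of_real (p k)) n = (\<lambda>k. complex_of_real (pn n k))"
    by (rule ext) (rule ps_pow_of_real)
  ultimately have "cf s t ^ n = ps_eval (\<lambda>k. complex_of_real (pn n k)) z"
    using ps_eval_pow[OF sm, of n] by simp
  then show "cf s t ^ n = (\<Sum>\<^sub>\<infinity>k. complex_of_real (pn n k * exp (s \<bullet> rvec k)) * cis (t \<bullet> rvec k))"
    by (simp only: ps_eval_def eq)
qed

lemma extz_nonneg: "extz (pn n) x \<ge> 0"
  using ps_pow_nonneg[of p] p_nonneg by (simp add: extz_def)

lemma extz_fourier:
  assumes s: "\<And>j. \<bar>s $ j\<bar> \<le> e"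
  shows "(\<integral>t. indicator pi_box t *\<^sub>R (cf s t ^ n * cis (- (t \<bullet> ivec x))) \<partial>lborel)
    = complex_of_real ((2 * pi) ^ CARD('n) * (extz (pn n) x * exp (s \<bullet> ivec x)))"
proof -
  have "extz (\<lambda>k. complex_of_real (pn n k * exp (s \<bullet> rvec k))) x = complex_of_real (extz (pn n) x * exp (s \<bullet> ivec x))"
    by (simp add: extz_def rvec_eq_ivec)
  then show ?thesis
    unfolding cf_power[OF s] fourier_inversion[OF pn_tilt_summable[OF s]] by simp
qed

lemma cf_measurable:
  assumes "\<And>j. \<bar>s $ j\<bar> \<le> e" shows "cf s \<in> borel_measurable borel"
  by (rule borel_measurable_continuous_onI[OF cf_continuous[OF assms]])

text \<open>Norms are taken inside the Fourier integral and the Gaussian majorant exp (- c n (t .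
  t)) is integrated over the whole space, which gives (pi / (c n))^(d/2). All constants are
  independent of s and x.\<close>

lemma extz_tilt_bound:
  "\<exists>M>0. \<forall>n\<ge>1. \<forall>x s. (\<forall>j. \<bar>s $ j\<bar> \<le> e) \<longrightarrow> extz (pn n) x * exp (s \<bullet> ivec x) * sqrt n ^ CARD('n) \<le> M * mg s ^ n"
proof -
  obtain c where c: "c > 0" "\<And>s t. (\<forall>j. \<bar>s $ j\<bar> \<le> e) \<Longrightarrow> t \<in> pi_box \<Longrightarrow> norm (cf s t) \<le> mg s * exp (- c * (t \<bullet> t))"
    using cf_bound by blast
  define M where "M = sqrt (pi / c) ^ CARD('n) / (2 * pi) ^ CARD('n)"
  have "extz (pn n) x * exp (s \<bullet> ivec x) * sqrt n ^ CARD('n) \<le> M * mg s ^ n"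
    if n: "n \<ge> 1" and s: "\<forall>j. \<bar>s $ j\<bar> \<le> e" for n x s
  proof -
    have s': "\<And>j. \<bar>s $ j\<bar> \<le> e" using s by blast
    note [measurable] = cf_measurable[OF s']
    have n0: "c * real n > 0" using n c by simp
    have int: "integrable lborel (\<lambda>t::real^'n. mg s ^ n * exp (- (c * real n * (t \<bullet> t))))"
      using integrable_exp_neg_inner[OF n0] by (rule integrable_mult_right)
    have bd: "norm (indicator pi_box t *\<^sub>R (cf s t ^ n * cis (- (t \<bullet> ivec x)))) \<le> mg s ^ n * exp (- (c * real n * (t \<bullet> t)))" for t
    proof (cases "t \<in> pi_box")
      case True
      have "norm (cf s t) ^ n \<le> (mg s * exp (- c * (t \<bullet> t))) ^ n"
        using c(2)[OF s True] by (intro power_mono) auto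
      also have "\<dots> = mg s ^ n * exp (- (c * real n * (t \<bullet> t)))"
        by (simp add: power_mult_distrib mult_ac flip: exp_of_nat_mult)
      finally show ?thesis using True by (simp add: norm_mult norm_power)
    qed (use mg_pos[OF s'] in simp)
    have "(2 * pi) ^ CARD('n) * (extz (pn n) x * exp (s \<bullet> ivec x))
        = norm (\<integral>t. indicator pi_box t *\<^sub>R (cf s t ^ n * cis (- (t \<bullet> ivec x))) \<partial>lborel)"
      unfolding extz_fourier[OF s'] norm_of_real using extz_nonneg by simp
    also have "\<dots> \<le> (\<integral>(t::real^'n). mg s ^ n * exp (- (c * real n * (t \<bullet> t))) \<partial>lborel)"
      by (rule Bochner_Integration.integral_norm_bound_integral[OF _ int bd])
         (rule Bochner_Integration.integrable_bound[OF int], measurable, intro AE_I2 order_trans[OF bd], simp)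
    also have "\<dots> = mg s ^ n * sqrt (pi / (c * real n)) ^ CARD('n)"
      by (simp add: integral_exp_neg_inner[OF n0])
    also have "\<dots> = mg s ^ n * sqrt (pi / c) ^ CARD('n) / sqrt n ^ CARD('n)"
      by (simp add: real_sqrt_divide real_sqrt_mult power_divide power_mult_distrib)
    finally have "(2 * pi) ^ CARD('n) * (extz (pn n) x * exp (s \<bullet> ivec x)) \<le> mg s ^ n * sqrt (pi / c) ^ CARD('n) / sqrt n ^ CARD('n)" .
    then have "((2 * pi) ^ CARD('n) * (extz (pn n) x * exp (s \<bullet> ivec x))) * sqrt n ^ CARD('n) \<le> mg s ^ n * sqrt (pi / c) ^ CARD('n)"
      using n by (simp add: pos_le_divide_eq)
    then show ?thesis by (simp add: M_def pos_le_divide_eq mult_ac)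
  qed
  moreover have "M > 0" using c by (simp add: M_def)
  ultimately show ?thesis by blast
qed

lemma inner_mean: "((\<lambda>k. p k * (s \<bullet> rvec k)) has_sum s \<bullet> mu) UNIV"
proof -
  have "((\<lambda>k. \<Sum>j\<in>UNIV. s $ j * (p k * real (k j))) has_sum (\<Sum>j\<in>UNIV. s $ j * mu $ j)) UNIV"
    by (intro has_sum_finite_sum has_sum_cmult_right p_mean)
  then show ?thesis by (simp add: inner_vec_def rvec_def sum_distrib_left mult_ac)
qed

text \<open>The linear term is exactly s . mu because mu is the mean; the remainder is at most s . s
  times the second moment with weight exp (e deg k). For |s| of order n^(-1/2) the n-th power
  therefore exceeds exp (n (s . mu)) only by a bounded factor.\<close>

lemma mg_le: "\<exists>C\<ge>0. \<forall>s. (\<forall>j. \<bar>s $ j\<bar> \<le> e) \<longrightarrow> mg s \<le> exp (s \<bullet> mu + C * (s \<bullet> s))"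
proof -
  define C where "C = (\<Sum>\<^sub>\<infinity>k. p k * (deg k ^ 2 * exp (e * deg k)))"
  have "C \<ge> 0" unfolding C_def using p_nonneg by (intro infsum_nonneg) auto
  moreover have "mg s \<le> exp (s \<bullet> mu + C * (s \<bullet> s))" if s: "\<forall>j. \<bar>s $ j\<bar> \<le> e" for s
  proof -
    have s': "\<And>j. \<bar>s $ j\<bar> \<le> e" using s by blast
    have "((\<lambda>k. p k + p k * (s \<bullet> rvec k) + (s \<bullet> s) * (p k * (deg k ^ 2 * exp (e * deg k)))) has_sum (1 + s \<bullet> mu + (s \<bullet> s) * C)) UNIV"
      unfolding C_def by (intro has_sum_add has_sum_cmult_right p_sum inner_mean has_sum_infsum summable_moment)
    moreover have "((\<lambda>k. p k * exp (s \<bullet> rvec k)) has_sum mg s) UNIV"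
      unfolding mg_def by (intro has_sum_infsum tilt_summable(1)[OF s'])
    moreover have "p k * exp (s \<bullet> rvec k) \<le> p k + p k * (s \<bullet> rvec k) + (s \<bullet> s) * (p k * (deg k ^ 2 * exp (e * deg k)))" for k
    proof -
      have "\<bar>s \<bullet> rvec k\<bar> \<le> norm s * deg k"
        using Cauchy_Schwarz_ineq2[of s "rvec k"] mult_left_mono[OF norm_rvec_le[of k] norm_ge_zero[of s]] by linarith
      then have "(s \<bullet> rvec k)\<^sup>2 \<le> (norm s * deg k)\<^sup>2"
        by (rule power2_le_iff_abs_le[THEN iffD2, rotated]) auto
      then have "(s \<bullet> rvec k)\<^sup>2 * exp \<bar>s \<bullet> rvec k\<bar> \<le> (norm s * deg k)\<^sup>2 * exp (e * deg k)"
        using inner_rvec_bound[OF s', of k] by (intro mult_mono) auto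
      then have "exp (s \<bullet> rvec k) \<le> 1 + s \<bullet> rvec k + (s \<bullet> s) * (deg k ^ 2 * exp (e * deg k))"
        using exp_le_quadratic[of "s \<bullet> rvec k"] by (simp add: power_mult_distrib dot_square_norm)
      from mult_left_mono[OF this p_nonneg[of k]] show ?thesis by (simp add: algebra_simps)
    qed
    ultimately have "mg s \<le> 1 + s \<bullet> mu + (s \<bullet> s) * C"
      by (meson has_sum_mono)
    also have "\<dots> \<le> exp (s \<bullet> mu + C * (s \<bullet> s))"
      using exp_ge_add_one_self[of "s \<bullet> mu + C * (s \<bullet> s)"] by (simp only: mult.commute[of C] add.assoc)
    finally show ?thesis .
  qed
  ultimately show ?thesis by blast
qed

text \<open>Chernoff's trick: tilting by \<open>s = \<plusminus> e / sqrt n\<close> in each coordinate costs only a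
  constant factor.\<close>
lemma extz_decay:
  "\<exists>M>0. \<forall>n\<ge>1. \<forall>x. extz (pn n) x * sqrt n ^ CARD('n)
     \<le> M * (\<Prod>j\<in>UNIV. exp (- (e / sqrt n * \<bar>of_int (x j) - n * mu $ j\<bar>)))"
proof -
  obtain M where M: "M > 0" "\<And>n x s. n \<ge> 1 \<Longrightarrow> (\<forall>j. \<bar>s $ j\<bar> \<le> e) \<Longrightarrow> extz (pn n) x * exp (s \<bullet> ivec x) * sqrt n ^ CARD('n) \<le> M * mg s ^ n"
    using extz_tilt_bound by blast
  obtain C where C: "C \<ge> 0" "\<And>s. (\<forall>j. \<bar>s $ j\<bar> \<le> e) \<Longrightarrow> mg s \<le> exp (s \<bullet> mu + C * (s \<bullet> s))"
    using mg_le by blast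
  define M' where "M' = M * exp (C * (CARD('n) * e\<^sup>2))"
  have "extz (pn n) x * sqrt n ^ CARD('n) \<le> M' * (\<Prod>j\<in>UNIV. exp (- (e / sqrt n * \<bar>of_int (x j) - n * mu $ j\<bar>)))"
    if n: "n \<ge> 1" for n :: nat and x :: "'n \<Rightarrow> int"
  proof -
    \<comment> \<open>The signs are those of x_j - n mu_j, so that s . (x - n mu) is e / sqrt n
      times the l1 distance, each coordinate contributing decay.\<close>
    define s :: "real^'n" where "s = (\<chi> j. e / sqrt n * sgn (of_int (x j) - n * mu $ j))"
    have sj: "\<bar>s $ j\<bar> \<le> e / sqrt n" for j
      using e_pos by (simp add: s_def abs_mult abs_sgn_eq)
    have "e / sqrt n \<le> e / 1" using n e_pos by (intro divide_left_mono) auto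
    then have s: "\<forall>j. \<bar>s $ j\<bar> \<le> e" using sj by (metis div_by_1 order_trans)
    have s': "\<And>j. \<bar>s $ j\<bar> \<le> e" using s by blast
    have "s \<bullet> s \<le> (\<Sum>j\<in>(UNIV::'n set). (e / sqrt n)\<^sup>2)"
      unfolding inner_vec_def
    proof (rule sum_mono)
      fix j
      show "s $ j \<bullet> s $ j \<le> (e / sqrt n)\<^sup>2"
        using power_mono[OF sj[of j], of 2] by (simp add: power2_eq_square)
    qed
    \<comment> \<open>The scale 1 / sqrt n keeps n (s . s) bounded by d e^2; this is the exponent of
      the constant in \<open>M'\<close>.\<close>
    also have "\<dots> = CARD('n) * e\<^sup>2 / n" using n by (simp add: power_divide)
    finally have ss: "n * (s \<bullet> s) \<le> CARD('n) * e\<^sup>2" using n by (simp add: field_simps)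
    have "s \<bullet> (ivec x - real n *\<^sub>R mu) = (\<Sum>j\<in>UNIV. e / sqrt n * \<bar>of_int (x j) - n * mu $ j\<bar>)"
    proof -
      have "sgn a * a = \<bar>a\<bar>" for a :: real by (simp add: sgn_if)
      then show ?thesis by (simp add: inner_vec_def s_def ivec_def mult.assoc)
    qed
    then have lin: "s \<bullet> ivec x - n * (s \<bullet> mu) = (\<Sum>j\<in>UNIV. e / sqrt n * \<bar>of_int (x j) - n * mu $ j\<bar>)"
      by (simp add: inner_diff_right)
    have "mg s ^ n \<le> exp (s \<bullet> mu + C * (s \<bullet> s)) ^ n"
      using C(2)[OF s] mg_pos[OF s'] by (intro power_mono) auto
    also have "\<dots> = exp (n * (s \<bullet> mu) + C * (n * (s \<bullet> s)))"
      by (simp add: exp_of_nat_mult[symmetric] algebra_simps)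
    also have "\<dots> \<le> exp (n * (s \<bullet> mu) + C * (CARD('n) * e\<^sup>2))"
      using mult_left_mono[OF ss C(1)] by simp
    finally have mgn: "mg s ^ n \<le> exp (n * (s \<bullet> mu) + C * (CARD('n) * e\<^sup>2))" .
    have "extz (pn n) x * sqrt n ^ CARD('n) = extz (pn n) x * exp (s \<bullet> ivec x) * sqrt n ^ CARD('n) * exp (- (s \<bullet> ivec x))"
      by (simp add: exp_minus)
    also have "\<dots> \<le> M * mg s ^ n * exp (- (s \<bullet> ivec x))"
      using M(2)[OF n s, of x] by (intro mult_right_mono) auto
    also have "\<dots> \<le> M * exp (n * (s \<bullet> mu) + C * (CARD('n) * e\<^sup>2)) * exp (- (s \<bullet> ivec x))"
      using M(1) mgn by (intro mult_right_mono mult_left_mono) auto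
    also have "\<dots> = M' * exp (- (s \<bullet> ivec x - n * (s \<bullet> mu)))"
      by (simp add: M'_def mult.assoc flip: exp_add)
    also have "exp (- (s \<bullet> ivec x - n * (s \<bullet> mu))) = (\<Prod>j\<in>UNIV. exp (- (e / sqrt n * \<bar>of_int (x j) - n * mu $ j\<bar>)))"
      unfolding lin by (simp add: exp_sum flip: sum_negf)
    finally show ?thesis .
  qed
  moreover have "M' > 0" using M by (simp add: M'_def)
  ultimately show ?thesis by blast
qed

section \<open>Covariance and Gaussian limit of the characteristic function\<close>

definition cov :: "real^'n^'n" where
  "cov = (\<chi> i j. \<Sum>\<^sub>\<infinity>k. p k * ((real (k i) - mu $ i) * (real (k j) - mu $ j)))"

lemma centered_bound: "\<bar>t \<bullet> rvec k - t \<bullet> mu\<bar> \<le> norm t * (1 + norm mu) * (1 + deg k)"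
proof -
  have "\<bar>t \<bullet> rvec k - t \<bullet> mu\<bar> \<le> norm t * norm (rvec k - mu)"
    using Cauchy_Schwarz_ineq2[of t "rvec k - mu"] by (simp add: inner_diff_right)
  also have "norm (rvec k - mu) \<le> deg k + norm mu"
    using norm_triangle_ineq4[of "rvec k" mu] norm_rvec_le[of k] by linarith
  also have "deg k + norm mu \<le> (1 + norm mu) * (1 + deg k)"
    by (simp add: algebra_simps)
  finally show ?thesis by (simp add: mult_left_mono mult.assoc)
qed

lemma summable_poly: "(\<lambda>k. p k * (1 + deg k) ^ r) summable_on UNIV"
proof -
  have "(\<lambda>k. 2 ^ r * (p k * (deg k ^ 0 * exp (e * deg k)) + p k * (deg k ^ r * exp (e * deg k)))) summable_on UNIV"
    by (intro summable_on_cmult_right summable_on_add summable_moment)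
  then show ?thesis
  proof (rule summable_on_comparison_test)
    fix k :: "'n \<Rightarrow> nat"
    have "(1 + deg k) ^ r \<le> (2 * max 1 (deg k)) ^ r" by (intro power_mono) auto
    also have "\<dots> \<le> 2 ^ r * (1 + deg k ^ r)"
      by (auto simp: power_mult_distrib max_def)
    also have "\<dots> \<le> 2 ^ r * ((1 + deg k ^ r) * exp (e * deg k))"
      using e_pos mult_left_mono[of 1 "exp (e * deg k)" "1 + deg k ^ r"] by simp
    finally have "p k * (1 + deg k) ^ r \<le> p k * (2 ^ r * ((1 + deg k ^ r) * exp (e * deg k)))"
      using p_nonneg by (intro mult_left_mono) auto
    then show "p k * (1 + deg k) ^ r \<le> 2 ^ r * (p k * (deg k ^ 0 * exp (e * deg k)) + p k * (deg k ^ r * exp (e * deg k)))"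
      by (simp add: algebra_simps)
  qed (use p_nonneg in auto)
qed

lemma centered_moment_summable: "(\<lambda>k. p k * \<bar>t \<bullet> rvec k - t \<bullet> mu\<bar> ^ r) summable_on UNIV"
proof -
  have "(\<lambda>k. (norm t * (1 + norm mu)) ^ r * (p k * (1 + deg k) ^ r)) summable_on UNIV"
    by (intro summable_on_cmult_right summable_poly)
  then show ?thesis
  proof (rule summable_on_comparison_test)
    fix k :: "'n \<Rightarrow> nat"
    have "\<bar>t \<bullet> rvec k - t \<bullet> mu\<bar> ^ r \<le> (norm t * (1 + norm mu) * (1 + deg k)) ^ r"
      using centered_bound by (intro power_mono) auto
    from mult_left_mono[OF this p_nonneg[of k]]
    show "p k * \<bar>t \<bullet> rvec k - t \<bullet> mu\<bar> ^ r \<le> (norm t * (1 + norm mu)) ^ r * (p k * (1 + deg k) ^ r)"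
      by (simp only: power_mult_distrib mult_ac)
  qed (use p_nonneg in auto)
qed

lemma cov_summable: "(\<lambda>k. p k * ((real (k i) - mu $ i) * (real (k j) - mu $ j))) summable_on UNIV"
proof (rule abs_summable_summable, rule summable_on_comparison_test)
  show "(\<lambda>k. p k * \<bar>axis i 1 \<bullet> rvec k - axis i 1 \<bullet> mu\<bar> ^ 2 + p k * \<bar>axis j 1 \<bullet> rvec k - axis j 1 \<bullet> mu\<bar> ^ 2) summable_on UNIV"
    by (intro summable_on_add centered_moment_summable)
  fix k :: "'n \<Rightarrow> nat"
  have "\<bar>a * b\<bar> \<le> a\<^sup>2 + b\<^sup>2" for a b :: real
    using sum_squares_bound[of "\<bar>a\<bar>" "\<bar>b\<bar>"] abs_ge_zero[of "a * b"] unfolding abs_mult power2_abs by linarith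
  from mult_left_mono[OF this p_nonneg]
  show "norm (p k * ((real (k i) - mu $ i) * (real (k j) - mu $ j))) \<le> p k * \<bar>axis i 1 \<bullet> rvec k - axis i 1 \<bullet> mu\<bar> ^ 2 + p k * \<bar>axis j 1 \<bullet> rvec k - axis j 1 \<bullet> mu\<bar> ^ 2"
    using p_nonneg[of k] by (simp add: inner_axis' rvec_def abs_mult distrib_left)
qed auto

lemma cov_form: "((\<lambda>k. p k * (t \<bullet> rvec k - t \<bullet> mu)\<^sup>2) has_sum t \<bullet> (cov *v t)) UNIV"
proof -
  have "((\<lambda>k. \<Sum>i\<in>UNIV. \<Sum>j\<in>UNIV. t $ i * t $ j * (p k * ((real (k i) - mu $ i) * (real (k j) - mu $ j))))
     has_sum (\<Sum>i\<in>UNIV. \<Sum>j\<in>UNIV. t $ i * t $ j * cov $ i $ j)) UNIV"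
    unfolding cov_def vec_lambda_beta
    by (intro has_sum_finite_sum has_sum_cmult_right has_sum_infsum cov_summable)
  moreover have "(\<Sum>i\<in>UNIV. \<Sum>j\<in>UNIV. t $ i * t $ j * cov $ i $ j) = t \<bullet> (cov *v t)"
    by (simp add: inner_vec_def matrix_vector_mult_def sum_distrib_left mult_ac)
  moreover have "(\<Sum>i\<in>UNIV. \<Sum>j\<in>UNIV. t $ i * t $ j * (p k * ((real (k i) - mu $ i) * (real (k j) - mu $ j))))
      = p k * (t \<bullet> rvec k - t \<bullet> mu)\<^sup>2" for k
  proof -
    have "t \<bullet> rvec k - t \<bullet> mu = (\<Sum>i\<in>UNIV. t $ i * (real (k i) - mu $ i))"
      by (simp add: inner_vec_def rvec_def right_diff_distrib sum_subtractf)
    then have "p k * (t \<bullet> rvec k - t \<bullet> mu)\<^sup>2 = p k * (\<Sum>i\<in>UNIV. \<Sum>j\<in>UNIV. (t $ i * (real (k i) - mu $ i)) * (t $ j * (real (k j) - mu $ j)))"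
      by (simp add: power2_eq_square sum_product)
    then show ?thesis by (simp add: sum_distrib_left mult_ac)
  qed
  ultimately show ?thesis by simp
qed

lemma cov_symmetric: "transpose cov = cov"
  by (simp add: transpose_def cov_def vec_eq_iff mult.commute)

text \<open>The form is the variance of t . X. If it vanishes, t . k is constant on the support, so
  N t = 0 for the invertible matrix N of support differences.\<close>

lemma cov_pos_def:
  assumes "t \<noteq> 0" shows "t \<bullet> (cov *v t) > 0"
proof -
  have nn: "0 \<le> p k * (t \<bullet> rvec k - t \<bullet> mu)\<^sup>2" for k using p_nonneg by simp
  have "t \<bullet> (cov *v t) \<ge> 0" by (rule has_sum_nonneg[OF cov_form nn])
  moreover have "t \<bullet> (cov *v t) \<noteq> 0"
  proof
    assume z: "t \<bullet> (cov *v t) = 0"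
    have "p k * (t \<bullet> rvec k - t \<bullet> mu)\<^sup>2 = 0" for k
      by (rule nonneg_has_sum_le_0D[OF cov_form]) (use z nn in auto)
    then have eq: "t \<bullet> rvec k = t \<bullet> mu" if "p k \<noteq> 0" for k using that by (metis eq_iff_diff_eq_0 mult_eq_0_iff power_eq_0_iff)
    obtain N :: "real^'n^'n" where N: "det N \<noteq> 0"
      and Nr: "\<And>i. \<exists>k l. p k \<noteq> 0 \<and> p l \<noteq> 0 \<and> N $ i = rvec k - rvec l"
      using difference_matrix by blast
    have "(N *v t) $ i = 0" for i
      using Nr[of i] eq by (auto simp: matrix_vector_mul_component inner_diff_left inner_commute[of _ t] inner_diff_right)
    then have "N *v t = 0" by (simp add: vec_eq_iff)
    moreover have "inj ((*v) N)" using N by (simp add: invertible_det_nz[symmetric] inj_matrix_vector_mult)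
    ultimately have "t = 0" by (metis injD matrix_vector_mult_0_right)
    then show False using assms by simp
  qed
  ultimately show ?thesis by simp
qed

lemma cf_0_eq: "cf 0 t = (\<Sum>\<^sub>\<infinity>k. complex_of_real (p k) * cis (t \<bullet> rvec k))"
  by (simp add: cf_def)

text \<open>The central limit theorem with a rate. For |z|, |w| <= 1 the powers satisfy |z^n - w^n|
  <= n |z - w|; the third absolute moment bounds the Taylor error of one factor by order n^(-3/2),
  so the total error is of order n^(-1/2).\<close>

lemma cf_scaled_power_tendsto:
  "(\<lambda>n. (cis (- ((1 / sqrt n) *\<^sub>R t \<bullet> mu)) * cf 0 ((1 / sqrt n) *\<^sub>R t)) ^ n) \<longlonglongrightarrow> complex_of_real (exp (- (t \<bullet> (cov *v t)) / 2))"
proof -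
  define Y where "Y k = t \<bullet> rvec k - t \<bullet> mu" for k
  define V where "V = t \<bullet> (cov *v t)"
  define T where "T = (\<Sum>\<^sub>\<infinity>k. p k * \<bar>Y k\<bar> ^ 3)"
  define z where "z a = cis (- (a * (t \<bullet> mu))) * cf 0 (a *\<^sub>R t)" for a
  have Vnn: "V \<ge> 0" unfolding V_def by (rule has_sum_nonneg[OF cov_form]) (use p_nonneg in auto)
  have hsz: "((\<lambda>k. complex_of_real (p k) * cis (a * Y k)) has_sum z a) UNIV" for a
  proof -
    have "((\<lambda>k. complex_of_real (p k) * cis (a *\<^sub>R t \<bullet> rvec k)) has_sum cf 0 (a *\<^sub>R t)) UNIV"
      unfolding cf_0_eq by (intro has_sum_infsum summable_on_of_real_cis p_summable p_nonneg)
    then have "((\<lambda>k. cis (- (a * (t \<bullet> mu))) * (complex_of_real (p k) * cis (a *\<^sub>R t \<bullet> rvec k))) has_sum z a) UNIV"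
      unfolding z_def by (rule has_sum_cmult_right)
    moreover have "cis (- (a * (t \<bullet> mu))) * (complex_of_real (p k) * cis (a *\<^sub>R t \<bullet> rvec k)) = complex_of_real (p k) * cis (a * Y k)" for k
    proof -
      have "cis (a * Y k) = cis (- (a * (t \<bullet> mu))) * cis (a *\<^sub>R t \<bullet> rvec k)"
        by (simp add: cis_mult Y_def right_diff_distrib)
      then show ?thesis by simp
    qed
    ultimately show ?thesis by (simp only:)
  qed
  have z1: "norm (z a) \<le> 1" for a
    by (rule norm_infsum_le[OF hsz p_sum]) (use p_nonneg in \<open>simp add: norm_mult\<close>)
  have hsY: "((\<lambda>k. p k * Y k) has_sum 0) UNIV"
  proof -
    have "((\<lambda>k. p k * (t \<bullet> rvec k) - p k * (t \<bullet> mu)) has_sum (t \<bullet> mu - 1 * (t \<bullet> mu))) UNIV"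
      by (intro has_sum_diff inner_mean has_sum_cmult_left p_sum)
    then show ?thesis by (simp add: Y_def right_diff_distrib)
  qed
  have hsV: "((\<lambda>k. p k * (Y k)\<^sup>2) has_sum V) UNIV" unfolding Y_def V_def by (rule cov_form)
  have hsT: "((\<lambda>k. p k * \<bar>Y k\<bar> ^ 3) has_sum T) UNIV"
    unfolding T_def Y_def by (intro has_sum_infsum centered_moment_summable)
  let ?T = "\<lambda>a k. 1 + \<i> * complex_of_real (a * Y k) - complex_of_real ((a * Y k)\<^sup>2 / 2)"
  have zb: "norm (z a - complex_of_real (1 - a\<^sup>2 * V / 2)) \<le> a ^ 3 * T / 6" if a: "a \<ge> 0" for a
  proof -
    have "((\<lambda>k. complex_of_real (p k) * cis (a * Y k)
          - (complex_of_real (p k) + \<i> * complex_of_real (a * (p k * Y k)) - complex_of_real (a\<^sup>2 / 2 * (p k * (Y k)\<^sup>2)))) has_sum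
        (z a - (complex_of_real 1 + \<i> * complex_of_real (a * 0) - complex_of_real (a\<^sup>2 / 2 * V)))) UNIV"
      by (intro has_sum_diff has_sum_add hsz has_sum_of_real p_sum has_sum_cmult_right hsY hsV)
    moreover have "complex_of_real (p k) * cis (a * Y k)
          - (complex_of_real (p k) + \<i> * complex_of_real (a * (p k * Y k)) - complex_of_real (a\<^sup>2 / 2 * (p k * (Y k)\<^sup>2)))
        = complex_of_real (p k) * (cis (a * Y k) - ?T a k)" for k
      by (simp add: algebra_simps power2_eq_square)
    moreover have "z a - (complex_of_real 1 + \<i> * complex_of_real (a * 0) - complex_of_real (a\<^sup>2 / 2 * V)) = z a - complex_of_real (1 - a\<^sup>2 * V / 2)"
      by simp
    ultimately have hs: "((\<lambda>k. complex_of_real (p k) * (cis (a * Y k) - ?T a k)) has_sum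
        (z a - complex_of_real (1 - a\<^sup>2 * V / 2))) UNIV"
      by (simp only:)
    have "norm (complex_of_real (p k) * (cis (a * Y k) - ?T a k))
        \<le> a ^ 3 / 6 * (p k * \<bar>Y k\<bar> ^ 3)" for k
    proof -
      have "(\<Sum>m\<le>2. (\<i> * complex_of_real (a * Y k)) ^ m / fact m) = ?T a k"
        by (simp add: eval_nat_numeral field_simps)
      then have "norm (cis (a * Y k) - ?T a k) \<le> \<bar>a * Y k\<bar> ^ 3 / 6"
        using iexp_approx1[of "a * Y k" 2] by (simp add: cis_conv_exp eval_nat_numeral)
      then have "p k * norm (cis (a * Y k) - ?T a k) \<le> p k * (\<bar>a * Y k\<bar> ^ 3 / 6)"
        using p_nonneg by (rule mult_left_mono)
      then show ?thesis using a p_nonneg by (simp add: norm_mult abs_mult power_mult_distrib mult_ac)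
    qed
    from norm_infsum_le[OF hs has_sum_cmult_right[OF hsT, of "a ^ 3 / 6"] this] show ?thesis by simp
  qed
  have wb: "\<bar>exp (- x) - (1 - x)\<bar> \<le> x\<^sup>2" if "x \<ge> 0" for x :: real
  proof -
    have "1 - x \<le> exp (- x)" using exp_ge_add_one_self[of "- x"] by simp
    moreover have "exp (- x) \<le> 1 - x + x\<^sup>2"
    proof -
      have "exp (- x) = 1 / exp x" by (simp add: exp_minus field_simps)
      also have "\<dots> \<le> 1 / (1 + x)"
        using exp_ge_add_one_self[of x] that by (intro divide_left_mono) auto
      also have "\<dots> \<le> 1 - x + x\<^sup>2"
      proof -
        have "(1 - x + x\<^sup>2) * (1 + x) = 1 + x ^ 3" by (simp add: algebra_simps power2_eq_square power3_eq_cube)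
        then have "1 \<le> (1 - x + x\<^sup>2) * (1 + x)" using that by simp
        then show ?thesis using that by (subst pos_divide_le_eq) auto
      qed
      finally show ?thesis .
    qed
    ultimately show ?thesis by (simp add: abs_le_iff)
  qed
  have main: "norm (z (1 / sqrt n) ^ n - complex_of_real (exp (- V / 2))) \<le> T / 6 / sqrt n + V\<^sup>2 / 4 / n" if n: "n \<ge> 1" for n :: nat
  proof -
    define a where "a = 1 / sqrt n"
    have a: "a \<ge> 0" "a\<^sup>2 = 1 / n" using n by (auto simp: a_def power_divide)
    \<comment> \<open>The real n-th root of the Gaussian limit, of modulus at most 1, so that powers
      can be compared factor by factor.\<close>
    define w where "w = complex_of_real (exp (- (V / (2 * n))))"
    have wn: "w ^ n = complex_of_real (exp (- V / 2))"
      using n by (simp add: w_def flip: of_real_power exp_of_nat_mult)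
    have w1: "norm w \<le> 1" using Vnn by (simp add: w_def)
    have eq: "w - complex_of_real (1 - a\<^sup>2 * V / 2) = complex_of_real (exp (- (V / (2 * n))) - (1 - V / (2 * n)))"
      by (simp add: w_def a)
    have "norm (w - complex_of_real (1 - a\<^sup>2 * V / 2)) \<le> (V / (2 * n))\<^sup>2"
      unfolding eq norm_of_real by (rule wb) (use Vnn in simp)
    then have "norm (z a - w) \<le> a ^ 3 * T / 6 + (V / (2 * n))\<^sup>2"
      using zb[OF a(1)] norm_triangle_ineq4[of "z a - complex_of_real (1 - a\<^sup>2 * V / 2)" "w - complex_of_real (1 - a\<^sup>2 * V / 2)"] by simp
    then have "n * norm (z a - w) \<le> n * (a ^ 3 * T / 6 + (V / (2 * n))\<^sup>2)"
      by (intro mult_left_mono) auto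
    moreover have "norm (z a ^ n - w ^ n) \<le> n * norm (z a - w)"
      by (rule norm_power_diff[OF z1 w1])
    moreover have "n * (a ^ 3 * T / 6 + (V / (2 * n))\<^sup>2) = T / 6 / sqrt n + V\<^sup>2 / 4 / n"
    proof -
      have "n * a ^ 3 = (n * a\<^sup>2) * a" by (simp add: eval_nat_numeral)
      also have "\<dots> = a" using n by (simp add: a)
      finally have na: "n * a ^ 3 = a" .
      have "n * (a ^ 3 * T / 6) = (n * a ^ 3) * T / 6" by simp
      also have "\<dots> = T / 6 / sqrt n" unfolding na by (simp add: a_def)
      finally have "n * (a ^ 3 * T / 6) = T / 6 / sqrt n" .
      moreover have "n * (V / (2 * n))\<^sup>2 = V\<^sup>2 / 4 / n" using n by (simp add: power2_eq_square field_simps)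
      ultimately show ?thesis by (simp only: distrib_left)
    qed
    ultimately show ?thesis unfolding wn a_def by linarith
  qed
  have "(\<lambda>n. T / 6 / sqrt (real n) + V\<^sup>2 / 4 / real n) \<longlonglongrightarrow> 0 + 0"
    by (intro tendsto_add tendsto_divide_0[OF tendsto_const] filterlim_at_top_imp_at_infinity
        filterlim_compose[OF sqrt_at_top] filterlim_real_sequentially)
  then have lim0: "(\<lambda>n. T / 6 / sqrt (real n) + V\<^sup>2 / 4 / real n) \<longlonglongrightarrow> 0" by simp
  have "\<forall>\<^sub>F n in sequentially. norm (z (1 / sqrt n) ^ n - complex_of_real (exp (- V / 2))) \<le> T / 6 / sqrt n + V\<^sup>2 / 4 / n"
    by (rule eventually_sequentiallyI[of 1]) (rule main)
  from Lim_null_comparison[OF this lim0]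
  have "(\<lambda>n. z (1 / sqrt n) ^ n - complex_of_real (exp (- V / 2))) \<longlonglongrightarrow> 0" .
  then have "(\<lambda>n. z (1 / sqrt n) ^ n) \<longlonglongrightarrow> complex_of_real (exp (- V / 2))"
    by (simp add: LIM_zero_iff)
  then show ?thesis by (simp add: z_def V_def)
qed

text \<open>Rescaling t by 1 / sqrt n in the Fourier integral produces the factor n^(d/2). The
  integrand then has the majorant exp (- c (t . t)) and converges pointwise to a Gaussian times a
  character, whose integral is \<open>integral_gaussian_form\<close>.\<close>

lemma local_limit:
  assumes lim: "(\<lambda>n. (1 / sqrt n) *\<^sub>R (ivec (x n) - real n *\<^sub>R mu)) \<longlonglongrightarrow> u"
  shows "(\<lambda>n. sqrt n ^ CARD('n) * extz (pn n) (x n)) \<longlonglongrightarrow>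
    exp (- (u \<bullet> (matrix_inv cov *v u)) / 2) / sqrt ((2 * pi) ^ CARD('n) * det cov)"
proof -
  obtain c where c: "c > 0" "\<And>s t. (\<forall>j. \<bar>s $ j\<bar> \<le> e) \<Longrightarrow> t \<in> pi_box \<Longrightarrow> norm (cf s t) \<le> mg s * exp (- c * (t \<bullet> t))"
    using cf_bound by blast
  have s0: "\<And>j. \<bar>(0 :: real^'n) $ j\<bar> \<le> e" using e_pos by simp
  have mg0: "mg 0 = 1" by (simp add: mg_def p_infsum)
  note [measurable] = cf_measurable[OF s0]
  define G where "G n t = indicator pi_box ((1 / sqrt n) *\<^sub>R t) *\<^sub>R (cf 0 ((1 / sqrt n) *\<^sub>R t) ^ n * cis (- ((1 / sqrt n) *\<^sub>R t \<bullet> ivec (x n))))" for n and t :: "real^'n"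
  define G' where "G' t = complex_of_real (exp (- (t \<bullet> (cov *v t)) / 2)) * cis (- (t \<bullet> u))" for t
  have scale: "(\<integral>t. G n t \<partial>lborel) = complex_of_real ((2 * pi) ^ CARD('n) * (sqrt n ^ CARD('n) * extz (pn n) (x n)))"
    if n: "n \<ge> 1" for n :: nat
  proof -
    define a where "a = 1 / sqrt n"
    have a: "a > 0" using n by (simp add: a_def)
    define A :: "real^'n^'n" where "A = a *\<^sub>R mat 1"
    have A: "A *v t = a *\<^sub>R t" for t by (simp add: A_def flip: scaleR_matrix_vector_assoc)
    have dA: "det A = a ^ CARD('n)"
      by (subst det_diagonal) (auto simp: A_def mat_def)
    define g where "g t = indicator pi_box t *\<^sub>R (cf 0 t ^ n * cis (- (t \<bullet> ivec (x n))))" for t :: "real^'n"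
    have m: "g \<in> borel_measurable borel" unfolding g_def by measurable
    have "(\<integral>t. g t \<partial>lborel) = \<bar>det A\<bar> *\<^sub>R (\<integral>t. g (A *v t) \<partial>lborel)"
      by (rule integral_matrix_subst[OF _ m]) (use a dA in simp)
    then have 1: "complex_of_real ((2 * pi) ^ CARD('n) * extz (pn n) (x n)) = a ^ CARD('n) *\<^sub>R (\<integral>t. G n t \<partial>lborel)"
      using extz_fourier[OF s0, of n "x n"] a by (simp add: g_def[abs_def] A dA G_def a_def)
    have "(\<integral>t. G n t \<partial>lborel) = (1 / a) ^ CARD('n) *\<^sub>R (a ^ CARD('n) *\<^sub>R (\<integral>t. G n t \<partial>lborel))"
      using a by (simp add: power_divide)
    also have "\<dots> = complex_of_real ((2 * pi) ^ CARD('n) * (sqrt n ^ CARD('n) * extz (pn n) (x n)))"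
      unfolding 1[symmetric] by (simp add: a_def scaleR_conv_of_real)
    finally show ?thesis .
  qed
  \<comment> \<open>The index is shifted because 1 / sqrt 0 is 0: \<open>G 0\<close> is the constant
    1, which has no integrable majorant.\<close>
  have "(\<lambda>n. \<integral>t. G (Suc n) t \<partial>lborel) \<longlonglongrightarrow> (\<integral>t. G' t \<partial>lborel)"
  proof (rule integral_dominated_convergence[where w = "\<lambda>t. exp (- (c * (t \<bullet> t)))"])
    show "G' \<in> borel_measurable lborel" unfolding G'_def by measurable
    show "G (Suc n) \<in> borel_measurable lborel" for n unfolding G_def by measurable
    show "integrable lborel (\<lambda>t::real^'n. exp (- (c * (t \<bullet> t))))"
      by (rule integrable_exp_neg_inner[OF c(1)])
    show "AE t in lborel. norm (G (Suc n) t) \<le> exp (- (c * (t \<bullet> t)))" for n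
    proof (rule AE_I2)
      fix t :: "real^'n"
      define a where "a = 1 / sqrt (real (Suc n))"
      show "norm (G (Suc n) t) \<le> exp (- (c * (t \<bullet> t)))"
      proof (cases "a *\<^sub>R t \<in> pi_box")
        case True
        have aa: "real (Suc n) * (a * a) = 1" by (simp add: a_def real_sqrt_mult_self)
        have "norm (cf 0 (a *\<^sub>R t)) ^ Suc n \<le> exp (- c * (a *\<^sub>R t \<bullet> a *\<^sub>R t)) ^ Suc n"
          using c(2)[OF _ True, of 0] s0 by (intro power_mono) (auto simp: mg0)
        also have "\<dots> = exp (real (Suc n) * (- c * (a *\<^sub>R t \<bullet> a *\<^sub>R t)))" by (simp only: exp_of_nat_mult)
        also have "real (Suc n) * (- c * (a *\<^sub>R t \<bullet> a *\<^sub>R t)) = - (c * ((real (Suc n) * (a * a)) * (t \<bullet> t)))"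
          by simp
        finally have "norm (cf 0 (a *\<^sub>R t)) ^ Suc n \<le> exp (- (c * (t \<bullet> t)))" unfolding aa by simp
        then show ?thesis using True by (simp add: G_def a_def norm_mult norm_power del: power_Suc)
      next
        case False
        then show ?thesis by (simp add: G_def a_def)
      qed
    qed
    show "AE t in lborel. (\<lambda>n. G (Suc n) t) \<longlonglongrightarrow> G' t"
    proof (rule AE_I2)
      fix t :: "real^'n"
      have a0: "(\<lambda>n. 1 / sqrt (real n)) \<longlonglongrightarrow> 0"
        by (intro tendsto_divide_0[OF tendsto_const] filterlim_at_top_imp_at_infinity
            filterlim_compose[OF sqrt_at_top] filterlim_real_sequentially)
      have "(\<lambda>n. (1 / sqrt (real n)) *\<^sub>R t) \<longlonglongrightarrow> 0 *\<^sub>R t" by (intro tendsto_scaleR a0 tendsto_const)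
      then have "\<forall>\<^sub>F n in sequentially. (1 / sqrt (real n)) *\<^sub>R t \<in> ball 0 pi"
        by (intro topological_tendstoD[where l = 0]) auto
      then have ev: "\<forall>\<^sub>F n in sequentially. (1 / sqrt (real n)) *\<^sub>R t \<in> pi_box"
      proof (rule eventually_mono)
        fix n assume "(1 / sqrt (real n)) *\<^sub>R t \<in> ball 0 pi"
        then show "(1 / sqrt (real n)) *\<^sub>R t \<in> pi_box"
          unfolding pi_box_def using component_le_norm_cart[of "(1 / sqrt (real n)) *\<^sub>R t"] by (auto intro: order_trans less_imp_le)
      qed
      have "(\<lambda>n. (cis (- ((1 / sqrt n) *\<^sub>R t \<bullet> mu)) * cf 0 ((1 / sqrt n) *\<^sub>R t)) ^ n * cis (- (t \<bullet> ((1 / sqrt n) *\<^sub>R (ivec (x n) - real n *\<^sub>R mu))))) \<longlonglongrightarrow> G' t"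
        unfolding G'_def by (intro tendsto_mult cf_scaled_power_tendsto tendsto_cis tendsto_minus tendsto_inner tendsto_const lim)
      moreover have "\<forall>\<^sub>F n in sequentially. (cis (- ((1 / sqrt n) *\<^sub>R t \<bullet> mu)) * cf 0 ((1 / sqrt n) *\<^sub>R t)) ^ n * cis (- (t \<bullet> ((1 / sqrt n) *\<^sub>R (ivec (x n) - real n *\<^sub>R mu)))) = G n t"
        using ev
      proof (rule eventually_mono)
        fix n :: nat
        assume b: "(1 / sqrt (real n)) *\<^sub>R t \<in> pi_box"
        define a where "a = 1 / sqrt (real n)"
        \<comment> \<open>The n phases of the mean and the phase of the centred point x n - n mu
          combine to the phase of x n.\<close>
        have "cis (- (a *\<^sub>R t \<bullet> mu)) ^ n * cis (- (t \<bullet> (a *\<^sub>R (ivec (x n) - real n *\<^sub>R mu)))) = cis (- (a *\<^sub>R t \<bullet> ivec (x n)))"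
          unfolding Complex.DeMoivre cis_mult by (rule arg_cong[where f = cis]) (simp add: inner_diff_right algebra_simps)
        then show "(cis (- ((1 / sqrt n) *\<^sub>R t \<bullet> mu)) * cf 0 ((1 / sqrt n) *\<^sub>R t)) ^ n * cis (- (t \<bullet> ((1 / sqrt n) *\<^sub>R (ivec (x n) - real n *\<^sub>R mu)))) = G n t"
          using b unfolding G_def a_def[symmetric] by (simp add: power_mult_distrib mult_ac)
      qed
      ultimately have "(\<lambda>n. G n t) \<longlonglongrightarrow> G' t" by (rule Lim_transform_eventually)
      then show "(\<lambda>n. G (Suc n) t) \<longlonglongrightarrow> G' t" by (rule LIMSEQ_Suc)
    qed
  qed
  then have "(\<lambda>n. complex_of_real ((2 * pi) ^ CARD('n) * (sqrt (Suc n) ^ CARD('n) * extz (pn (Suc n)) (x (Suc n))))) \<longlonglongrightarrow> (\<integral>t. G' t \<partial>lborel)"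
    by (subst (asm) scale) auto
  then have "(\<lambda>n. complex_of_real ((2 * pi) ^ CARD('n) * (sqrt n ^ CARD('n) * extz (pn n) (x n)))) \<longlonglongrightarrow> (\<integral>t. G' t \<partial>lborel)"
    by (rule LIMSEQ_imp_Suc)
  also have "(\<integral>t. G' t \<partial>lborel) = complex_of_real (sqrt ((2 * pi) ^ CARD('n) / det cov) * exp (- (u \<bullet> (matrix_inv cov *v u)) / 2))"
    unfolding G'_def by (rule integral_gaussian_form[OF cov_symmetric cov_pos_def])
  finally have "(\<lambda>n. (2 * pi) ^ CARD('n) * (sqrt n ^ CARD('n) * extz (pn n) (x n))) \<longlonglongrightarrow> sqrt ((2 * pi) ^ CARD('n) / det cov) * exp (- (u \<bullet> (matrix_inv cov *v u)) / 2)"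
    by (simp only: tendsto_of_real_iff)
  from tendsto_mult_left[OF this, of "1 / (2 * pi) ^ CARD('n)"]
  have "(\<lambda>n. sqrt n ^ CARD('n) * extz (pn n) (x n)) \<longlonglongrightarrow> 1 / (2 * pi) ^ CARD('n) * (sqrt ((2 * pi) ^ CARD('n) / det cov) * exp (- (u \<bullet> (matrix_inv cov *v u)) / 2))"
    by simp
  also have "1 / (2 * pi) ^ CARD('n) * (sqrt ((2 * pi) ^ CARD('n) / det cov) * exp (- (u \<bullet> (matrix_inv cov *v u)) / 2))
      = exp (- (u \<bullet> (matrix_inv cov *v u)) / 2) / sqrt ((2 * pi) ^ CARD('n) * det cov)"
  proof -
    define q where "q = (2 * pi) ^ CARD('n)"
    have q: "q > 0" by (simp add: q_def)
    then have "q = sqrt q * sqrt q" by simp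
    then have "sqrt q / q = 1 / sqrt q" using q by (metis nonzero_divide_mult_cancel_left real_sqrt_eq_zero_cancel_iff less_irrefl)
    then have "sqrt (q / det cov) / q = 1 / sqrt (q * det cov)"
      by (simp add: real_sqrt_divide real_sqrt_mult) (metis divide_divide_eq_left mult.commute times_divide_eq_left)
    moreover have "1 / q * (sqrt (q / det cov) * E) = sqrt (q / det cov) / q * E" for E by simp
    ultimately show ?thesis unfolding q_def[symmetric] by simp
  qed
  finally show ?thesis .
qed

end

subsection \<open>Lattice sums over an orthant as integrals\<close>

abbreviation leb :: "'i set \<Rightarrow> ('i \<Rightarrow> real) measure" where
  "leb C \<equiv> PiM C (\<lambda>_. lborel)"

abbreviation orthant :: "'i set \<Rightarrow> ('i \<Rightarrow> real) set" where
  "orthant C \<equiv> {u. \<forall>i\<in>C. u i > 0}"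

text \<open>Exponents on C are kept as functions on the full index type, so that every multi-index
  is uniquely a sum of one supported on C and one supported on its complement.\<close>

definition supp_in :: "'n set \<Rightarrow> ('n \<Rightarrow> nat) set" where
  "supp_in C = {w. \<forall>j. j \<notin> C \<longrightarrow> w j = 0}"

text \<open>The label of the grid cell of mesh 1 / c containing u; it presents a lattice sum as the
  integral of a step function.\<close>

definition floor_on :: "'n set \<Rightarrow> real \<Rightarrow> ('n \<Rightarrow> real) \<Rightarrow> 'n \<Rightarrow> nat" where
  "floor_on C c u = (\<lambda>j. if j \<in> C then nat \<lfloor>c * u j\<rfloor> else 0)"

lemma floor_on_eq_iff:
  assumes "w \<in> supp_in C"
  shows "floor_on C c u = w \<longleftrightarrow> (\<forall>j\<in>C. nat \<lfloor>c * u j\<rfloor> = w j)"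
  using assms unfolding floor_on_def supp_in_def fun_eq_iff by (metis (mono_tags, lifting) mem_Collect_eq)

lemma emeasure_floor_cell:
  assumes c: "c > 0"
  shows "{x \<in> {0<..}. nat \<lfloor>c * x\<rfloor> = m} \<in> sets borel" (is "?A \<in> _")
    and "emeasure lborel {x \<in> {0<..}. nat \<lfloor>c * x\<rfloor> = m} = ennreal (1 / c)"
proof -
  \<comment> \<open>The label 0 is separate because \<open>nat\<close> also sends negative floors to
    0; intersecting with the positive axis leaves an open interval, of the same length 1 /
    c.\<close>
  have "?A = (if m = 0 then {0<..<1 / c} else {m / c..<(m + 1) / c})"
  proof (cases "m = 0")
    case True
    have "?A = {0<..<1 / c}"
    proof (rule set_eqI)
      fix x show "x \<in> ?A \<longleftrightarrow> x \<in> {0<..<1 / c}"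
        using c True by (auto simp: pos_less_divide_eq mult.commute[of x])
    qed
    then show ?thesis using True by simp
  next
    case False
    have "?A = {m / c..<(m + 1) / c}"
    proof (rule set_eqI)
      fix x
      have "nat \<lfloor>c * x\<rfloor> = m \<longleftrightarrow> \<lfloor>c * x\<rfloor> = int m" using False by auto
      also have "\<dots> \<longleftrightarrow> m / c \<le> x \<and> x < (m + 1) / c"
        using c by (simp add: floor_eq_iff pos_divide_le_eq pos_less_divide_eq mult.commute[of x] add.commute[of 1])
      finally have iff: "nat \<lfloor>c * x\<rfloor> = m \<longleftrightarrow> m / c \<le> x \<and> x < (m + 1) / c" .
      have "m / c > 0" using False c by simp
      then have "x > 0" if "m / c \<le> x" using that by (rule order_less_le_trans)
      then show "x \<in> ?A \<longleftrightarrow> x \<in> {m / c..<(m + 1) / c}" 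
        unfolding mem_Collect_eq iff greaterThan_iff atLeastLessThan_iff by blast
    qed
    then show ?thesis using False by (simp only: if_False)
  qed
  moreover have "(m + 1) / c - m / c = 1 / c" by (simp add: add_divide_distrib)
  moreover have "m / c \<le> (m + 1) / c" using c by (intro divide_right_mono) auto
  ultimately show "?A \<in> sets borel" "emeasure lborel ?A = ennreal (1 / c)"
    using c by auto
qed

lemma emeasure_floor_on_cell:
  fixes C :: "'n::finite set"
  assumes c: "c > 0" and w: "w \<in> supp_in C"
  shows "emeasure (leb C) {u \<in> space (leb C). (\<forall>i\<in>C. u i > 0) \<and> floor_on C c u = w}
      = ennreal ((1 / c) ^ card C)"
proof -
  interpret product_sigma_finite "\<lambda>_::'n. lborel :: real measure" by standard
  interpret finite_product_sigma_finite "\<lambda>_::'n. lborel :: real measure" C by standard auto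
  have eq: "{u \<in> space (leb C). (\<forall>i\<in>C. u i > 0) \<and> floor_on C c u = w}
      = PiE C (\<lambda>j. {x \<in> {0<..}. nat \<lfloor>c * x\<rfloor> = w j})"
    by (auto simp: floor_on_eq_iff[OF w] space_PiM PiE_iff extensional_def)
  show "emeasure (leb C) {u \<in> space (leb C). (\<forall>i\<in>C. u i > 0) \<and> floor_on C c u = w}
      = ennreal ((1 / c) ^ card C)"
  proof -
    have "emeasure (leb C) (PiE C (\<lambda>j. {x \<in> {0<..}. nat \<lfloor>c * x\<rfloor> = w j}))
        = (\<Prod>j\<in>C. emeasure lborel {x \<in> {0<..}. nat \<lfloor>c * x\<rfloor> = w j})"
      by (rule measure_times) (simp only: emeasure_floor_cell(1)[OF c] sets_lborel)
    then show ?thesis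
      unfolding eq emeasure_floor_cell(2)[OF c] using c by (simp add: ennreal_power)
  qed
qed

lemma floor_on_measurable [measurable]:
  fixes C :: "'n::finite set"
  shows "floor_on C c \<in> leb C \<rightarrow>\<^sub>M count_space UNIV"
proof (subst measurable_count_space_eq2_countable, safe)
  fix w :: "'n \<Rightarrow> nat"
  have "floor_on C c -` {w} \<inter> space (leb C) = (if w \<in> supp_in C then PiE C (\<lambda>j. {x. nat \<lfloor>c * x\<rfloor> = w j}) else {})"
  proof (cases "w \<in> supp_in C")
    case True
    have "floor_on C c -` {w} \<inter> space (leb C) = {u \<in> space (leb C). floor_on C c u = w}" by auto
    also have "\<dots> = PiE C (\<lambda>j. {x. nat \<lfloor>c * x\<rfloor> = w j})"
      unfolding floor_on_eq_iff[OF True] by (auto simp: space_PiM PiE_iff extensional_def)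
    finally show ?thesis using True by simp
  next
    case False
    then have "floor_on C c u \<noteq> w" for u by (auto simp: floor_on_def supp_in_def)
    then show ?thesis using False by auto
  qed
  moreover have "{x::real. nat \<lfloor>c * x\<rfloor> = m} \<in> sets borel" for m by measurable
  ultimately show "floor_on C c -` {w} \<inter> space (leb C) \<in> sets (leb C)"
    by (auto intro!: sets_PiM_I_finite)
qed auto

lemma orthant_measurable:
  fixes C :: "'n::finite set"
  shows "indicator (orthant C) \<in> borel_measurable (leb C)"
proof (rule borel_measurable_indicator')
  have "{u \<in> space (leb C). \<forall>i\<in>C. u i > 0} = PiE C (\<lambda>_. {0<..})"
    by (auto simp: space_PiM PiE_iff extensional_def)
  then show "{x \<in> space (leb C). x \<in> orthant C} \<in> sets (leb C)"
    by (auto intro!: sets_PiM_I_finite)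
qed

text \<open>The image of Lebesgue measure on the orthant under \<open>floor_on\<close> is (1 /
  c)^|C| times counting measure on \<open>supp_in C\<close>. As multi-indices are countable, it
  suffices to compare singletons, whose preimages are cells. For empty C the domain is a single
  point of mass 1.\<close>

lemma nn_integral_floor_on:
  fixes C :: "'n::finite set" and h :: "('n \<Rightarrow> nat) \<Rightarrow> ennreal"
  assumes c: "c > 0"
  shows "(\<integral>\<^sup>+u. indicator (orthant C) u * h (floor_on C c u) \<partial>leb C)
    = ennreal ((1 / c) ^ card C) * (\<integral>\<^sup>+w. h w \<partial>count_space (supp_in C))"
proof -
    note [measurable] = orthant_measurable[of C]
  define N where "N = distr (density (leb C) (indicator (orthant C))) (count_space UNIV) (floor_on C c)"
  have f: "floor_on C c \<in> density (leb C) (indicator (orthant C)) \<rightarrow>\<^sub>M count_space UNIV"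
    by (simp add: measurable_density_eq1)
  have "N = density (count_space UNIV) (\<lambda>w. ennreal ((1 / c) ^ card C) * indicator (supp_in C) w)"
  proof (rule measure_eqI_countable[where A = UNIV])
    fix w :: "'n \<Rightarrow> nat"
    have pre: "floor_on C c -` {w} \<inter> space (leb C) \<in> sets (leb C)"
      by (rule measurable_sets[OF floor_on_measurable]) simp
    have "emeasure N {w} = emeasure (density (leb C) (indicator (orthant C))) (floor_on C c -` {w} \<inter> space (leb C))"
      unfolding N_def by (subst emeasure_distr[OF f]) auto
    also have "\<dots> = (\<integral>\<^sup>+u. indicator {u \<in> space (leb C). (\<forall>i\<in>C. u i > 0) \<and> floor_on C c u = w} u \<partial>leb C)"
    proof (subst emeasure_density)
      show "(\<integral>\<^sup>+u. indicator (orthant C) u * indicator (floor_on C c -` {w} \<inter> space (leb C)) u \<partial>leb C)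
          = (\<integral>\<^sup>+u. indicator {u \<in> space (leb C). (\<forall>i\<in>C. u i > 0) \<and> floor_on C c u = w} u \<partial>leb C)"
        by (rule nn_integral_cong) (auto split: split_indicator)
    qed (use pre in auto)
    also have "\<dots> = emeasure (leb C) {u \<in> space (leb C). (\<forall>i\<in>C. u i > 0) \<and> floor_on C c u = w}"
    proof (rule nn_integral_indicator)
      have "{u \<in> space (leb C). (\<forall>i\<in>C. u i > 0) \<and> floor_on C c u = w}
          = {u \<in> space (leb C). u \<in> orthant C} \<inter> (floor_on C c -` {w} \<inter> space (leb C))" by auto
      moreover have "{u \<in> space (leb C). u \<in> orthant C} \<in> sets (leb C)"
        using borel_measurable_indicator_iff[of "orthant C" "leb C"] orthant_measurable[of C]
        by (simp add: Int_def conj_commute)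
      ultimately show "{u \<in> space (leb C). (\<forall>i\<in>C. u i > 0) \<and> floor_on C c u = w} \<in> sets (leb C)" using pre by simp
    qed
    also have "\<dots> = ennreal ((1 / c) ^ card C) * indicator (supp_in C) w"
    proof (cases "w \<in> supp_in C")
      case True then show ?thesis by (simp add: emeasure_floor_on_cell[OF c])
    next
      case False
      then have empty: "{u \<in> space (leb C). (\<forall>i\<in>C. u i > 0) \<and> floor_on C c u = w} = {}"
        by (auto simp: supp_in_def floor_on_def fun_eq_iff)
      show ?thesis unfolding empty using False by simp
    qed
    finally show "emeasure N {w} = emeasure (density (count_space UNIV) (\<lambda>w. ennreal ((1 / c) ^ card C) * indicator (supp_in C) w)) {w}"
      by (simp add: emeasure_density nn_integral_count_space_indicator[symmetric] flip: nn_integral_count_space_indicator)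
  qed (auto simp: N_def)
  then have "(\<integral>\<^sup>+w. h w \<partial>N) = (\<integral>\<^sup>+w. ennreal ((1 / c) ^ card C) * (h w * indicator (supp_in C) w) \<partial>count_space UNIV)"
    by (simp add: nn_integral_density mult_ac)
  also have "\<dots> = ennreal ((1 / c) ^ card C) * (\<integral>\<^sup>+w. h w \<partial>count_space (supp_in C))"
    by (simp add: nn_integral_cmult nn_integral_count_space_indicator)
  also have "(\<integral>\<^sup>+w. h w \<partial>N) = (\<integral>\<^sup>+u. indicator (orthant C) u * h (floor_on C c u) \<partial>leb C)"
    unfolding N_def by (subst nn_integral_distr[OF f]) (auto simp: nn_integral_density measurable_density_eq1)
  finally show ?thesis by simp
qed

lemma
  fixes C :: "'n::finite set" and h :: "('n \<Rightarrow> nat) \<Rightarrow> real"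
  assumes c: "c > 0" and h: "\<And>w. h w \<ge> 0" "h summable_on supp_in C"
  shows integrable_floor_on: "integrable (leb C) (\<lambda>u. indicator (orthant C) u * h (floor_on C c u))"
    and integral_floor_on: "(\<integral>u. indicator (orthant C) u * h (floor_on C c u) \<partial>leb C)
      = (1 / c) ^ card C * (\<Sum>\<^sub>\<infinity>w\<in>supp_in C. h w)"
proof -
  note [measurable] = orthant_measurable[of C]
  have abs: "Infinite_Set_Sum.abs_summable_on h (supp_in C)"
    using h unfolding abs_summable_equivalent[symmetric] by simp
  have "(\<integral>\<^sup>+w. ennreal (h w) \<partial>count_space (supp_in C)) = ennreal (\<Sum>\<^sub>\<infinity>w\<in>supp_in C. h w)"
    using nn_integral_conv_infsetsum[OF abs] h(1) infsetsum_infsum[OF abs] by simp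
  then have nn: "(\<integral>\<^sup>+u. ennreal (indicator (orthant C) u * h (floor_on C c u)) \<partial>leb C)
      = ennreal ((1 / c) ^ card C * (\<Sum>\<^sub>\<infinity>w\<in>supp_in C. h w))"
    using nn_integral_floor_on[OF c, of C "\<lambda>w. ennreal (h w)"] c h(1)
    by (simp add: ennreal_mult ennreal_indicator infsum_nonneg)
  show "integrable (leb C) (\<lambda>u. indicator (orthant C) u * h (floor_on C c u))"
    by (rule integrableI_nonneg) (use h(1) nn in auto)
  show "(\<integral>u. indicator (orthant C) u * h (floor_on C c u) \<partial>leb C)
      = (1 / c) ^ card C * (\<Sum>\<^sub>\<infinity>w\<in>supp_in C. h w)"
    by (subst integral_eq_nn_integral) (use h(1) nn c in \<open>auto simp: infsum_nonneg\<close>)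
qed

text \<open>Dominated by two exponential densities placed back to back at b.\<close>

lemma integrable_exp_neg_abs:
  fixes a b :: real assumes "a > 0"
  shows "integrable lborel (\<lambda>x. exp (- (a * \<bar>x - b\<bar>)))"
proof -
  interpret prob_space "density lborel (exponential_density a)"
    by (rule prob_space_exponential_density[OF assms])
  have "(\<integral>\<^sup>+x. ennreal (exponential_density a x) \<partial>lborel) = 1"
    using emeasure_space_1 by (simp add: emeasure_density)
  then have D: "integrable lborel (exponential_density a)"
    by (intro integrableI_nonneg) (auto simp: exponential_density_nonneg[OF assms])
  have "integrable lborel (\<lambda>x. exponential_density a (- b + 1 * x) + exponential_density a (b + (- 1) * x))"
    by (intro Bochner_Integration.integrable_add lborel_integrable_real_affine D) auto
  then have "integrable lborel (\<lambda>x. 1 / a * (exponential_density a (- b + 1 * x) + exponential_density a (b + (- 1) * x)))"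
    by (rule integrable_mult_right)
  then show ?thesis
  proof (rule Bochner_Integration.integrable_bound)
    show "AE x in lborel. norm (exp (- (a * \<bar>x - b\<bar>))) \<le> norm (1 / a * (exponential_density a (- b + 1 * x) + exponential_density a (b + (- 1) * x)))"
      using assms by (intro AE_I2) (auto simp: exponential_density_def abs_if field_simps)
  qed measurable
qed

lemma integral_exp_neg_abs_shift:
  "(\<integral>x. exp (- (a * \<bar>x - b\<bar>)) \<partial>lborel) = (\<integral>x. exp (- (a * \<bar>x\<bar>)) \<partial>lborel)" for a b :: real
  by (subst lborel_integral_real_affine[where t = b and c = 1]) auto

context lattice_dist
begin

text \<open>The rescaled probability at x minus the grid label of u: a step function whose pointwise
  limit comes from the local limit theorem and whose integral over the orthant is a lattice
  sum.\<close>

abbreviation cell :: "'n set \<Rightarrow> nat \<Rightarrow> ('n \<Rightarrow> int) \<Rightarrow> ('n \<Rightarrow> real) \<Rightarrow> real" where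
  "cell C n x u \<equiv> sqrt n ^ CARD('n) * extz (pn n) (\<lambda>j. x j - int (floor_on C (sqrt n) u j))"

abbreviation gauss :: "'n set \<Rightarrow> ('n \<Rightarrow> real) \<Rightarrow> real" where
  "gauss C u \<equiv> exp (- (\<Sum>i\<in>C. \<Sum>j\<in>C. u i * matrix_inv cov $ i $ j * u j) / 2)"

text \<open>The probability that the walk agrees with x outside C and is at most x in every
  coordinate of C.\<close>

definition slice_sum :: "'n set \<Rightarrow> nat \<Rightarrow> ('n \<Rightarrow> int) \<Rightarrow> real" where
  "slice_sum C n x = (\<Sum>\<^sub>\<infinity>w\<in>supp_in C. extz (pn n) (\<lambda>j. x j - int (w j)))"

lemma finite_extz_support: "finite {w. extz (pn n) (\<lambda>j. x j - int (w j)) \<noteq> 0}"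
proof (rule finite_subset)
  show "{w. extz (pn n) (\<lambda>j. x j - int (w j)) \<noteq> 0} \<subseteq> {w. \<forall>j. w j \<le> nat (x j)}"
  proof
    fix w assume "w \<in> {w. extz (pn n) (\<lambda>j. x j - int (w j)) \<noteq> 0}"
    then have "x j - int (w j) \<ge> 0" for j unfolding extz_def by (metis (mono_tags, lifting) mem_Collect_eq)
    then have "int (w j) \<le> x j" for j by (metis diff_ge_0_iff_ge)
    moreover from this have "x j \<ge> 0" for j by (metis of_nat_0_le_iff order_trans)
    ultimately show "w \<in> {w. \<forall>j. w j \<le> nat (x j)}" by (simp add: le_nat_iff)
  qed
  show "finite {w :: 'n \<Rightarrow> nat. \<forall>j. w j \<le> nat (x j)}" by (rule finite_le_fun)
qed

lemma extz_slice_summable: "(\<lambda>w. extz (pn n) (\<lambda>j. x j - int (w j))) summable_on A"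
  by (rule finite_nonzero_values_imp_summable_on)
     (rule finite_subset[OF _ finite_extz_support[of n x]], auto)

lemma slice_sum_nonneg: "slice_sum C n x \<ge> 0"
  unfolding slice_sum_def by (intro infsum_nonneg extz_nonneg)

lemma card_add_compl: "card C + card (- C) = CARD('n)" for C :: "'n set"
  using card_Un_disjoint[of C "- C"] by (simp add: Compl_partition)

text \<open>The factor n^(d/2) in \<open>cell\<close> meets the cell volume n^(-|C|/2), which leaves
  n^(1/2) for each coordinate outside C.\<close>

lemma
  assumes n: "n \<ge> 1"
  shows integrable_slice: "integrable (leb C) (\<lambda>u. indicator (orthant C) u * (cell C n x u))"
    and integral_slice: "(\<integral>u. indicator (orthant C) u * (cell C n x u) \<partial>leb C)
      = sqrt n ^ card (- C) * slice_sum C n x"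
proof -
  have c: "sqrt n > 0" using n by simp
  define h where "h w = sqrt n ^ CARD('n) * extz (pn n) (\<lambda>j. x j - int (w j))" for w
  have h: "\<And>w. h w \<ge> 0" "h summable_on supp_in C"
    unfolding h_def[abs_def] by (auto intro!: mult_nonneg_nonneg extz_nonneg summable_on_cmult_right extz_slice_summable)
  show "integrable (leb C) (\<lambda>u. indicator (orthant C) u * (cell C n x u))"
    using integrable_floor_on[OF c h] unfolding h_def .
  have "(\<integral>u. indicator (orthant C) u * h (floor_on C (sqrt n) u) \<partial>leb C)
      = (1 / sqrt n) ^ card C * (sqrt n ^ CARD('n) * slice_sum C n x)"
    unfolding integral_floor_on[OF c h] unfolding h_def slice_sum_def
    by (subst infsum_cmult_right) (auto intro: extz_slice_summable)
  also have "\<dots> = sqrt n ^ card (- C) * slice_sum C n x"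
    using n by (simp add: card_add_compl[of C, symmetric] power_add power_divide)
  finally show "(\<integral>u. indicator (orthant C) u * (cell C n x u) \<partial>leb C)
      = sqrt n ^ card (- C) * slice_sum C n x" unfolding h_def .
qed

text \<open>Transfers \<open>extz_decay\<close> from grid points to u. Rounding moves u_j by at most
  1 / sqrt n <= 1, at the cost of a factor exp e per coordinate of C; the factors outside C are at
  most 1 and are dropped.\<close>

lemma slice_decay:
  "\<exists>M>0. \<forall>n\<ge>1. \<forall>x C u. indicator (orthant C) u * (cell C n x u)
     \<le> M * (\<Prod>j\<in>C. exp e * exp (- (e * \<bar>u j - (of_int (x j) - n * mu $ j) / sqrt n\<bar>)))"
proof -
  obtain M where M: "M > 0" "\<And>n x. n \<ge> 1 \<Longrightarrow> extz (pn n) x * sqrt n ^ CARD('n)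
     \<le> M * (\<Prod>j\<in>UNIV. exp (- (e / sqrt n * \<bar>of_int (x j) - n * mu $ j\<bar>)))"
    using extz_decay by blast
  have "indicator (orthant C) u * (cell C n x u)
     \<le> M * (\<Prod>j\<in>C. exp e * exp (- (e * \<bar>u j - (of_int (x j) - n * mu $ j) / sqrt n\<bar>)))"
    if n: "n \<ge> 1" for n :: nat and x :: "'n \<Rightarrow> int" and C and u :: "'n \<Rightarrow> real"
  proof (cases "\<forall>i\<in>C. u i > 0")
    case True
    have sn: "sqrt n \<ge> 1" using n by simp
    define f where "f = (\<lambda>j. exp e * exp (- (e * \<bar>u j - (of_int (x j) - n * mu $ j) / sqrt n\<bar>)))"
    let ?y = "\<lambda>j. of_int (x j - int (floor_on C (sqrt n) u j)) - n * mu $ j"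
    have fac: "exp (- (e / sqrt n * \<bar>?y j\<bar>)) \<le> (if j \<in> C then f j else 1)" for j
    proof (cases "j \<in> C")
      case False then show ?thesis using e_pos n by simp
    next
      case jC: True
      define b where "b = (of_int (x j) - n * mu $ j) / sqrt n"
      define m where "m = real (nat \<lfloor>sqrt n * u j\<rfloor>)"
      have "sqrt n * u j \<ge> 0" using True jC sn by (intro mult_nonneg_nonneg) (auto intro: less_imp_le)
      then have "m = of_int \<lfloor>sqrt n * u j\<rfloor>" by (simp add: m_def)
      then have "\<bar>m - sqrt n * u j\<bar> \<le> 1" by linarith
      then have "\<bar>m - sqrt n * u j\<bar> / sqrt n \<le> 1 / 1" using sn by (intro frac_le) auto
      moreover have "\<bar>m - sqrt n * u j\<bar> / sqrt n = \<bar>m / sqrt n - u j\<bar>"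
      proof -
        have "m / sqrt n - u j = (m - sqrt n * u j) / sqrt n" using sn by (simp add: diff_divide_distrib)
        then show ?thesis using sn by simp
      qed
      ultimately have d: "\<bar>m / sqrt n - u j\<bar> \<le> 1" by simp
      have eq: "1 / sqrt n * \<bar>?y j\<bar> = \<bar>b - m / sqrt n\<bar>"
      proof -
        have "b - m / sqrt n = ?y j / sqrt n"
          using jC by (simp add: b_def m_def floor_on_def diff_divide_distrib)
        then show ?thesis using sn by simp
      qed
      have "e / sqrt n * \<bar>?y j\<bar> = e * \<bar>b - m / sqrt n\<bar>"
      proof -
        have "e / sqrt n * X = e * (1 / sqrt n * X)" for X by simp
        then show ?thesis unfolding eq[symmetric] .
      qed
      also have "\<dots> \<ge> e * (\<bar>u j - b\<bar> - 1)"
        using e_pos d by (intro mult_left_mono) linarith+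
      finally have "- (e / sqrt n * \<bar>?y j\<bar>) \<le> e + - (e * \<bar>u j - b\<bar>)"
        by (simp add: right_diff_distrib)
      then show ?thesis using jC by (simp add: f_def b_def flip: exp_add)
    qed
    have "cell C n x u
        \<le> M * (\<Prod>j\<in>UNIV. exp (- (e / sqrt n * \<bar>?y j\<bar>)))"
      using M(2)[OF n, of "\<lambda>j. x j - int (floor_on C (sqrt n) u j)"] by (simp only: mult.commute)
    also have "\<dots> \<le> M * (\<Prod>j\<in>UNIV. if j \<in> C then f j else 1)"
    proof (rule mult_left_mono)
      show "(\<Prod>j\<in>UNIV. exp (- (e / sqrt n * \<bar>?y j\<bar>))) \<le> (\<Prod>j\<in>UNIV. if j \<in> C then f j else 1)"
        by (rule prod_mono) (simp only: fac exp_ge_zero simp_thms)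
    qed (use M in simp)
    also have "(\<Prod>j\<in>UNIV. if j \<in> C then f j else 1) = (\<Prod>j\<in>C. f j)"
      by (rule prod.mono_neutral_cong_right) auto
    finally show ?thesis using True by (simp add: f_def)
  next
    case False
    have "0 \<le> M * (\<Prod>j\<in>C. exp e * exp (- (e * \<bar>u j - (of_int (x j) - n * mu $ j) / sqrt n\<bar>)))"
      using M by (intro mult_nonneg_nonneg prod_nonneg) auto
    then show ?thesis using False by simp
  qed
  then show ?thesis using M(1) by blast
qed

lemma integrable_exp_prod:
  fixes C :: "'n set"
  shows "integrable (leb C) (\<lambda>u. \<Prod>j\<in>C. exp e * exp (- (e * \<bar>u j - b j\<bar>)))"
    and "(\<integral>u. (\<Prod>j\<in>C. exp e * exp (- (e * \<bar>u j - b j\<bar>))) \<partial>leb C) = (exp e * (\<integral>x. exp (- (e * \<bar>x\<bar>)) \<partial>lborel)) ^ card C"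
proof -
  interpret product_sigma_finite "\<lambda>_::'n. lborel :: real measure" by standard
  have i: "integrable lborel (\<lambda>x. exp e * exp (- (e * \<bar>x - b\<bar>)))" for b
    by (rule integrable_mult_right[OF integrable_exp_neg_abs[OF e_pos]])
  show "integrable (leb C) (\<lambda>u. \<Prod>j\<in>C. exp e * exp (- (e * \<bar>u j - b j\<bar>)))"
    by (rule product_integrable_prod[OF finite i])
  show "(\<integral>u. (\<Prod>j\<in>C. exp e * exp (- (e * \<bar>u j - b j\<bar>))) \<partial>leb C) = (exp e * (\<integral>x. exp (- (e * \<bar>x\<bar>)) \<partial>lborel)) ^ card C"
    unfolding product_integral_prod[OF finite i] integral_mult_right_zero integral_exp_neg_abs_shift
    by simp
qed

text \<open>The majorant depends on x only through a translation, so its integral does not depend on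
  x. This uniformity supplies the domination over all shifts (k, v) in
  \<open>coefficient_limit\<close>.\<close>

lemma slice_sum_bounded: "\<exists>M. \<forall>n\<ge>1. \<forall>x. sqrt n ^ card (- C) * slice_sum C n x \<le> M"
proof -
  obtain M where M: "M > 0" "\<And>n x u. n \<ge> 1 \<Longrightarrow> indicator (orthant C) u * (cell C n x u)
     \<le> M * (\<Prod>j\<in>C. exp e * exp (- (e * \<bar>u j - (of_int (x j) - n * mu $ j) / sqrt n\<bar>)))"
    using slice_decay by blast
  have "sqrt n ^ card (- C) * slice_sum C n x \<le> M * (exp e * (\<integral>x. exp (- (e * \<bar>x\<bar>)) \<partial>lborel)) ^ card C"
    if n: "n \<ge> 1" for n :: nat and x :: "'n \<Rightarrow> int"
  proof -
    define b where "b j = (of_int (x j) - n * mu $ j) / sqrt n" for j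
    have "sqrt n ^ card (- C) * slice_sum C n x \<le> (\<integral>u. M * (\<Prod>j\<in>C. exp e * exp (- (e * \<bar>u j - b j\<bar>))) \<partial>leb C)"
      unfolding integral_slice[OF n, symmetric] b_def
      by (intro integral_mono integrable_slice[OF n] integrable_mult_right integrable_exp_prod(1) M(2)[OF n])
    also have "\<dots> = M * (exp e * (\<integral>x. exp (- (e * \<bar>x\<bar>)) \<partial>lborel)) ^ card C"
      unfolding integral_mult_right_zero integrable_exp_prod(2) ..
    finally show ?thesis .
  qed
  then show ?thesis by blast
qed

definition orthant_mass :: "'n set \<Rightarrow> real" where
  "orthant_mass C = (\<integral>u. indicator (orthant C) u *
     gauss C u \<partial>leb C)"

text \<open>Dominated convergence for the step functions \<open>cell\<close>, with pointwise limit
  from \<open>local_limit\<close>. Integrability of the Gaussian on the orthant comes along as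
  integrability of a dominated limit.\<close>

lemma
  assumes x: "\<And>j. (\<lambda>n. (of_int (x n j) - n * mu $ j) / sqrt n) \<longlonglongrightarrow> 0"
  shows slice_sum_tendsto: "(\<lambda>n. sqrt n ^ card (- C) * slice_sum C n (x n)) \<longlonglongrightarrow> orthant_mass C / sqrt ((2 * pi) ^ CARD('n) * det cov)"
    and orthant_integrable: "integrable (leb C) (\<lambda>u. indicator (orthant C) u *
     gauss C u)"
proof -
  obtain M where M: "M > 0" "\<And>n x u. n \<ge> 1 \<Longrightarrow> indicator (orthant C) u * (cell C n x u)
     \<le> M * (\<Prod>j\<in>C. exp e * exp (- (e * \<bar>u j - (of_int (x j) - n * mu $ j) / sqrt n\<bar>)))"
    using slice_decay by blast
  define F where "F n u = indicator (orthant C) u * (cell C n (x n) u)" for n u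
  define q where "q = sqrt ((2 * pi) ^ CARD('n) * det cov)"
  define F' where "F' u = indicator (orthant C) u * (gauss C u / q)" for u
  have "Bseq (\<lambda>n. (of_int (x n j) - n * mu $ j) / sqrt n)" for j
    by (rule convergent_imp_Bseq) (use x in \<open>auto simp: convergent_def\<close>)
  \<comment> \<open>The rescaled displacements converge and are thus bounded; moving the centre of
    the majorant to 0 costs the factor exp (e D_j), so one integrable function serves all n.\<close>
  then obtain D where D: "\<And>n j. \<bar>(of_int (x n j) - n * mu $ j) / sqrt n\<bar> \<le> D j"
    unfolding Bseq_def real_norm_def by metis
  define W where "W u = M * ((\<Prod>j\<in>C. exp (e * D j)) * (\<Prod>j\<in>C. exp e * exp (- (e * \<bar>u j - 0\<bar>))))" for u :: "'n \<Rightarrow> real"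
  have F'_measurable: "F' \<in> borel_measurable (leb C)"
  proof -
    note [measurable] = orthant_measurable[of C]
    have [measurable]: "(\<lambda>u. u i) \<in> borel_measurable (leb C)" if "i \<in> C" for i
      using measurable_component_singleton[OF that, of "\<lambda>_. lborel :: real measure"] by simp
    show ?thesis unfolding F'_def by measurable
  qed
  have F_measurable: "F (Suc n) \<in> borel_measurable (leb C)" for n
    unfolding F_def using integrable_slice[of "Suc n" C "x (Suc n)"] by (auto dest: borel_measurable_integrable)
  have W_integrable: "integrable (leb C) W"
    unfolding W_def by (intro integrable_mult_right integrable_exp_prod(1))
  have F_bound: "AE u in leb C. norm (F (Suc n) u) \<le> W u" for n
  proof (rule AE_I2)
    fix u :: "'n \<Rightarrow> real"
    have "norm (F (Suc n) u) = F (Suc n) u"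
      unfolding F_def using extz_nonneg by simp
    also have "\<dots> \<le> M * (\<Prod>j\<in>C. exp e * exp (- (e * \<bar>u j - (of_int (x (Suc n) j) - Suc n * mu $ j) / sqrt (Suc n)\<bar>)))"
      unfolding F_def by (rule M(2)) simp
    also have "\<dots> \<le> M * (\<Prod>j\<in>C. exp (e * D j) * (exp e * exp (- (e * \<bar>u j - 0\<bar>))))"
    proof (intro mult_left_mono prod_mono conjI)
      fix j
      define b where "b = (of_int (x (Suc n) j) - Suc n * mu $ j) / sqrt (Suc n)"
      have "\<bar>b\<bar> \<le> D j" using D[of "Suc n" j] unfolding b_def .
      then have "e * \<bar>u j\<bar> \<le> e * (D j + \<bar>u j - b\<bar>)" using e_pos by (intro mult_left_mono) linarith+
      then have "- (e * \<bar>u j - b\<bar>) \<le> e * D j + - (e * \<bar>u j\<bar>)" by (simp add: distrib_left)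
      then have "exp (- (e * \<bar>u j - b\<bar>)) \<le> exp (e * D j) * exp (- (e * \<bar>u j\<bar>))" by (simp flip: exp_add)
      then have "exp e * exp (- (e * \<bar>u j - b\<bar>)) \<le> exp e * (exp (e * D j) * exp (- (e * \<bar>u j\<bar>)))" by (intro mult_left_mono) auto
      then show "exp e * exp (- (e * \<bar>u j - (of_int (x (Suc n) j) - Suc n * mu $ j) / sqrt (Suc n)\<bar>)) \<le> exp (e * D j) * (exp e * exp (- (e * \<bar>u j - 0\<bar>)))"
        unfolding b_def[symmetric] by (simp add: mult_ac)
    qed (use M in auto)
    also have "\<dots> = W u" by (simp only: W_def prod.distrib)
    finally show "norm (F (Suc n) u) \<le> W u" .
  qed
  have F_lim: "AE u in leb C. (\<lambda>n. F (Suc n) u) \<longlonglongrightarrow> F' u"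
  proof (rule AE_I2)
    fix u :: "'n \<Rightarrow> real"
    show "(\<lambda>n. F (Suc n) u) \<longlonglongrightarrow> F' u"
    proof (cases "\<forall>i\<in>C. u i > 0")
      case False then show ?thesis by (simp add: F_def F'_def)
    next
      case True
      \<comment> \<open>The walk must reach x minus a nonnegative vector, so the rescaled target is
        -u on C and 0 elsewhere; the quadratic form is even, which removes the sign.\<close>
      define u' :: "real^'n" where "u' = (\<chi> j. if j \<in> C then - u j else 0)"
      have fl: "(\<lambda>n. real (nat \<lfloor>sqrt n * u j\<rfloor>) / sqrt n) \<longlonglongrightarrow> u j" if j: "j \<in> C" for j
      proof -
        have s0: "(\<lambda>n. 1 / sqrt (real n)) \<longlonglongrightarrow> 0"
          by (intro tendsto_divide_0[OF tendsto_const] filterlim_at_top_imp_at_infinity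
              filterlim_compose[OF sqrt_at_top] filterlim_real_sequentially)
        have "\<forall>\<^sub>F n in sequentially. norm (real (nat \<lfloor>sqrt n * u j\<rfloor>) / sqrt n - u j) \<le> 1 / sqrt n"
        proof (rule eventually_sequentiallyI[of 1])
          fix n :: nat assume "n \<ge> 1"
          then have sn: "sqrt n > 0" by simp
          have "sqrt n * u j \<ge> 0" using True j sn by (intro mult_nonneg_nonneg) (auto intro: less_imp_le)
          then have "\<bar>real (nat \<lfloor>sqrt n * u j\<rfloor>) - sqrt n * u j\<bar> \<le> 1" by linarith
          then have "\<bar>real (nat \<lfloor>sqrt n * u j\<rfloor>) - sqrt n * u j\<bar> / sqrt n \<le> 1 / sqrt n"
            using sn by (intro divide_right_mono) auto
          moreover have "real (nat \<lfloor>sqrt n * u j\<rfloor>) / sqrt n - u j = (real (nat \<lfloor>sqrt n * u j\<rfloor>) - sqrt n * u j) / sqrt n"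
            using sn by (simp add: diff_divide_distrib)
          ultimately show "norm (real (nat \<lfloor>sqrt n * u j\<rfloor>) / sqrt n - u j) \<le> 1 / sqrt n" using sn by simp
        qed
        from Lim_null_comparison[OF this s0] show ?thesis by (simp add: LIM_zero_iff)
      qed
      have "(\<lambda>n. (1 / sqrt n) *\<^sub>R (ivec (\<lambda>j. x n j - int (floor_on C (sqrt n) u j)) - real n *\<^sub>R mu)) \<longlonglongrightarrow> u'"
      proof (rule vec_tendstoI)
        fix j
        have "(\<lambda>n. (of_int (x n j) - n * mu $ j) / sqrt n - real (floor_on C (sqrt n) u j) / sqrt n) \<longlonglongrightarrow> 0 - (if j \<in> C then u j else 0)"
          by (intro tendsto_diff x) (auto simp: floor_on_def fl)
        moreover have "0 - (if j \<in> C then u j else 0) = u' $ j" by (simp add: u'_def)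
        ultimately show "(\<lambda>n. ((1 / sqrt n) *\<^sub>R (ivec (\<lambda>j. x n j - int (floor_on C (sqrt n) u j)) - real n *\<^sub>R mu)) $ j) \<longlonglongrightarrow> u' $ j"
          by (simp add: ivec_def diff_divide_distrib algebra_simps)
      qed
      from local_limit[OF this]
      have "(\<lambda>n. cell C n (x n) u) \<longlonglongrightarrow> exp (- (u' \<bullet> (matrix_inv cov *v u')) / 2) / q"
        unfolding q_def .
      also have "u' \<bullet> (matrix_inv cov *v u') = (\<Sum>i\<in>C. \<Sum>j\<in>C. u i * matrix_inv cov $ i $ j * u j)"
      proof -
        have "u' \<bullet> (matrix_inv cov *v u') = (\<Sum>i\<in>UNIV. \<Sum>j\<in>UNIV. u' $ i * matrix_inv cov $ i $ j * u' $ j)"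
          by (simp add: inner_vec_def matrix_vector_mult_def sum_distrib_left mult.assoc)
        also have "\<dots> = (\<Sum>i\<in>C. \<Sum>j\<in>UNIV. u' $ i * matrix_inv cov $ i $ j * u' $ j)"
          by (rule sum.mono_neutral_cong_right) (auto simp: u'_def)
        also have "\<dots> = (\<Sum>i\<in>C. \<Sum>j\<in>C. u i * matrix_inv cov $ i $ j * u j)"
          by (intro sum.cong[OF refl] sum.mono_neutral_cong_right) (auto simp: u'_def)
        finally show ?thesis .
      qed
      finally have "(\<lambda>n. F n u) \<longlonglongrightarrow> F' u" using True by (simp add: F_def F'_def)
      then show ?thesis by (rule LIMSEQ_Suc)
    qed
  qed
  note dc = F'_measurable F_measurable W_integrable F_lim F_bound
  have "integrable (leb C) (\<lambda>u. q * F' u)"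
    by (rule integrable_mult_right[OF integrable_dominated_convergence[OF dc]])
  moreover have "q > 0" using det_pos_def[OF cov_symmetric cov_pos_def] by (simp add: q_def)
  ultimately show "integrable (leb C) (\<lambda>u. indicator (orthant C) u *
     gauss C u)"
    by (simp add: F'_def[abs_def])
  have "(\<lambda>n. \<integral>u. F (Suc n) u \<partial>leb C) \<longlonglongrightarrow> (\<integral>u. F' u \<partial>leb C)"
    by (rule integral_dominated_convergence[OF dc])
  moreover have "(\<integral>u. F' u \<partial>leb C) = orthant_mass C / q"
    unfolding F'_def orthant_mass_def times_divide_eq_right integral_divide_zero ..
  moreover have "(\<integral>u. F (Suc n) u \<partial>leb C) = sqrt (Suc n) ^ card (- C) * slice_sum C (Suc n) (x (Suc n))" for n
    unfolding F_def by (rule integral_slice) simp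
  ultimately have "(\<lambda>n. sqrt (Suc n) ^ card (- C) * slice_sum C (Suc n) (x (Suc n))) \<longlonglongrightarrow> orthant_mass C / q"
    by simp
  then show "(\<lambda>n. sqrt n ^ card (- C) * slice_sum C n (x n)) \<longlonglongrightarrow> orthant_mass C / sqrt ((2 * pi) ^ CARD('n) * det cov)"
    unfolding q_def by (rule LIMSEQ_imp_Suc)
qed

end

subsection \<open>Coefficient sums\<close>

text \<open>Dominated convergence for counting measure on A.\<close>

lemma tannery_infsum:
  fixes f :: "nat \<Rightarrow> 'k \<Rightarrow> 'b::{banach,second_countable_topology}"
  assumes h: "h summable_on A"
    and b: "\<And>n k. k \<in> A \<Longrightarrow> norm (f n k) \<le> h k"
    and l: "\<And>k. k \<in> A \<Longrightarrow> (\<lambda>n. f n k) \<longlonglongrightarrow> g k"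
  shows "(\<lambda>n. infsum (f n) A) \<longlonglongrightarrow> infsum g A"
proof -
  have hs: "(\<lambda>k. norm (h k)) summable_on A"
    by (rule summable_on_iff_abs_summable_on_real[THEN iffD1, OF h])
  have gb: "norm (g k) \<le> h k" if "k \<in> A" for k
    by (rule LIMSEQ_le_const2[OF tendsto_norm[OF l[OF that]]]) (use b that in auto)
  have abs: "Infinite_Set_Sum.abs_summable_on F A" if "\<And>k. k \<in> A \<Longrightarrow> norm (F k) \<le> h k" for F :: "'k \<Rightarrow> 'b"
    unfolding abs_summable_equivalent[symmetric]
    by (rule summable_on_comparison_test[OF h]) (use that in auto)
  have ha: "Infinite_Set_Sum.abs_summable_on h A"
    unfolding abs_summable_equivalent[symmetric] by (rule hs)
  have "(\<lambda>n. \<integral>k. f n k \<partial>count_space A) \<longlonglongrightarrow> (\<integral>k. g k \<partial>count_space A)"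
    by (rule integral_dominated_convergence[where w = h])
       (use ha b l in \<open>auto simp: Infinite_Set_Sum.abs_summable_on_def AE_count_space\<close>)
  then show ?thesis
    using infsetsum_infsum[OF abs[OF b]] infsetsum_infsum[OF abs[OF gb]] by (simp add: infsetsum_def)
qed

lemma infsum_geometric_supp_in:
  fixes z :: "real^'n::finite"
  assumes "\<And>j. j \<in> S \<Longrightarrow> 0 < z $ j" "\<And>j. j \<in> S \<Longrightarrow> z $ j < 1"
  shows "(\<lambda>v. mon z v) summable_on supp_in S"
    and "(\<Sum>\<^sub>\<infinity>v\<in>supp_in S. mon z v) = (\<Prod>j\<in>S. 1 / (1 - z $ j))"
proof -
  define B where "B j = (if j \<in> S then UNIV else {0::nat})" for j
  have eq: "supp_in S = PiE UNIV B"
    by (auto simp: supp_in_def B_def PiE_UNIV_domain split: if_splits)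
  have geo: "((\<lambda>m. z $ j ^ m) has_sum (1 / (1 - z $ j))) UNIV" if "j \<in> S" for j
    by (rule norm_summable_imp_has_sum) (use assms[OF that] in \<open>auto intro!: geometric_sums summable_geometric simp: norm_power\<close>)
  have B: "((\<lambda>m. z $ j ^ m) has_sum (if j \<in> S then 1 / (1 - z $ j) else 1)) (B j)" for j
    using geo[of j] by (auto simp: B_def intro: has_sum_finiteI)
  have abs: "(\<lambda>m. norm (z $ j ^ m)) summable_on B j" for j
    by (rule summable_on_iff_abs_summable_on_real[THEN iffD1, OF has_sum_imp_summable[OF B]])
  have "(\<Sum>\<^sub>\<infinity>v\<in>supp_in S. mon z v) = (\<Prod>j\<in>UNIV. \<Sum>\<^sub>\<infinity>m\<in>B j. z $ j ^ m)"
    unfolding eq mon_def by (rule infsum_prod_PiE_abs[OF finite abs])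
  also have "\<dots> = (\<Prod>j\<in>UNIV. if j \<in> S then 1 / (1 - z $ j) else 1)"
    using B by (intro prod.cong refl infsumI)
  also have "\<dots> = (\<Prod>j\<in>S. 1 / (1 - z $ j))" by (rule prod.mono_neutral_cong_right) auto
  finally show sum: "(\<Sum>\<^sub>\<infinity>v\<in>supp_in S. mon z v) = (\<Prod>j\<in>S. 1 / (1 - z $ j))" .
  \<comment> \<open>An \<open>infsum\<close> that does not exist has value 0, so a nonzero value
    proves summability.\<close>
  have "(\<Prod>j\<in>S. 1 / (1 - z $ j)) \<noteq> 0" using assms(2) by (simp add: less_imp_neq)
  then show "(\<lambda>v. mon z v) summable_on supp_in S"
    using sum infsum_not_exists by metis
qed

text \<open>All coefficients of the geometric factor are 1, so its exponent m is free and \<kappa>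
  is split as k + m plus the exponent of the middle factor.\<close>

lemma ps_mult_geom:
  fixes a q :: "('n::finite \<Rightarrow> nat) \<Rightarrow> 'b::comm_ring_1"
  shows "ps_mult (ps_mult a q) ps_geom \<kappa> =
    (\<Sum>(k, m)\<in>{(k, m). \<forall>j. k j + m j \<le> \<kappa> j}. a k * q (\<lambda>j. \<kappa> j - k j - m j))"
proof -
  have "ps_mult (ps_mult a q) ps_geom \<kappa> = (\<Sum>i\<in>{i. \<forall>j. i j \<le> \<kappa> j}. \<Sum>k\<in>{k. \<forall>j. k j \<le> i j}. a k * q (\<lambda>j. i j - k j))"
    by (simp add: ps_mult_def ps_geom_def)
  also have "\<dots> = (\<Sum>(i, k)\<in>(SIGMA i:{i. \<forall>j. i j \<le> \<kappa> j}. {k. \<forall>j. k j \<le> i j}). a k * q (\<lambda>j. i j - k j))"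
    by (intro sum.Sigma) (auto simp: finite_le_fun)
  also have "\<dots> = (\<Sum>(k, m)\<in>{(k, m). \<forall>j. k j + m j \<le> \<kappa> j}. a k * q (\<lambda>j. \<kappa> j - k j - m j))"
  proof (rule sum.reindex_bij_witness[where i = "\<lambda>(k, m). (\<lambda>j. \<kappa> j - m j, k)" and j = "\<lambda>(i, k). (k, \<lambda>j. \<kappa> j - i j)"], goal_cases)
    case (1 x) then show ?case by (auto simp: fun_eq_iff)
  next
    case (2 x) then show ?case by (auto simp: le_diff_conv)
  next
    case (3 x) then show ?case
      by (auto simp: fun_eq_iff) (metis add_leD2 diff_diff_cancel)
  next
    case (4 x) then show ?case by (auto simp: le_diff_conv2) (meson add_leD1 add_leD2 le_diff_conv2)
  next
    case (5 x)
    obtain i k where x: "x = (i, k)" by (cases x)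
    have le: "i j \<le> \<kappa> j" "k j \<le> i j" for j using 5 by (auto simp: x)
    have "\<kappa> j - k j - (\<kappa> j - i j) = i j - k j" for j using le[of j] by linarith
    then show ?case by (simp add: x)
  qed
  finally show ?thesis .
qed

subsection \<open>Differentiating the cumulant generating function\<close>

text \<open>A Laplace transform with arbitrary real coefficients: differentiating in direction i
  only multiplies c by k_i, so derivatives stay in this form.\<close>

definition lap :: "(('n::finite \<Rightarrow> nat) \<Rightarrow> real) \<Rightarrow> real^'n \<Rightarrow> real" where
  "lap c s = (\<Sum>\<^sub>\<infinity>k. c k * exp (s \<bullet> rvec k))"

lemma lap_summable:
  fixes c :: "('n::finite \<Rightarrow> nat) \<Rightarrow> real"
  assumes "(\<lambda>k. \<bar>c k\<bar> * exp (e * deg k)) summable_on UNIV" "\<And>j. \<bar>s $ j\<bar> \<le> e"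
  shows "(\<lambda>k. c k * exp (s \<bullet> rvec k)) summable_on UNIV"
proof (rule abs_summable_summable, rule summable_on_comparison_test[OF assms(1)])
  show "norm (c k * exp (s \<bullet> rvec k)) \<le> \<bar>c k\<bar> * exp (e * deg k)" for k
    using inner_rvec_bound[OF assms(2), of k] by (auto simp: abs_mult intro!: mult_left_mono)
qed auto

text \<open>Shrinking the radius from e to e' pays for one factor k_i, by (e - e') x <= exp ((e -
  e') x).\<close>

lemma lap_weight_summable:
  fixes c :: "('n::finite \<Rightarrow> nat) \<Rightarrow> real"
  assumes "(\<lambda>k. \<bar>c k\<bar> * exp (e * deg k)) summable_on UNIV" "e' < e"
  shows "(\<lambda>k. \<bar>c k * real (k i)\<bar> * exp (e' * deg k)) summable_on UNIV"
proof (rule summable_on_comparison_test)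
  show "(\<lambda>k. 1 / (e - e') * (\<bar>c k\<bar> * exp (e * deg k))) summable_on UNIV"
    by (rule summable_on_cmult_right[OF assms(1)])
  fix k :: "'n \<Rightarrow> nat"
  have "real (k i) \<le> deg k"
    unfolding deg_def by (rule member_le_sum) auto
  moreover have "(e - e') * deg k \<le> exp ((e - e') * deg k)"
    using exp_ge_add_one_self[of "(e - e') * deg k"] by linarith
  ultimately have "(e - e') * real (k i) \<le> exp ((e - e') * deg k)"
    using assms(2) mult_left_mono[of "real (k i)" "deg k" "e - e'"] by linarith
  then have "real (k i) \<le> 1 / (e - e') * exp ((e - e') * deg k)"
    using assms(2) by (simp add: field_simps)
  then have "\<bar>c k\<bar> * exp (e' * deg k) * real (k i) \<le> \<bar>c k\<bar> * exp (e' * deg k) * (1 / (e - e') * exp ((e - e') * deg k))"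
    by (intro mult_left_mono) auto
  also have "\<dots> = 1 / (e - e') * (\<bar>c k\<bar> * (exp (e' * deg k) * exp ((e - e') * deg k)))"
    by (simp add: mult_ac)
  also have "exp (e' * deg k) * exp ((e - e') * deg k) = exp (e * deg k)"
    by (simp add: left_diff_distrib flip: exp_add)
  finally show "\<bar>c k * real (k i)\<bar> * exp (e' * deg k) \<le> 1 / (e - e') * (\<bar>c k\<bar> * exp (e * deg k))"
    by (simp add: abs_mult mult_ac)
qed auto

text \<open>Termwise differentiation by a direct estimate: the sum of the second-order remainders is
  at most r^2 T, so the difference quotient is within |r| T of the differentiated series.\<close>

lemma lap_has_derivative:
  fixes c :: "('n::finite \<Rightarrow> nat) \<Rightarrow> real"
  assumes c: "(\<lambda>k. \<bar>c k\<bar> * exp (e * deg k)) summable_on UNIV" and s: "\<And>j. \<bar>s $ j\<bar> < e"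
  shows "((\<lambda>r. lap c (s + r *\<^sub>R axis i 1)) has_real_derivative lap (\<lambda>k. c k * real (k i)) s) (at 0)"
proof -
  define m where "m = Max (range (\<lambda>j. \<bar>s $ j\<bar>))"
  have ms: "\<bar>s $ j\<bar> \<le> m" for j unfolding m_def by (rule Max_ge) auto
  have "m \<in> range (\<lambda>j. \<bar>s $ j\<bar>)" unfolding m_def by (rule Max_in) auto
  then have me: "m < e" using s by auto
  have m0: "m \<ge> 0" using ms[of undefined] abs_ge_zero order_trans by blast
  \<comment> \<open>One \<rho> covers the increment r and one the factor x^2 of the remainder;
    dividing the gap e - m by three keeps m + 2 \<rho> strictly below e.\<close>
  define \<rho> where "\<rho> = (e - m) / 3"
  have \<rho>: "\<rho> > 0" "m + 2 * \<rho> < e" "m + \<rho> < e" using me by (auto simp: \<rho>_def field_simps)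
  define T where "T = (\<Sum>\<^sub>\<infinity>k. 2 / \<rho>\<^sup>2 * (\<bar>c k\<bar> * exp (e * deg k)))"
  let ?sr = "\<lambda>r. s + r *\<^sub>R axis i 1" and ?D = "lap (\<lambda>k. c k * real (k i)) s"
  let ?t = "\<lambda>r k. c k * exp (?sr r \<bullet> rvec k) - c k * exp (s \<bullet> rvec k) - r * (c k * real (k i) * exp (s \<bullet> rvec k))"
  have est: "\<bar>lap c (?sr r) - lap c s - r * ?D\<bar> \<le> r\<^sup>2 * T" if r: "\<bar>r\<bar> \<le> \<rho>" for r
  proof -
    have s1: "\<bar>?sr r $ j\<bar> \<le> e" for j
    proof -
      have "\<bar>?sr r $ j\<bar> \<le> \<bar>s $ j\<bar> + \<bar>r\<bar>" by (auto simp: axis_def)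
      then show ?thesis using ms[of j] r \<rho> by linarith
    qed
    have h1: "((\<lambda>k. c k * exp (?sr r \<bullet> rvec k)) has_sum lap c (?sr r)) UNIV"
      unfolding lap_def by (intro has_sum_infsum lap_summable[OF c s1])
    have h2: "((\<lambda>k. c k * exp (s \<bullet> rvec k)) has_sum lap c s) UNIV"
      unfolding lap_def by (intro has_sum_infsum lap_summable[OF c] less_imp_le s)
    have h3: "((\<lambda>k. c k * real (k i) * exp (s \<bullet> rvec k)) has_sum ?D) UNIV"
      unfolding lap_def by (intro has_sum_infsum lap_summable[OF lap_weight_summable[OF c me]] ms)
    have h: "((\<lambda>k. ?t r k) has_sum
       (lap c (?sr r) - lap c s - r * ?D)) UNIV"
      by (intro has_sum_diff h1 h2 has_sum_cmult_right h3)
    have hT: "((\<lambda>k. r\<^sup>2 * (2 / \<rho>\<^sup>2 * (\<bar>c k\<bar> * exp (e * deg k)))) has_sum (r\<^sup>2 * T)) UNIV"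
      unfolding T_def by (intro has_sum_cmult_right has_sum_infsum summable_on_cmult_right c)
    have "norm (?t r k)
        \<le> r\<^sup>2 * (2 / \<rho>\<^sup>2 * (\<bar>c k\<bar> * exp (e * deg k)))" for k
    proof -
      define x where "x = real (k i)"
      have x: "x \<ge> 0" "x \<le> deg k" unfolding x_def deg_def by (auto intro: member_le_sum)
      have ip: "?sr r \<bullet> rvec k = s \<bullet> rvec k + r * x"
        by (simp add: inner_add_left inner_axis' rvec_def x_def)
      have "\<bar>exp (r * x) - 1 - r * x\<bar> \<le> (r * x)\<^sup>2 * exp \<bar>r * x\<bar>"
        using exp_le_quadratic[of "r * x"] exp_ge_add_one_self[of "r * x"] by linarith
      also have "\<dots> \<le> r\<^sup>2 * (x\<^sup>2 * exp (\<rho> * x))"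
        using r x by (auto simp: power_mult_distrib abs_mult mult.assoc intro!: mult_left_mono mult_right_mono)
      also have "\<dots> \<le> r\<^sup>2 * (2 / \<rho>\<^sup>2 * exp (2 * \<rho> * x))"
      proof (rule mult_left_mono)
        have "(\<rho> * x) ^ 2 / fact 2 \<le> exp (\<rho> * x)" using \<rho> x by (intro power_div_fact_le_exp) auto
        then have "x\<^sup>2 \<le> 2 / \<rho>\<^sup>2 * exp (\<rho> * x)" using \<rho> by (simp add: power_mult_distrib field_simps)
        then have "x\<^sup>2 * exp (\<rho> * x) \<le> 2 / \<rho>\<^sup>2 * exp (\<rho> * x) * exp (\<rho> * x)" by (rule mult_right_mono) simp
        then show "x\<^sup>2 * exp (\<rho> * x) \<le> 2 / \<rho>\<^sup>2 * exp (2 * \<rho> * x)"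
          by (simp add: mult.assoc flip: exp_add)
      qed simp
      finally have q: "\<bar>exp (r * x) - 1 - r * x\<bar> \<le> r\<^sup>2 * (2 / \<rho>\<^sup>2 * exp (2 * \<rho> * x))" .
      have "s \<bullet> rvec k \<le> m * deg k" using inner_rvec_bound[OF ms, of k] by linarith
      moreover have "2 * \<rho> * x \<le> 2 * \<rho> * deg k" using x \<rho> by (intro mult_left_mono) auto
      moreover have "(m + 2 * \<rho>) * deg k \<le> e * deg k" using \<rho> by (intro mult_right_mono) auto
      ultimately have ee: "exp (s \<bullet> rvec k + 2 * \<rho> * x) \<le> exp (e * deg k)" by (simp add: distrib_right)
      have "?t r k
          = c k * exp (s \<bullet> rvec k) * (exp (r * x) - 1 - r * x)"
        unfolding ip exp_add x_def[symmetric] by (simp add: algebra_simps)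
      then have "norm (?t r k)
          = \<bar>c k\<bar> * exp (s \<bullet> rvec k) * \<bar>exp (r * x) - 1 - r * x\<bar>" by (simp add: abs_mult)
      also have "\<dots> \<le> \<bar>c k\<bar> * exp (s \<bullet> rvec k) * (r\<^sup>2 * (2 / \<rho>\<^sup>2 * exp (2 * \<rho> * x)))"
        using q by (intro mult_left_mono) auto
      also have "\<dots> = r\<^sup>2 * (2 / \<rho>\<^sup>2 * (\<bar>c k\<bar> * exp (s \<bullet> rvec k + 2 * \<rho> * x)))"
        by (simp add: exp_add)
      also have "\<dots> \<le> r\<^sup>2 * (2 / \<rho>\<^sup>2 * (\<bar>c k\<bar> * exp (e * deg k)))"
        using ee by (intro mult_left_mono) auto
      finally show ?thesis .
    qed
    from norm_infsum_le[OF h hT this] show ?thesis by simp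
  qed
  have "(\<lambda>r. (lap c (?sr r) - lap c (?sr 0)) / r - ?D) \<midarrow>0\<rightarrow> 0"
  proof (rule Lim_null_comparison)
    show "\<forall>\<^sub>F r in at 0. norm ((lap c (?sr r) - lap c (?sr 0)) / r - ?D) \<le> \<bar>r\<bar> * T"
      unfolding eventually_at
    proof (intro exI[of _ \<rho>] conjI ballI impI)
      fix r :: real assume "r \<noteq> 0 \<and> dist r 0 < \<rho>"
      then have r: "r \<noteq> 0" "\<bar>r\<bar> \<le> \<rho>" by auto
      have "(lap c (?sr r) - lap c (?sr 0)) / r - ?D
          = (lap c (?sr r) - lap c s - r * ?D) / r"
        using r by (simp add: field_simps)
      also have "norm \<dots> \<le> r\<^sup>2 * T / \<bar>r\<bar>"
        using est[OF r(2)] r(1) by (simp add: divide_right_mono)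
      also have "r\<^sup>2 * T / \<bar>r\<bar> = \<bar>r\<bar> * T" using r(1) by (simp add: power2_eq_square abs_if)
      finally show "norm ((lap c (?sr r) - lap c (?sr 0)) / r - ?D) \<le> \<bar>r\<bar> * T" .
    qed (use \<rho> in auto)
    have "(\<lambda>r. \<bar>r\<bar> * T) \<midarrow>0\<rightarrow> \<bar>0\<bar> * T" by (intro tendsto_intros)
    then show "(\<lambda>r. \<bar>r\<bar> * T) \<midarrow>0\<rightarrow> 0" by simp
  qed
  then show ?thesis by (simp add: DERIV_def LIM_zero_iff)
qed

lemma mon_exp: "mon (\<chi> j. exp (t $ j)) k = exp (t \<bullet> rvec k)" for t :: "real^'n::finite"
  by (simp add: mon_def inner_vec_def rvec_def exp_sum exp_of_nat_mult[symmetric] mult.commute)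

lemma mon_of_real_exp: "mon (\<chi> j. complex_of_real (exp (t $ j))) k = of_real (exp (t \<bullet> rvec k))" for t :: "real^'n::finite"
  using mon_polar[of t 0 k] by simp

lemma lap_pos:
  fixes c :: "('n::finite \<Rightarrow> nat) \<Rightarrow> real"
  assumes "(\<lambda>k. c k * exp (s \<bullet> rvec k)) summable_on UNIV" "\<And>k. c k \<ge> 0" "c k0 > 0"
  shows "lap c s > 0"
proof -
  have "0 < (\<Sum>k\<in>{k0}. c k * exp (s \<bullet> rvec k))" using assms(3) by simp
  also have "\<dots> \<le> lap c s"
    unfolding lap_def by (rule finite_sum_le_infsum) (use assms in auto)
  finally show ?thesis .
qed

lemma ln_lap_has_derivative:
  fixes c :: "('n::finite \<Rightarrow> nat) \<Rightarrow> real"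
  assumes c: "(\<lambda>k. \<bar>c k\<bar> * exp (e * deg k)) summable_on UNIV" and s: "\<And>j. \<bar>s $ j\<bar> < e"
    and "B > 0" "lap c s > 0"
  shows "((\<lambda>r. ln (B * lap c (s + r *\<^sub>R axis i 1))) has_real_derivative lap (\<lambda>k. c k * real (k i)) s / lap c s) (at 0)"
proof -
  have "((\<lambda>r. ln (B * lap c (s + r *\<^sub>R axis i 1))) has_real_derivative
      1 / (B * lap c (s + 0 *\<^sub>R axis i 1)) * (B * lap (\<lambda>k. c k * real (k i)) s)) (at 0)"
    using assms(3,4) by (intro DERIV_ln_divide[THEN DERIV_chain2] DERIV_cmult lap_has_derivative[OF c s]) auto
  then show ?thesis using assms(3) by simp
qed

text \<open>The constant B disappears with the first derivative, which is a quotient of two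
  transforms; the quotient rule and \<open>lap c 0 = 1\<close> then give second moment minus product
  of means.\<close>

lemma hessian_ln_lap:
  fixes c :: "('n::finite \<Rightarrow> nat) \<Rightarrow> real"
  assumes c: "(\<lambda>k. \<bar>c k\<bar> * exp (e * deg k)) summable_on UNIV" and e: "e > 0"
    and B: "B > 0" and pos: "\<And>s. (\<And>j. \<bar>s $ j\<bar> < e) \<Longrightarrow> lap c s > 0" and one: "lap c 0 = 1"
  shows "hessian (\<lambda>t. ln (B * lap c (t - \<tau>))) \<tau> $ i $ j
    = lap (\<lambda>k. c k * real (k i) * real (k j)) 0 - lap (\<lambda>k. c k * real (k i)) 0 * lap (\<lambda>k. c k * real (k j)) 0"
proof -
  define G where "G s = deriv (\<lambda>r. ln (B * lap c (\<tau> + s *\<^sub>R axis j 1 + r *\<^sub>R axis i 1 - \<tau>))) 0" for s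
  define G' where "G' s = lap (\<lambda>k. c k * real (k i)) (0 + s *\<^sub>R axis j 1) / lap c (0 + s *\<^sub>R axis j 1)" for s
  have G: "G s = G' s" if "\<bar>s\<bar> < e" for s
  proof -
    have bd: "\<bar>(s *\<^sub>R axis j 1 :: real^'n) $ l\<bar> < e" for l using that e by (simp add: axis_def)
    have "((\<lambda>r. ln (B * lap c (s *\<^sub>R axis j 1 + r *\<^sub>R axis i 1))) has_real_derivative G' s) (at 0)"
      using ln_lap_has_derivative[OF c bd B pos[OF bd], of i] by (simp add: G'_def)
    then show ?thesis unfolding G_def by (intro DERIV_imp_deriv) (simp add: add.assoc)
  qed
  \<comment> \<open>The formula for the inner derivative is available only for |s| < e, and
    agreement near 0 determines the outer derivative.\<close>
  have "\<forall>\<^sub>F s in nhds 0. G s = G' s"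
    unfolding eventually_nhds_metric using G e by (intro exI[of _ e]) auto
  then have "deriv G 0 = deriv G' 0" by (rule deriv_cong_ev) simp
  moreover have "(G' has_real_derivative
     (lap (\<lambda>k. c k * real (k i) * real (k j)) 0 * lap c (0 + 0 *\<^sub>R axis j 1) - lap (\<lambda>k. c k * real (k i)) (0 + 0 *\<^sub>R axis j 1) * lap (\<lambda>k. c k * real (k j)) 0)
       / (lap c (0 + 0 *\<^sub>R axis j 1) * lap c (0 + 0 *\<^sub>R axis j 1))) (at 0)"
    unfolding G'_def
  proof (rule DERIV_divide)
    have "e / 2 < e" using e by simp
    from lap_weight_summable[OF c this]
    show "((\<lambda>s. lap (\<lambda>k. c k * real (k i)) (0 + s *\<^sub>R axis j 1)) has_real_derivative lap (\<lambda>k. c k * real (k i) * real (k j)) 0) (at 0)"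
      by (rule lap_has_derivative) (use e in simp)
    show "((\<lambda>s. lap c (0 + s *\<^sub>R axis j 1)) has_real_derivative lap (\<lambda>k. c k * real (k j)) 0) (at 0)"
      using c by (rule lap_has_derivative) (use e in simp)
  qed (simp add: one)
  then have "deriv G' 0 = lap (\<lambda>k. c k * real (k i) * real (k j)) 0 - lap (\<lambda>k. c k * real (k i)) 0 * lap (\<lambda>k. c k * real (k j)) 0"
    by (simp add: one DERIV_imp_deriv)
  ultimately show ?thesis by (simp add: hessian_def G_def[abs_def])
qed

section \<open>The limit of the normalised coefficient sum\<close>

context lattice_dist
begin

lemma cov_eq: "cov $ i $ j = lap (\<lambda>k. p k * real (k i) * real (k j)) 0 - mu $ i * mu $ j"
proof -
  have "(\<lambda>k. p k * ((real (k i) - mu $ i) * (real (k j) - mu $ j)) + (mu $ j * (p k * real (k i)) + mu $ i * (p k * real (k j)) - mu $ i * mu $ j * p k)) = (\<lambda>k. p k * real (k i) * real (k j))"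
    by (simp add: fun_eq_iff algebra_simps)
  moreover have "((\<lambda>k. p k * ((real (k i) - mu $ i) * (real (k j) - mu $ j)) + (mu $ j * (p k * real (k i)) + mu $ i * (p k * real (k j)) - mu $ i * mu $ j * p k))
      has_sum (cov $ i $ j + (mu $ j * mu $ i + mu $ i * mu $ j - mu $ i * mu $ j * 1))) UNIV"
    unfolding cov_def vec_lambda_beta
    by (intro has_sum_add has_sum_diff has_sum_cmult_right has_sum_infsum cov_summable p_mean p_sum)
  ultimately have "((\<lambda>k. p k * real (k i) * real (k j)) has_sum (cov $ i $ j + mu $ i * mu $ j)) UNIV"
    by simp
  then show ?thesis by (simp add: lap_def infsumI)
qed

text \<open>The integrand is positive on the open unit cube, which has measure 1, so it cannot
  vanish almost everywhere; the sequence x gives integrability through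
  \<open>orthant_integrable\<close>.\<close>

lemma orthant_mass_pos:
  fixes x :: "nat \<Rightarrow> 'n \<Rightarrow> int"
  assumes x: "\<And>j. (\<lambda>n. (of_int (x n j) - n * mu $ j) / sqrt n) \<longlonglongrightarrow> 0"
  shows "orthant_mass C > 0"
proof -
  interpret product_sigma_finite "\<lambda>_::'n. lborel :: real measure" by standard
  interpret finite_product_sigma_finite "\<lambda>_::'n. lborel :: real measure" C by standard auto
    let ?f = "\<lambda>u. indicator (orthant C) u * gauss C u"
  have int: "integrable (leb C) ?f" using orthant_integrable[OF x] .
  have nn: "AE u in leb C. 0 \<le> ?f u" by simp
  have "orthant_mass C \<ge> 0" unfolding orthant_mass_def by (rule integral_nonneg_AE[OF nn])
  moreover have "orthant_mass C \<noteq> 0"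
  proof
    assume "orthant_mass C = 0"
    then have "AE u in leb C. ?f u = 0"
      using integral_nonneg_eq_0_iff_AE[OF int nn] by (simp add: orthant_mass_def)
    then have "AE u in leb C. \<not> u \<in> PiE C (\<lambda>_. {0<..<1})"
      by (rule AE_mp) (auto intro!: AE_I2 simp: PiE_iff indicator_def)
    then have "emeasure (leb C) {u \<in> space (leb C). u \<in> PiE C (\<lambda>_. {0<..<1})} = 0" by (rule emeasure_eq_0_AE)
    also have "{u \<in> space (leb C). u \<in> PiE C (\<lambda>_. {0<..<1})} = PiE C (\<lambda>_. {0<..<1})"
      by (auto simp: space_PiM PiE_iff extensional_def)
    also have "emeasure (leb C) (PiE C (\<lambda>_. {0<..<1})) = (\<Prod>i\<in>C. emeasure lborel {0<..<1::real})"
      by (rule measure_times) auto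
    also have "\<dots> = 1" by simp
    finally show False by simp
  qed
  ultimately show ?thesis by simp
qed

abbreviation coeff_sum :: "(('n \<Rightarrow> nat) \<Rightarrow> complex) \<Rightarrow> real^'n \<Rightarrow> nat \<Rightarrow> ('n \<Rightarrow> nat) \<Rightarrow> complex" where
  "coeff_sum \<alpha> z n \<kappa> \<equiv> \<Sum>(k, m)\<in>{(k, m). \<forall>j. k j + m j \<le> \<kappa> j}. \<alpha> k * of_real (mon z m * pn n (\<lambda>j. \<kappa> j - k j - m j))"

text \<open>The exponent m splits as v + w with w supported on C, where z is 1 and the monomial of w
  is trivial; the sum over w is then a \<open>slice_sum\<close>. Extension by zero turns the
  constraint k + m <= \<kappa> into a finitely supported sum over all pairs.\<close>

lemma coefficient_sum_eq:
  fixes \<alpha> :: "('n \<Rightarrow> nat) \<Rightarrow> complex" and z :: "real^'n"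
  assumes zC: "\<And>j. j \<in> C \<Longrightarrow> z $ j = 1"
  shows "coeff_sum \<alpha> z n \<kappa>
    = (\<Sum>\<^sub>\<infinity>(k, v)\<in>UNIV \<times> supp_in (- C). \<alpha> k * of_real (mon z v) * of_real (slice_sum C n (\<lambda>j. int (\<kappa> j) - int (k j) - int (v j))))"
proof -
  define P where "P = {(k, m). \<forall>j. k j + m j \<le> \<kappa> j}"
  define f where "f = (\<lambda>(k, m). \<alpha> k * complex_of_real (mon z m * extz (pn n) (\<lambda>j. int (\<kappa> j) - int (k j) - int (m j))))"
  have finP: "finite P"
  proof (rule finite_subset)
    show "P \<subseteq> {k. \<forall>j. k j \<le> \<kappa> j} \<times> {m. \<forall>j. m j \<le> \<kappa> j}"
      unfolding P_def by (auto intro: add_leD1 add_leD2)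
  qed (simp add: finite_le_fun)
  have fP: "f (k, m) = \<alpha> k * of_real (mon z m * pn n (\<lambda>j. \<kappa> j - k j - m j))" if "(k, m) \<in> P" for k m
  proof -
    have le: "k j + m j \<le> \<kappa> j" for j using that by (simp add: P_def)
    have "int (\<kappa> j) - int (k j) - int (m j) \<ge> 0" for j using le[of j] by linarith
    moreover have "nat (int (\<kappa> j) - int (k j) - int (m j)) = \<kappa> j - k j - m j" for j using le[of j] by linarith
    ultimately show ?thesis by (simp add: f_def extz_def)
  qed
  have f0: "f x = 0" if xP: "x \<notin> P" for x
  proof -
    obtain k m where x: "x = (k, m)" by (cases x)
    obtain j where "\<not> k j + m j \<le> \<kappa> j" using xP by (auto simp: P_def x)
    then have "\<not> int (\<kappa> j) - int (k j) - int (m j) \<ge> 0" by linarith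
    then have "extz (pn n) (\<lambda>j. int (\<kappa> j) - int (k j) - int (m j)) = 0" unfolding extz_def by auto
    then show ?thesis by (simp add: f_def x)
  qed
  have hs: "(f has_sum sum f P) UNIV"
    by (rule has_sum_finite_neutralI[of P]) (use finP f0 in auto)
  define \<phi> where "\<phi> = (\<lambda>((k, v), w). (k :: 'n \<Rightarrow> nat, \<lambda>j :: 'n. v j + w j :: nat))"
  have bij: "bij_betw \<phi> ((UNIV \<times> supp_in (- C)) \<times> supp_in C) UNIV"
    by (rule bij_betw_byWitness[where f' = "\<lambda>(k, m). ((k, \<lambda>j. if j \<in> C then 0 else m j), \<lambda>j. if j \<in> C then m j else 0)"])
       (auto simp: \<phi>_def supp_in_def fun_eq_iff)
  have inner: "(\<Sum>\<^sub>\<infinity>w\<in>supp_in C. f (\<phi> ((k, v), w)))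
      = \<alpha> k * of_real (mon z v) * of_real (slice_sum C n (\<lambda>j. int (\<kappa> j) - int (k j) - int (v j)))" for k v
  proof -
    have z1: "mon z w = 1" if "w \<in> supp_in C" for w
    proof -
      have "z $ j ^ w j = 1" for j using that zC[of j] by (cases "j \<in> C") (auto simp: supp_in_def)
      then show ?thesis by (simp add: mon_def)
    qed
    have "(\<Sum>\<^sub>\<infinity>w\<in>supp_in C. f (\<phi> ((k, v), w)))
      = (\<Sum>\<^sub>\<infinity>w\<in>supp_in C. \<alpha> k * of_real (mon z v) * of_real (extz (pn n) (\<lambda>j. int (\<kappa> j) - int (k j) - int (v j) - int (w j))))"
      by (rule infsum_cong) (simp add: f_def \<phi>_def mon_add z1 algebra_simps)
    also have "\<dots> = \<alpha> k * of_real (mon z v) * (\<Sum>\<^sub>\<infinity>w\<in>supp_in C. complex_of_real (extz (pn n) (\<lambda>j. int (\<kappa> j) - int (k j) - int (v j) - int (w j))))"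
      by (rule infsum_cmult_right')
    also have "(\<Sum>\<^sub>\<infinity>w\<in>supp_in C. complex_of_real (extz (pn n) (\<lambda>j. int (\<kappa> j) - int (k j) - int (v j) - int (w j)))) = of_real (slice_sum C n (\<lambda>j. int (\<kappa> j) - int (k j) - int (v j)))"
      unfolding slice_sum_def by (intro infsumI has_sum_of_real has_sum_infsum extz_slice_summable)
    finally show ?thesis .
  qed
  have summ: "(\<lambda>x. f (\<phi> x)) summable_on ((UNIV \<times> supp_in (- C)) \<times> supp_in C)"
    using has_sum_imp_summable[OF hs] by (simp add: summable_on_reindex_bij_betw[OF bij])
  have "(\<Sum>(k, m)\<in>P. \<alpha> k * of_real (mon z m * pn n (\<lambda>j. \<kappa> j - k j - m j))) = sum f P"
    by (rule sum.cong) (auto simp: fP)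
  also have "\<dots> = infsum f UNIV" using hs by (simp add: infsumI)
  also have "\<dots> = (\<Sum>\<^sub>\<infinity>x\<in>(UNIV \<times> supp_in (- C)) \<times> supp_in C. f (\<phi> x))"
    by (rule infsum_reindex_bij_betw[OF bij, symmetric])
  also have "\<dots> = (\<Sum>\<^sub>\<infinity>y\<in>UNIV \<times> supp_in (- C). \<Sum>\<^sub>\<infinity>w\<in>supp_in C. f (\<phi> (y, w)))"
    by (rule infsum_Sigma_banach[OF summ, symmetric])
  also have "\<dots> = (\<Sum>\<^sub>\<infinity>(k, v)\<in>UNIV \<times> supp_in (- C). \<alpha> k * of_real (mon z v) * of_real (slice_sum C n (\<lambda>j. int (\<kappa> j) - int (k j) - int (v j))))"
    by (rule infsum_cong) (auto simp: inner)
  finally show ?thesis unfolding P_def .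
qed

text \<open>Tannery's theorem over (k, v) with majorant |\<alpha>_k| z^v M. For fixed (k, v) the
  shift divided by sqrt n tends to 0, so every slice has the same limit L and the remaining double
  series factors.\<close>

lemma coefficient_limit:
  fixes \<alpha> :: "('n \<Rightarrow> nat) \<Rightarrow> complex" and z :: "real^'n"
  assumes \<alpha>: "(\<lambda>k. norm (\<alpha> k)) summable_on UNIV"
    and zS: "\<And>j. j \<notin> C \<Longrightarrow> 0 < z $ j" "\<And>j. j \<notin> C \<Longrightarrow> z $ j < 1" and zC: "\<And>j. j \<in> C \<Longrightarrow> z $ j = 1"
    and \<kappa>: "\<And>j. (\<lambda>n. (real (\<kappa> n j) - n * mu $ j) / sqrt n) \<longlonglongrightarrow> 0"
  shows "(\<lambda>n. of_real (sqrt n ^ card (- C)) *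
      coeff_sum \<alpha> z n (\<kappa> n))
    \<longlonglongrightarrow> infsum \<alpha> UNIV * of_real (\<Prod>j\<in>- C. 1 / (1 - z $ j)) * of_real (orthant_mass C / sqrt ((2 * pi) ^ CARD('n) * det cov))"
proof -
  let ?I = "UNIV \<times> supp_in (- C)"
  define L where "L = orthant_mass C / sqrt ((2 * pi) ^ CARD('n) * det cov)"
  define y where "y n k v = (\<lambda>j. int (\<kappa> n j) - int (k j) - int (v j))" for n and k v :: "'n \<Rightarrow> nat"
  define g where "g n = (\<lambda>(k, v). \<alpha> k * of_real (mon z v) * complex_of_real (sqrt n ^ card (- C) * slice_sum C n (y n k v)))" for n :: nat
  obtain M where M: "\<And>n x. n \<ge> 1 \<Longrightarrow> sqrt n ^ card (- C) * slice_sum C n x \<le> M"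
    using slice_sum_bounded by blast
  have zpos: "z $ j > 0" for j using zS(1) zC by (cases "j \<in> C") auto
  then have monpos: "mon z v \<ge> 0" for v unfolding mon_def by (intro prod_nonneg) (auto intro: less_imp_le)
  have geo: "(\<lambda>v. mon z v) summable_on supp_in (- C)" "(\<Sum>\<^sub>\<infinity>v\<in>supp_in (- C). mon z v) = (\<Prod>j\<in>- C. 1 / (1 - z $ j))"
    by (rule infsum_geometric_supp_in; use zS in auto)+
  have geoc: "(\<lambda>v. norm (complex_of_real (mon z v))) summable_on supp_in (- C)"
    using geo(1) monpos by simp
  have s0: "(\<lambda>n. a / sqrt (real n)) \<longlonglongrightarrow> 0" for a
    by (intro tendsto_divide_0[OF tendsto_const] filterlim_at_top_imp_at_infinity
        filterlim_compose[OF sqrt_at_top] filterlim_real_sequentially)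
  have lim: "(\<lambda>n. sqrt n ^ card (- C) * slice_sum C n (y n k v)) \<longlonglongrightarrow> L" for k v
    unfolding L_def
  proof (rule slice_sum_tendsto)
    fix j
    have "(\<lambda>n. (real (\<kappa> n j) - n * mu $ j) / sqrt n - (real (k j) + real (v j)) / sqrt n) \<longlonglongrightarrow> 0 - 0"
      by (intro tendsto_diff \<kappa> s0)
    then show "(\<lambda>n. (of_int (y n k v j) - n * mu $ j) / sqrt n) \<longlonglongrightarrow> 0"
      by (simp add: y_def diff_divide_distrib add_divide_distrib algebra_simps)
  qed
  have "(\<lambda>n. infsum (g (Suc n)) ?I) \<longlonglongrightarrow> infsum (\<lambda>(k, v). \<alpha> k * of_real (mon z v) * of_real L) ?I"
  proof (rule tannery_infsum)
    show "(\<lambda>x. (case x of (k, v) \<Rightarrow> norm (\<alpha> k * complex_of_real (mon z v))) * M) summable_on ?I"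
      by (intro summable_on_cmult_left summable_on_product_norm[OF \<alpha> geoc])
    show "norm (g (Suc n) x) \<le> (case x of (k, v) \<Rightarrow> norm (\<alpha> k * complex_of_real (mon z v))) * M" for n x
    proof -
      obtain k v where x: "x = (k, v)" by (cases x)
      have "\<bar>sqrt (Suc n) ^ card (- C) * slice_sum C (Suc n) (y (Suc n) k v)\<bar> \<le> M"
        using M[of "Suc n" "y (Suc n) k v"] slice_sum_nonneg[of C "Suc n" "y (Suc n) k v"] by (subst abs_of_nonneg) auto
      then show ?thesis unfolding g_def x prod.case norm_mult[of "\<alpha> k * _"] norm_of_real
        by (intro mult_left_mono) auto
    qed
    show "(\<lambda>n. g (Suc n) x) \<longlonglongrightarrow> (case x of (k, v) \<Rightarrow> \<alpha> k * of_real (mon z v) * of_real L)" for x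
    proof -
      obtain k v where x: "x = (k, v)" by (cases x)
      have "(\<lambda>n. g n x) \<longlonglongrightarrow> \<alpha> k * of_real (mon z v) * of_real L"
        unfolding g_def x prod.case by (intro tendsto_mult tendsto_const tendsto_of_real lim)
      then show ?thesis unfolding x prod.case by (rule LIMSEQ_Suc)
    qed
  qed
  then have "(\<lambda>n. infsum (g n) ?I) \<longlonglongrightarrow> infsum (\<lambda>(k, v). \<alpha> k * of_real (mon z v) * of_real L) ?I"
    by (rule LIMSEQ_imp_Suc)
  moreover have "infsum (g n) ?I = of_real (sqrt n ^ card (- C)) *
      coeff_sum \<alpha> z n (\<kappa> n)" for n
  proof -
    have "infsum (g n) ?I = (\<Sum>\<^sub>\<infinity>x\<in>?I. of_real (sqrt n ^ card (- C)) *
        (case x of (k, v) \<Rightarrow> \<alpha> k * of_real (mon z v) * of_real (slice_sum C n (y n k v))))"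
      by (rule infsum_cong) (auto simp: g_def)
    also have "\<dots> = of_real (sqrt n ^ card (- C)) * (\<Sum>\<^sub>\<infinity>(k, v)\<in>?I. \<alpha> k * of_real (mon z v) * of_real (slice_sum C n (y n k v)))"
      by (rule infsum_cmult_right')
    also have "(\<Sum>\<^sub>\<infinity>(k, v)\<in>?I. \<alpha> k * of_real (mon z v) * of_real (slice_sum C n (y n k v)))
        = coeff_sum \<alpha> z n (\<kappa> n)"
      unfolding y_def by (rule coefficient_sum_eq[OF zC, symmetric])
    finally show ?thesis .
  qed
  moreover have "infsum (\<lambda>(k, v). \<alpha> k * of_real (mon z v) * of_real L) ?I
      = infsum \<alpha> UNIV * of_real (\<Prod>j\<in>- C. 1 / (1 - z $ j)) * of_real L"
  proof -
    have "infsum (\<lambda>(k, v). \<alpha> k * of_real (mon z v) * of_real L) ?I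
        = infsum (\<lambda>x. (case x of (k, v) \<Rightarrow> \<alpha> k * of_real (mon z v)) * of_real L) ?I"
      by (rule infsum_cong) auto
    also have "\<dots> = infsum (\<lambda>(k, v). \<alpha> k * of_real (mon z v)) ?I * of_real L"
      by (rule infsum_cmult_left')
    also have "infsum (\<lambda>(k, v). \<alpha> k * of_real (mon z v)) ?I = infsum \<alpha> UNIV * infsum (\<lambda>v. complex_of_real (mon z v)) (supp_in (- C))"
      by (rule infsum_product_norm[OF \<alpha> geoc])
    also have "infsum (\<lambda>v. complex_of_real (mon z v)) (supp_in (- C)) = of_real (\<Prod>j\<in>- C. 1 / (1 - z $ j))"
      unfolding geo(2)[symmetric] by (intro infsumI has_sum_of_real has_sum_infsum geo(1))
    finally show ?thesis .
  qed
  ultimately show ?thesis unfolding L_def by simp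
qed

end

section \<open>Translation back to the generating functions A and B\<close>

theorem theorem14:
  fixes b :: "('n::finite \<Rightarrow> nat) \<Rightarrow> real"
    and \<Omega> :: "(complex ^ 'n) set"
    and lam \<tau> :: "real ^ 'n"
    and a :: "('n \<Rightarrow> nat) \<Rightarrow> complex"
    and \<delta> :: real
    and \<kappa> :: "nat \<Rightarrow> 'n \<Rightarrow> nat"
  defines "K \<equiv> (\<lambda>t::real ^ 'n. ln (ps_eval b (\<chi> j. exp (t $ j))))"
      and "\<Psi> \<equiv> {t::real ^ 'n. (\<chi> j. complex_of_real (exp (t $ j))) \<in> \<Omega>}"
      and "\<zeta> \<equiv> (\<chi> j. exp (\<tau> $ j)) :: real ^ 'n"
      and "S \<equiv> {j. exp (\<tau> $ j) < 1}"
      and "C \<equiv> {j. exp (\<tau> $ j) = 1}"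
      and "H \<equiv> hessian (\<lambda>t::real ^ 'n. ln (ps_eval b (\<chi> j. exp (t $ j)))) \<tau>"
  assumes b_nonneg: "\<And>k. b k \<ge> 0"
      and b_full_rank: "full_rank b"
      and b_aperiodic: "aperiodic b"
      and \<Omega>_open: "open \<Omega>" and \<Omega>_0: "0 \<in> \<Omega>"
      and b_conv: "\<And>z. z \<in> \<Omega> \<Longrightarrow> (\<lambda>k. complex_of_real (b k) * mon z k) summable_on UNIV"
      and lam_pos: "\<And>j. lam $ j > 0"
      and \<tau>_in: "\<tau> \<in> \<Psi>"
      and \<tau>_min: "\<And>t. t \<in> \<Psi> \<Longrightarrow> K \<tau> - lam \<bullet> \<tau> \<le> K t - lam \<bullet> t"
      and \<zeta>_le1: "\<And>j. \<zeta> $ j \<le> 1"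
      and a_analytic: "\<exists>U. open U \<and> torus \<zeta> \<subseteq> U \<and>
                         (\<forall>z\<in>U. (\<lambda>k. a k * mon z k) summable_on UNIV)"
      and a_nonzero: "ps_eval a (\<chi> j. complex_of_real (\<zeta> $ j)) \<noteq> 0"
      and \<delta>_lt: "\<delta> < 1/2"
      and \<kappa>_asymp: "\<And>j. (\<lambda>n. real (\<kappa> n j) - lam $ j * real n) \<in> O(\<lambda>n. real n powr \<delta>)"
  shows "(\<lambda>n. ps_mult (ps_mult a (ps_pow (\<lambda>k. complex_of_real (b k)) n)) ps_geom (\<kappa> n))
         \<sim>[at_top]
         (\<lambda>n. complex_of_real
                 (ps_eval b \<zeta> ^ n / (\<Prod>j\<in>UNIV. (\<zeta> $ j) ^ \<kappa> n j)
                  / (\<Prod>j\<in>S. (1 - \<zeta> $ j))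
                  / sqrt ((2 * pi) ^ CARD('n) * real n ^ card S * det H)
                  * (LINT u | PiM C (\<lambda>_. lborel).
                       indicator {u. \<forall>i\<in>C. u i > 0} u *
                       exp (- (\<Sum>i\<in>C. \<Sum>j\<in>C. u i * matrix_inv H $ i $ j * u j) / 2)))
               * ps_eval a (\<chi> j. complex_of_real (\<zeta> $ j)))"
proof -
  define Bz where "Bz = ps_eval b \<zeta>"
  define p where "p k = b k * mon \<zeta> k / Bz" for k
  have mon\<zeta>: "mon \<zeta> k = exp (\<tau> \<bullet> rvec k)" for k unfolding \<zeta>_def by (rule mon_exp)
  have mon\<zeta>_pos: "mon \<zeta> k > 0" for k by (simp add: mon\<zeta>)
  have conv: "(\<lambda>k. b k * exp (t \<bullet> rvec k)) summable_on UNIV" if "t \<in> \<Psi>" for t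
  proof -
    have "(\<lambda>k. complex_of_real (b k) * mon (\<chi> j. complex_of_real (exp (t $ j))) k) summable_on UNIV"
      using that by (intro b_conv) (simp add: \<Psi>_def)
    from summable_on_Re[OF this] show ?thesis by (simp add: mon_of_real_exp)
  qed
  have "open \<Psi>"
    unfolding \<Psi>_def vimage_def[symmetric]
    by (intro open_vimage \<Omega>_open continuous_on_vec_lambda continuous_intros)
  then obtain \<rho> where \<rho>: "\<rho> > 0" "ball \<tau> \<rho> \<subseteq> \<Psi>" using \<tau>_in open_contains_ball by blast
  \<comment> \<open>The l1 norm bounds the Euclidean norm, so the cube of half-side r around \<tau>
    lies in the ball of radius \<rho>.\<close>
  define r where "r = \<rho> / (2 * CARD('n))"
  have r: "r > 0" using \<rho> by (simp add: r_def)
  have near: "\<tau> + s \<in> \<Psi>" if s: "\<And>j. \<bar>s $ j\<bar> \<le> r" for s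
  proof -
    have "norm s \<le> (\<Sum>j\<in>UNIV. \<bar>s $ j\<bar>)" by (rule norm_le_l1_cart)
    also have "\<dots> \<le> (\<Sum>j\<in>(UNIV::'n set). r)" by (intro sum_mono s)
    also have "\<dots> = \<rho> / 2" by (simp add: r_def)
    finally have "dist \<tau> (\<tau> + s) < \<rho>" using \<rho> by (simp add: dist_norm)
    then show ?thesis using \<rho> by auto
  qed
  \<comment> \<open>For the zero series the set of differences is empty and spans dimension 0,
    contrary to full rank.\<close>
  have "\<exists>k0. b k0 \<noteq> 0"
  proof (rule ccontr)
    assume "\<not> (\<exists>k0. b k0 \<noteq> 0)"
    then have "ps_support b = {}" by (simp add: ps_support_def)
    then show False using b_full_rank by (simp add: full_rank_def)
  qed
  then obtain k0 where k0: "b k0 > 0" using b_nonneg by (metis less_eq_real_def)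
  have lapB: "ps_eval b (\<chi> j. exp (t $ j)) = lap b t" for t
    by (simp add: ps_eval_def lap_def mon_exp)
  have Bz_pos: "Bz > 0"
    unfolding Bz_def \<zeta>_def lapB by (rule lap_pos[OF conv[OF \<tau>_in] b_nonneg k0])
  have p_exp: "p k = b k * exp (\<tau> \<bullet> rvec k) / Bz" for k by (simp add: p_def mon\<zeta>)
  have p_nonneg: "p k \<ge> 0" for k using b_nonneg Bz_pos by (simp add: p_exp)
  have p0: "p k0 > 0" using k0 Bz_pos by (simp add: p_exp)
  have p_tilt: "p k * exp (s \<bullet> rvec k) = 1 / Bz * (b k * exp ((\<tau> + s) \<bullet> rvec k))" for s k
    by (simp add: p_exp inner_add_left exp_add)
  have lap_p: "lap b (\<tau> + s) = Bz * lap p s" for s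
  proof -
    have "lap p s = (\<Sum>\<^sub>\<infinity>k. 1 / Bz * (b k * exp ((\<tau> + s) \<bullet> rvec k)))" unfolding lap_def p_tilt ..
    also have "\<dots> = 1 / Bz * lap b (\<tau> + s)" unfolding lap_def by (rule infsum_cmult_right')
    finally show ?thesis using Bz_pos by simp
  qed
  have p_summ: "(\<lambda>k. p k * exp (s \<bullet> rvec k)) summable_on UNIV" if "\<And>j. \<bar>s $ j\<bar> \<le> r" for s
    unfolding p_tilt by (intro summable_on_cmult_right conv near that)
  have lap_p_pos: "lap p s > 0" if "\<And>j. \<bar>s $ j\<bar> \<le> r" for s
    by (rule lap_pos[OF p_summ[OF that] p_nonneg p0])
  have p_deg: "(\<lambda>k. p k * exp (r * deg k)) summable_on UNIV"
  proof -
    have "(\<chi> j. r) \<bullet> rvec k = r * deg k" for k :: "'n \<Rightarrow> nat"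
      by (simp add: inner_vec_def rvec_def deg_def sum_distrib_left)
    then show ?thesis using p_summ[of "\<chi> j. r"] r by simp
  qed
  then have p_abs: "(\<lambda>k. \<bar>p k\<bar> * exp (r * deg k)) summable_on UNIV" using p_nonneg by simp
  have p_one: "lap p 0 = 1" using lap_p[of 0] Bz_pos unfolding Bz_def \<zeta>_def lapB by simp
  have K: "K t = ln (Bz * lap p (t - \<tau>))" for t
    unfolding K_def lapB using lap_p[of "t - \<tau>"] by simp
  have mean: "lap (\<lambda>k. p k * real (k j)) 0 = lam $ j" for j
  proof -
    \<comment> \<open>Since \<Psi> contains a cube around \<tau>, the restriction to axis j has an
      interior minimum at 0, so its derivative, mean minus \<open>lam $ j\<close>, vanishes.\<close>
    define g where "g \<rho> = K (\<tau> + \<rho> *\<^sub>R axis j 1) - lam \<bullet> (\<tau> + \<rho> *\<^sub>R axis j 1)" for \<rho>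
    have "((\<lambda>\<rho>. ln (Bz * lap p (0 + \<rho> *\<^sub>R axis j 1))) has_real_derivative lap (\<lambda>k. p k * real (k j)) 0 / lap p 0) (at 0)"
      by (rule ln_lap_has_derivative[OF p_abs _ Bz_pos]) (use r p_one in auto)
    then have "((\<lambda>\<rho>. ln (Bz * lap p (0 + \<rho> *\<^sub>R axis j 1)) - (lam \<bullet> \<tau> + \<rho> * lam $ j)) has_real_derivative lap (\<lambda>k. p k * real (k j)) 0 / lap p 0 - (0 + 1 * lam $ j)) (at 0)"
      by (intro DERIV_diff DERIV_add DERIV_const DERIV_cmult_right DERIV_ident)
    then have d: "(g has_real_derivative lap (\<lambda>k. p k * real (k j)) 0 - lam $ j) (at 0)"
      by (simp add: g_def[abs_def] K p_one inner_add_right inner_axis)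
    have "g 0 \<le> g y" if "\<bar>0 - y\<bar> < r" for y
    proof -
      have "\<tau> + y *\<^sub>R axis j 1 \<in> \<Psi>" by (rule near) (use that r in \<open>auto simp: axis_def\<close>)
      then show ?thesis using \<tau>_min by (simp add: g_def)
    qed
    then have "lap (\<lambda>k. p k * real (k j)) 0 - lam $ j = 0"
      by (intro DERIV_local_min[OF d r]) auto
    then show ?thesis by simp
  qed
  have r2: "r / 2 < r" using r by simp
  have wsumm: "(\<lambda>k. p k * real (k j)) summable_on UNIV" for j
    using lap_summable[OF lap_weight_summable[OF p_abs r2, of j], of 0] r by simp
  \<comment> \<open>Full rank and aperiodicity depend only on the support, which multiplication by
    positive factors preserves.\<close>
  have supp: "ps_support p = ps_support b"
    using Bz_pos mon\<zeta>_pos by (auto simp: ps_support_def p_def) (metis less_irrefl)+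
  \<comment> \<open>The locale asks for the exponential moment at twice its parameter, here exactly
    the available radius r.\<close>
  interpret lattice_dist p lam "r / 2"
  proof
    show "p k \<ge> 0" for k by (rule p_nonneg)
    show "r / 2 > 0" using r by simp
    show "(\<lambda>k. p k * exp (2 * (r / 2) * deg k)) summable_on UNIV" using p_deg by simp
    show "(p has_sum 1) UNIV"
      using has_sum_infsum[OF p_summ[of 0]] p_one r by (simp add: lap_def)
    show "((\<lambda>k. p k * real (k j)) has_sum lam $ j) UNIV" for j
      using has_sum_infsum[OF wsumm[of j]] mean[of j] by (simp add: lap_def)
    show "full_rank p" using b_full_rank by (simp add: full_rank_def supp)
    show "aperiodic p" using b_aperiodic by (simp add: aperiodic_def q_periodic_def supp)
  qed
  have H: "H = cov"
  proof -
    have "H = hessian (\<lambda>t. ln (Bz * lap p (t - \<tau>))) \<tau>" using K unfolding H_def K_def by simp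
    then have "H $ i $ j = cov $ i $ j" for i j
      using hessian_ln_lap[OF p_abs r Bz_pos _ p_one, of \<tau> i j] lap_p_pos
      by (simp add: cov_eq mean less_imp_le)
    then show ?thesis by (simp add: vec_eq_iff)
  qed
  have S: "S = - C"
  proof -
    have "exp (\<tau> $ j) \<le> 1" for j using \<zeta>_le1[of j] by (simp add: \<zeta>_def)
    then show ?thesis by (auto simp: S_def C_def less_le)
  qed
  define \<alpha> where "\<alpha> k = a k * of_real (mon \<zeta> k)" for k
  have mon_c: "mon (\<chi> j. complex_of_real (\<zeta> $ j)) k = of_real (mon \<zeta> k)" for k
    by (simp add: mon_def)
  \<comment> \<open>Convergence is used at the positive point of the torus; for complex families
    unordered summability is absolute.\<close>
  have \<alpha>: "(\<lambda>k. norm (\<alpha> k)) summable_on UNIV"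
  proof -
    obtain U where U: "torus \<zeta> \<subseteq> U" "\<forall>z\<in>U. (\<lambda>k. a k * mon z k) summable_on UNIV" using a_analytic by blast
    have "(\<chi> j. complex_of_real (\<zeta> $ j)) \<in> torus \<zeta>" by (simp add: torus_def \<zeta>_def)
    then have "(\<lambda>k. a k * mon (\<chi> j. complex_of_real (\<zeta> $ j)) k) summable_on UNIV" using U by blast
    then show ?thesis by (simp add: summable_on_iff_abs_summable_on_complex mon_c \<alpha>_def)
  qed
  have \<alpha>_sum: "infsum \<alpha> UNIV = ps_eval a (\<chi> j. complex_of_real (\<zeta> $ j))"
    by (simp add: ps_eval_def mon_c \<alpha>_def[abs_def])
  \<comment> \<open>Here \<delta> < 1/2 enters: the error divided by sqrt n is O(n^(\<delta> -
    1/2)).\<close>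
  have \<kappa>: "(\<lambda>n. (real (\<kappa> n j) - n * lam $ j) / sqrt n) \<longlonglongrightarrow> 0" for j
  proof -
    obtain c where c: "\<forall>\<^sub>F n in at_top. norm (real (\<kappa> n j) - lam $ j * real n) \<le> c * norm (real n powr \<delta>)"
      using landau_o.bigE[OF \<kappa>_asymp[of j]] by blast
    have "\<forall>\<^sub>F n in sequentially. norm ((real (\<kappa> n j) - n * lam $ j) / sqrt n) \<le> c * real n powr (\<delta> - 1 / 2)"
      using c eventually_gt_at_top[of 0]
    proof eventually_elim
      case (elim n)
      have "norm ((real (\<kappa> n j) - n * lam $ j) / sqrt n) \<le> c * (real n powr \<delta>) / sqrt n"
        using elim by (simp add: divide_right_mono mult.commute)
      also have "\<dots> = c * real n powr (\<delta> - 1 / 2)"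
        using elim by (simp add: powr_diff powr_half_sqrt)
      finally show ?case .
    qed
    moreover have "(\<lambda>n. real n powr (\<delta> - 1 / 2)) \<longlonglongrightarrow> 0"
      by (rule tendsto_neg_powr[OF _ filterlim_real_sequentially]) (use \<delta>_lt in simp)
    then have "(\<lambda>n. c * real n powr (\<delta> - 1 / 2)) \<longlonglongrightarrow> 0"
      by (rule tendsto_mult_right_zero)
    ultimately show ?thesis by (rule Lim_null_comparison)
  qed
  define q where "q = sqrt ((2 * pi) ^ CARD('n) * det cov)"
  have q: "q > 0" using det_pos_def[OF cov_symmetric cov_pos_def] by (simp add: q_def)
  define PS where "PS = (\<Prod>j\<in>- C. 1 - \<zeta> $ j)"
  have PS: "PS \<noteq> 0" unfolding PS_def S[symmetric] by (auto simp: S_def \<zeta>_def)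
  define \<Lambda> where "\<Lambda> = ps_eval a (\<chi> j. complex_of_real (\<zeta> $ j)) * of_real (1 / PS) * of_real (orthant_mass C / q)"
  define t where "t n = (of_real (sqrt n ^ card (- C)) *
      coeff_sum \<alpha> \<zeta> n (\<kappa> n))" for n
  have "t \<longlonglongrightarrow> infsum \<alpha> UNIV * of_real (\<Prod>j\<in>- C. 1 / (1 - \<zeta> $ j)) * of_real (orthant_mass C / sqrt ((2 * pi) ^ CARD('n) * det cov))"
    unfolding t_def[abs_def]
  proof (rule coefficient_limit[OF \<alpha> _ _ _ \<kappa>])
    show "0 < \<zeta> $ j" for j by (simp add: \<zeta>_def)
    show "\<zeta> $ j < 1" if "j \<notin> C" for j
    proof -
      have "j \<in> S" using that S by simp
      then show ?thesis by (simp add: S_def \<zeta>_def)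
    qed
    show "\<zeta> $ j = 1" if "j \<in> C" for j using that by (simp add: C_def \<zeta>_def)
  qed
  then have t: "t \<longlonglongrightarrow> \<Lambda>"
    by (simp add: \<Lambda>_def \<alpha>_sum PS_def q_def prod_dividef)
  have x: "\<And>j. (\<lambda>n. (of_int (int (\<kappa> n j)) - n * lam $ j) / sqrt n) \<longlonglongrightarrow> 0" using \<kappa> by simp
  \<comment> \<open>A nonzero limit turns convergence of the normalised coefficient into asymptotic
    equivalence, as the ratio then tends to 1.\<close>
  have \<Lambda>0: "\<Lambda> \<noteq> 0"
    using a_nonzero PS q orthant_mass_pos[OF x, of C] by (simp add: \<Lambda>_def)
  let ?c = "\<lambda>n. ps_mult (ps_mult a (ps_pow (\<lambda>k. complex_of_real (b k)) n)) ps_geom (\<kappa> n)"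
  \<comment> \<open>The deterministic factor. Division by a power of sqrt 0 can make
    \<open>D 0\<close> zero, so the coefficient is compared with it only for n > 0.\<close>
  define D where "D n = complex_of_real (Bz ^ n / mon \<zeta> (\<kappa> n) / sqrt n ^ card (- C))" for n :: nat
  have D0: "D n \<noteq> 0" if "n > 0" for n using that Bz_pos mon\<zeta>_pos[of "\<kappa> n"] by (simp add: D_def)
  have lhs: "?c n = D n * t n" if n: "n > 0" for n
  proof -
    have summand: "a k * complex_of_real (ps_pow b n (\<lambda>j. \<kappa> n j - k j - m j))
        = of_real (Bz ^ n / mon \<zeta> (\<kappa> n)) * (\<alpha> k * of_real (mon \<zeta> m * pn n (\<lambda>j. \<kappa> n j - k j - m j)))"
      if km: "\<forall>j. k j + m j \<le> \<kappa> n j" for k m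
    proof -
      \<comment> \<open>The exponents k, m and l add up to \<kappa> n, so the three monomials
        introduced by the normalisation multiply to \<zeta>^\<kappa> and cancel against it.\<close>
      define l where "l = (\<lambda>j. \<kappa> n j - k j - m j)"
      have "\<kappa> n = (\<lambda>j. (k j + m j) + l j)" using km by (auto simp: l_def)
      then have mm: "mon \<zeta> (\<kappa> n) = mon \<zeta> k * mon \<zeta> m * mon \<zeta> l" by (metis mon_add)
      have "pn n l = ps_pow b n l * mon \<zeta> l / Bz ^ n"
        unfolding p_def[abs_def] by (rule ps_pow_scale) (use Bz_pos in simp)
      then have "Bz ^ n / mon \<zeta> (\<kappa> n) * (mon \<zeta> k * (mon \<zeta> m * pn n l)) = ps_pow b n l"
        using mon\<zeta>_pos[of k] mon\<zeta>_pos[of m] mon\<zeta>_pos[of l] Bz_pos by (simp add: mm)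
      then have "a k * complex_of_real (ps_pow b n l) = a k * complex_of_real (Bz ^ n / mon \<zeta> (\<kappa> n) * (mon \<zeta> k * (mon \<zeta> m * pn n l)))" by simp
      then show ?thesis unfolding l_def[symmetric] \<alpha>_def of_real_mult by (simp only: mult_ac)
    qed
    have "?c n
        = (\<Sum>(k, m)\<in>{(k, m). \<forall>j. k j + m j \<le> \<kappa> n j}. a k * complex_of_real (ps_pow b n (\<lambda>j. \<kappa> n j - k j - m j)))"
      unfolding ps_mult_geom ps_pow_of_real ..
    also have "\<dots> = (\<Sum>x\<in>{(k, m). \<forall>j. k j + m j \<le> \<kappa> n j}. of_real (Bz ^ n / mon \<zeta> (\<kappa> n)) *
        (case x of (k, m) \<Rightarrow> \<alpha> k * of_real (mon \<zeta> m * pn n (\<lambda>j. \<kappa> n j - k j - m j))))"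
    proof (rule sum.cong[OF refl])
      fix x :: "('n \<Rightarrow> nat) \<times> ('n \<Rightarrow> nat)"
      assume x: "x \<in> {(k, m). \<forall>j. k j + m j \<le> \<kappa> n j}"
      obtain k m where km: "x = (k, m)" by (cases x)
      show "(case x of (k, m) \<Rightarrow> a k * complex_of_real (ps_pow b n (\<lambda>j. \<kappa> n j - k j - m j)))
        = of_real (Bz ^ n / mon \<zeta> (\<kappa> n)) * (case x of (k, m) \<Rightarrow> \<alpha> k * of_real (mon \<zeta> m * pn n (\<lambda>j. \<kappa> n j - k j - m j)))"
        unfolding km prod.case by (rule summand) (use x km in simp)
    qed
    also have "\<dots> = of_real (Bz ^ n / mon \<zeta> (\<kappa> n)) * coeff_sum \<alpha> \<zeta> n (\<kappa> n)"
      by (rule sum_distrib_left[symmetric])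
    also have "\<dots> = D n * t n"
      using n by (simp add: D_def t_def)
    finally show ?thesis .
  qed
  have rhs: "complex_of_real
                 (ps_eval b \<zeta> ^ n / (\<Prod>j\<in>UNIV. (\<zeta> $ j) ^ \<kappa> n j)
                  / (\<Prod>j\<in>S. (1 - \<zeta> $ j))
                  / sqrt ((2 * pi) ^ CARD('n) * real n ^ card S * det H)
                  * (LINT u | leb C.
                       indicator (orthant C) u *
                       exp (- (\<Sum>i\<in>C. \<Sum>j\<in>C. u i * matrix_inv H $ i $ j * u j) / 2)))
               * ps_eval a (\<chi> j. complex_of_real (\<zeta> $ j)) = D n * \<Lambda>" for n
  proof -
    have sq: "sqrt ((2 * pi) ^ CARD('n) * real n ^ card S * det H) = q * sqrt n ^ card (- C)"
      by (simp add: q_def H S real_sqrt_mult real_sqrt_power)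
    have pr: "(\<Prod>j\<in>S. 1 - \<zeta> $ j) = PS" by (simp add: S PS_def)
    have om: "(LINT u | leb C. indicator (orthant C) u *
        exp (- (\<Sum>i\<in>C. \<Sum>j\<in>C. u i * matrix_inv H $ i $ j * u j) / 2)) = orthant_mass C"
      by (simp only: orthant_mass_def H)
    show ?thesis
      unfolding sq pr om Bz_def[symmetric] mon_def[symmetric] D_def \<Lambda>_def by (simp add: mult_ac)
  qed
  have "(\<lambda>n. t n / \<Lambda>) \<longlonglongrightarrow> \<Lambda> / \<Lambda>" by (intro tendsto_divide t tendsto_const \<Lambda>0)
  then have "(\<lambda>n. t n / \<Lambda>) \<longlonglongrightarrow> 1" using \<Lambda>0 by simp
  moreover have "\<forall>\<^sub>F n in sequentially. t n / \<Lambda> = ?c n / (D n * \<Lambda>)"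
    using eventually_gt_at_top[of 0] by eventually_elim (simp add: lhs D0)
  ultimately have "(\<lambda>n. ?c n / (D n * \<Lambda>)) \<longlonglongrightarrow> 1"
    by (rule Lim_transform_eventually)
  then show ?thesis unfolding rhs by (rule asymp_equivI')
qed

end
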